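(* Let $G$ be a connected graph with maximum degree $\Delta \leq 5$ in which every non-trivial automorphism moves infinitely many vertices. Then $D(G) \leq 2$.
   Context: All graphs are simple, connected and locally finite. A distinguishing $k$-colouring of a graph $G=(V,E)$ is a map $c\colon V\to\{0,\dots,k-1\}$ such that the identity is the only automorphism $\gamma$ of $G$ with $c\circ\gamma=c$. The distinguishing number $D(G)$ is the least $k$ such that $G$ admits a distinguishing $k$-colouring. *)

theory Defs
  imports Main
begin

text \<open>A graph is given by its vertex type 'a (vertex set = UNIV) and an
adjacency relation E.\<close>

definition simple_graph :: "('a \<Rightarrow> 'a \<Rightarrow> bool) \<Rightarrow> bool" where
  "simple_graph E \<longleftrightarrow> (\<forall>u v. E u v \<longrightarrow> E v u) \<and> (\<forall>v. \<not> E v v)"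

definition connected_graph :: "('a \<Rightarrow> 'a \<Rightarrow> bool) \<Rightarrow> bool" where
  "connected_graph E \<longleftrightarrow> (\<forall>u v. (u, v) \<in> {(x, y). E x y}\<^sup>*)"

definition neighbours :: "('a \<Rightarrow> 'a \<Rightarrow> bool) \<Rightarrow> 'a \<Rightarrow> 'a set" where
  "neighbours E v = {w. E v w}"

text \<open>Maximum degree at most d (each neighbourhood finite of size at most d).\<close>
definition max_degree_le :: "('a \<Rightarrow> 'a \<Rightarrow> bool) \<Rightarrow> nat \<Rightarrow> bool" where
  "max_degree_le E d \<longleftrightarrow> (\<forall>v. finite (neighbours E v) \<and> card (neighbours E v) \<le> d)"

definition graph_aut :: "('a \<Rightarrow> 'a \<Rightarrow> bool) \<Rightarrow> ('a \<Rightarrow> 'a) \<Rightarrow> bool" where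
  "graph_aut E \<gamma> \<longleftrightarrow> bij \<gamma> \<and> (\<forall>u v. E u v \<longleftrightarrow> E (\<gamma> u) (\<gamma> v))"

text \<open>Infinite motion: every non-trivial automorphism moves infinitely many vertices.\<close>
definition infinite_motion :: "('a \<Rightarrow> 'a \<Rightarrow> bool) \<Rightarrow> bool" where
  "infinite_motion E \<longleftrightarrow> (\<forall>\<gamma>. graph_aut E \<gamma> \<and> \<gamma> \<noteq> id \<longrightarrow> infinite {v. \<gamma> v \<noteq> v})"

definition distinguishing_colouring :: "('a \<Rightarrow> 'a \<Rightarrow> bool) \<Rightarrow> nat \<Rightarrow> ('a \<Rightarrow> nat) \<Rightarrow> bool" where
  "distinguishing_colouring E k c \<longleftrightarrow>
     (\<forall>v. c v < k) \<and> (\<forall>\<gamma>. graph_aut E \<gamma> \<and> c \<circ> \<gamma> = c \<longrightarrow> \<gamma> = id)"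

definition distinguishing_number :: "('a \<Rightarrow> 'a \<Rightarrow> bool) \<Rightarrow> nat" where
  "distinguishing_number E = (LEAST k. \<exists>c. distinguishing_colouring E k c)"

end

theory Submission
  imports Defs "HOL-Library.Countable_Set"
begin

text \<open>
  Fix a root r and colour the spheres around r one after the other. \<open>Gam c n\<close> is the group of
  automorphisms fixing r and preserving the colours up to distance n. By a local argument on each of
  its orbits, the next sphere can be coloured so that all orbits of the new group have at most three
  points, that orbits of size three have a common set of parents, and that no automorphism can move
  a pair whose two points have different children. Every element of the new group then preserves
  adjacency after being replaced by the identity beyond the previous level, so it is trivial there by
  infinite motion. Hence a colouring of this kind is preserved by no automorphism fixing r except
  the identity.

  It remains to destroy the automorphisms taking r to a given \<open>r' \<noteq> r\<close>. Suppose that every such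
  colouring extending a given finite part is preserved by one of them. Recolouring an orbit by
  exchanging the colours does not change the groups \<open>Gam\<close>, and comparing the number of black
  vertices in the balls around r and \<open>r'\<close> shows that all large balls around r and \<open>r'\<close> coincide.
  Then the automorphism normalises the groups \<open>Gam\<close> and, again by recolouring, maps each orbit
  at a large distance to itself; truncating it on the fixed points of \<open>Gam\<close> contradicts infinite motion.
  By compactness finitely many colours suffice to exclude \<open>r'\<close>, and the countably many
  \<open>r'\<close> are treated in turn.
\<close>

section \<open>Transitive actions with labels\<close>

text \<open>The degree bound enters through small numbers. A vertex other than the root has a
  parent, hence at most four children, so at most four points share a label value. An orbit of at
  most three points has at most three subsets of a given size, so a label takes two or three values.
  An orbit with labels thus has at most twelve points, one without labels at most five. The obstacle
  is an orbit with as many black as white points, since exchanging its colours cannot be seen by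
  counting. Balance is accepted in two cases only: all points are fixed and have different parent
  sets, or the orbit consists of the children, four each, of a three-point orbit. The second case
  arises because three classes of four points need the counts 1, 2, 3 to be told apart without a
  class of one colour, and 1 + 2 + 3 is half of twelve. It is tamed by the degree again: four
  children leave room for one parent, so such orbits on consecutive levels force a vertex with a
  single, fixed parent, and its orbit is unbalanced.\<close>

text \<open>In the application U is an orbit on some level, and each label of a vertex is its set of parents
  inside one orbit of the previous level; labels that are constant on U are discarded.\<close>
locale labelled_action =
  fixes G :: "('a \<Rightarrow> 'a) set" and U :: "'a set" and L :: "('a \<Rightarrow> 'b) set"
  assumes finU: "finite U" and neU: "U \<noteq> {}"
    and maps: "g \<in> G \<Longrightarrow> u \<in> U \<Longrightarrow> g u \<in> U"
    and injG: "g \<in> G \<Longrightarrow> inj_on g U"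
    and trans: "u \<in> U \<Longrightarrow> v \<in> U \<Longrightarrow> \<exists>g\<in>G. g u = v"
    and lab: "l \<in> L \<Longrightarrow> g \<in> G \<Longrightarrow> u \<in> U \<Longrightarrow> v \<in> U \<Longrightarrow> l (g u) = l (g v) \<longleftrightarrow> l u = l v"
    and card_lab: "l \<in> L \<Longrightarrow> card (l ` U) = 2 \<or> card (l ` U) = 3"
    and block_le: "l \<in> L \<Longrightarrow> u \<in> U \<Longrightarrow> card {v \<in> U. l v = l u} \<le> 4"
    and small: "L = {} \<Longrightarrow> card U \<le> 5"
begin

section \<open>Classes of equal labels and the requirements on the colouring of one orbit\<close>

definition cls :: "('a \<Rightarrow> 'b) set \<Rightarrow> 'a \<Rightarrow> 'a set" where
  "cls M u = {v \<in> U. \<forall>l\<in>M. l v = l u}"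

definition Stab :: "'a set \<Rightarrow> ('a \<Rightarrow> 'a) set" where
  "Stab t = {g \<in> G. \<forall>u\<in>U. g u \<in> t \<longleftrightarrow> u \<in> t}"

definition movable :: "'a set \<Rightarrow> 'a set" where
  "movable t = {u \<in> U. \<exists>g\<in>Stab t. g u \<noteq> u}"

text \<open>This is what makes \<open>G1\<close> pass to the next level: in the application a class
  of all labels consists of the points with the same parents.\<close>

definition small_orbits :: "'a set \<Rightarrow> bool" where
  "small_orbits t \<longleftrightarrow> (\<forall>u\<in>U. card ((\<lambda>g. g u) ` Stab t) \<le> 3 \<and>
     (card ((\<lambda>g. g u) ` Stab t) = 3 \<longrightarrow> (\<lambda>g. g u) ` Stab t \<subseteq> cls L u))"

text \<open>One class that stays in place is enough for \<open>G2\<close>: its parents form a set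
  preserved by the whole stabiliser.\<close>

definition fixes_class :: "'a set \<Rightarrow> bool" where
  "fixes_class t \<longleftrightarrow> (\<exists>u\<in>U. \<forall>g\<in>Stab t. g u \<in> cls L u)"

text \<open>Colour and black count are also kept by an automorphism that moves the root, if it maps
  the orbit to itself and respects parents and colours. Among at most three points, two orbits of
  size at least two must meet; this will force such an automorphism to keep the orbits of the new
  group.\<close>

definition isolating :: "'a set \<Rightarrow> bool" where
  "isolating t \<longleftrightarrow> (\<forall>u\<in>U. card {v \<in> movable t. (v \<in> t \<longleftrightarrow> u \<in> t) \<and>
      card (cls L v \<inter> t) = card (cls L u \<inter> t)} \<le> 3)"

definition rigid :: "'a set \<Rightarrow> bool" where
  "rigid t \<longleftrightarrow> (\<forall>g\<in>Stab t. \<forall>u\<in>U. g u = u) \<and> (\<forall>u\<in>U. cls L u = {u})"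

text \<open>The exception left by the counts 1, 2, 3 on three blocks of four points. The fixed point
  is what a descent through consecutive levels will exploit.\<close>

definition full_triple :: "'a set \<Rightarrow> bool" where
  "full_triple t \<longleftrightarrow> (\<exists>u\<in>U. \<forall>g\<in>Stab t. g u = u) \<and>
     (\<exists>l\<in>L. card (l ` U) = 3 \<and> (\<forall>u\<in>U. card {v \<in> U. l v = l u} = 4))"

definition fine :: "'a set \<Rightarrow> bool" where
  "fine t \<longleftrightarrow> t \<subseteq> U \<and> small_orbits t \<and> fixes_class t \<and> isolating t \<and>
     (2 * card t \<noteq> card U \<or> rigid t \<or> full_triple t)"

lemma cls_finite [simp]: "finite (cls M u)"
  unfolding cls_def using finU by auto

lemma cls_sub: "cls M u \<subseteq> U"
  unfolding cls_def by auto

lemma cls_self [simp]: "u \<in> U \<Longrightarrow> u \<in> cls M u"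
  unfolding cls_def by auto

lemma cls_eq: "v \<in> cls M u \<Longrightarrow> cls M v = cls M u"
  unfolding cls_def by auto

lemma cls_eq_iff: "u \<in> U \<Longrightarrow> v \<in> U \<Longrightarrow> cls M v = cls M u \<longleftrightarrow> v \<in> cls M u"
  using cls_eq cls_self by blast

lemma cls_disj: "cls M v \<noteq> cls M u \<Longrightarrow> cls M v \<inter> cls M u = {}"
  using cls_eq by blast

lemma cls_disjoint: "pairwise disjnt (cls M ` A)"
  unfolding pairwise_def disjnt_def
proof (intro ballI impI)
  fix X Y assume "X \<in> cls M ` A" "Y \<in> cls M ` A" "X \<noteq> Y"
  then obtain u v where "X = cls M u" "Y = cls M v" "cls M u \<noteq> cls M v" by auto
  then show "X \<inter> Y = {}" using cls_disj[of M u v] by simp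
qed

lemma cls_map: "M \<subseteq> L \<Longrightarrow> g \<in> G \<Longrightarrow> u \<in> U \<Longrightarrow> v \<in> U \<Longrightarrow> g v \<in> cls M (g u) \<longleftrightarrow> v \<in> cls M u"
  unfolding cls_def using lab maps by blast

lemma cls_image_sub: "M \<subseteq> L \<Longrightarrow> g \<in> G \<Longrightarrow> u \<in> U \<Longrightarrow> g ` cls M u \<subseteq> cls M (g u)"
  using cls_map cls_sub by blast

lemma cls_card_le:
  assumes "M \<subseteq> L" "u \<in> U" "v \<in> U" shows "card (cls M u) \<le> card (cls M v)"
proof -
  obtain g where g: "g \<in> G" "g u = v" using trans assms by blast
  have "card (g ` cls M u) = card (cls M u)"
    by (rule card_image) (meson cls_sub g(1) injG inj_on_subset)
  moreover have "card (g ` cls M u) \<le> card (cls M v)"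
    using cls_image_sub[OF assms(1) g(1) assms(2)] g(2) by (simp add: card_mono)
  ultimately show ?thesis by simp
qed

lemma cls_card: "M \<subseteq> L \<Longrightarrow> u \<in> U \<Longrightarrow> v \<in> U \<Longrightarrow> card (cls M u) = card (cls M v)"
  by (simp add: cls_card_le le_antisym)

lemma cls_image:
  assumes "M \<subseteq> L" "g \<in> G" "u \<in> U" shows "g ` cls M u = cls M (g u)"
proof (rule card_subset_eq)
  show "g ` cls M u \<subseteq> cls M (g u)" using cls_image_sub assms by blast
  have "card (g ` cls M u) = card (cls M u)"
    by (rule card_image) (meson cls_sub assms(2) injG inj_on_subset)
  then show "card (g ` cls M u) = card (cls M (g u))"
    using cls_card assms maps by metis
qed simp

lemma cls_count:
  assumes "M \<subseteq> L" "g \<in> Stab t" "u \<in> U"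
  shows "card (cls M (g u) \<inter> t) = card (cls M u \<inter> t)"
proof -
  have g: "g \<in> G" using assms(2) by (simp add: Stab_def)
  have "cls M (g u) \<inter> t = g ` (cls M u \<inter> t)"
    unfolding cls_image[OF assms(1) g assms(3), symmetric]
    using assms(2) cls_sub by (auto simp: Stab_def) blast+
  moreover have "inj_on g (cls M u \<inter> t)"
    by (meson cls_sub g injG inj_on_subset inf.coboundedI1)
  ultimately show ?thesis by (simp add: card_image)
qed

lemma card_cls_decomp:
  assumes "M \<subseteq> L" "u \<in> U" shows "card U = card (cls M u) * card (cls M ` U)"
proof -
  have "card (\<Union> (cls M ` U)) = (\<Sum>X\<in>cls M ` U. card X)"
  proof (rule card_Union_disjoint)
    show "pairwise disjnt (cls M ` U)" by (rule cls_disjoint)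
  qed auto
  also have "\<dots> = (\<Sum>X\<in>cls M ` U. card (cls M u))"
  proof (rule sum.cong)
    fix X assume "X \<in> cls M ` U"
    then obtain v where "v \<in> U" "X = cls M v" by blast
    then show "card X = card (cls M u)" using cls_card[OF assms(1) _ assms(2)] by simp
  qed simp
  also have "\<Union> (cls M ` U) = U" by (auto simp: cls_def)
  finally show ?thesis by (simp add: mult.commute)
qed

text \<open>Classes are disjoint, so points can be chosen in each class separately and finding
  \<open>t\<close> is reduced to finding numbers. It is applied to the classes of all labels and to
  the blocks of a single one.\<close>

lemma prescribed:
  assumes "\<And>u. u \<in> U \<Longrightarrow> \<tau> (cls M u) \<le> card (cls M u)"
  obtains t where "t \<subseteq> U" "\<And>u. u \<in> U \<Longrightarrow> card (cls M u \<inter> t) = \<tau> (cls M u)"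
    "card t = (\<Sum>X\<in>cls M ` U. \<tau> X)"
proof -
  have "\<forall>X\<in>cls M ` U. \<exists>Y. Y \<subseteq> X \<and> card Y = \<tau> X"
    using assms by (metis (no_types, lifting) image_iff obtain_subset_with_card_n)
  then obtain f where f: "\<And>X. X \<in> cls M ` U \<Longrightarrow> f X \<subseteq> X \<and> card (f X) = \<tau> X"
    by metis
  define t where "t = (\<Union>X\<in>cls M ` U. f X)"
  have tU: "t \<subseteq> U" unfolding t_def using f cls_sub by blast
  have int: "cls M u \<inter> t = f (cls M u)" if "u \<in> U" for u
  proof -
    have "x \<in> f (cls M u)" if x: "x \<in> cls M u" "v \<in> U" "x \<in> f (cls M v)" for x v
    proof -
      have "x \<in> cls M v" using f x by blast
      then have "cls M v = cls M u" using x cls_eq by blast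
      then show ?thesis using x by simp
    qed
    then show ?thesis unfolding t_def using f that by blast
  qed
  have "card t = (\<Sum>X\<in>cls M ` U. card (f X))"
    unfolding t_def
  proof (rule card_UN_disjoint)
    show "finite (cls M ` U)" using finU by simp
    show "\<forall>i\<in>cls M ` U. finite (f i)"
    proof
      fix X assume X: "X \<in> cls M ` U"
      then have "f X \<subseteq> X" "finite X" using f by auto
      then show "finite (f X)" by (rule finite_subset)
    qed
    show "\<forall>i\<in>cls M ` U. \<forall>j\<in>cls M ` U. i \<noteq> j \<longrightarrow> f i \<inter> f j = {}"
    proof (intro ballI impI)
      fix i j assume ij: "i \<in> cls M ` U" "j \<in> cls M ` U" "i \<noteq> j"
      then obtain u v where "i = cls M u" "j = cls M v" "cls M u \<noteq> cls M v" by auto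
      then have "i \<inter> j = {}" using cls_disj[of M u v] by simp
      then show "f i \<inter> f j = {}" using f[OF ij(1)] f[OF ij(2)] by blast
    qed
  qed
  also have "\<dots> = (\<Sum>X\<in>cls M ` U. \<tau> X)" using f by simp
  finally show ?thesis using that[of t] tU int f by auto
qed

lemma Stab_cls_inj:
  assumes "M \<subseteq> L" "g \<in> Stab t" "u \<in> U"
    and inj: "\<And>u v. u \<in> U \<Longrightarrow> v \<in> U \<Longrightarrow> card (cls M u \<inter> t) = card (cls M v \<inter> t) \<Longrightarrow> cls M u = cls M v"
  shows "g u \<in> cls M u"
proof -
  have "g u \<in> U" using assms maps by (auto simp: Stab_def)
  then show ?thesis using inj[of "g u" u] cls_count[OF assms(1,2,3)] assms(3) cls_self by metis
qed

lemma orb_sub: "u \<in> U \<Longrightarrow> (\<lambda>g. g u) ` Stab t \<subseteq> {v \<in> U. v \<in> t \<longleftrightarrow> u \<in> t}"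
  unfolding Stab_def using maps by auto

text \<open>If the number of black points distinguishes the classes, then no class can be moved.\<close>
lemma fine_by_counts:
  assumes "t \<subseteq> U"
    and inj: "\<And>u v. u \<in> U \<Longrightarrow> v \<in> U \<Longrightarrow> card (cls L u \<inter> t) = card (cls L v \<inter> t) \<Longrightarrow> cls L u = cls L v"
    and le: "\<And>u. u \<in> U \<Longrightarrow> card (cls L u \<inter> t) \<le> 3 \<and> card (cls L u - t) \<le> 3"
    and last: "2 * card t \<noteq> card U \<or> rigid t \<or> full_triple t"
  shows "fine t"
proof -
  have stay: "g u \<in> cls L u" if "g \<in> Stab t" "u \<in> U" for g u
    using Stab_cls_inj[OF order_refl that] inj by blast
  have part: "card {v \<in> cls L u. v \<in> t \<longleftrightarrow> u \<in> t} \<le> 3" if "u \<in> U" for u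
  proof (cases "u \<in> t")
    case True then show ?thesis using le[OF that] by (simp add: Int_def)
  next
    case False then show ?thesis using le[OF that] by (simp add: set_diff_eq)
  qed
  have "small_orbits t" unfolding small_orbits_def
  proof (intro ballI conjI impI)
    fix u assume u: "u \<in> U"
    have sub: "(\<lambda>g. g u) ` Stab t \<subseteq> {v \<in> cls L u. v \<in> t \<longleftrightarrow> u \<in> t}"
      using orb_sub[OF u, of t] stay u by auto
    show "card ((\<lambda>g. g u) ` Stab t) \<le> 3"
      using card_mono[OF _ sub] part[OF u] by simp
    show "(\<lambda>g. g u) ` Stab t \<subseteq> cls L u" using sub by auto
  qed
  moreover have "fixes_class t" unfolding fixes_class_def using neU stay by blast
  moreover have "isolating t" unfolding isolating_def
  proof
    fix u assume u: "u \<in> U"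
    have "{v \<in> movable t. (v \<in> t \<longleftrightarrow> u \<in> t) \<and> card (cls L v \<inter> t) = card (cls L u \<inter> t)}
        \<subseteq> {v \<in> cls L u. v \<in> t \<longleftrightarrow> u \<in> t}"
      using inj u cls_self unfolding movable_def by blast
    from card_mono[OF _ this] part[OF u]
    show "card {v \<in> movable t. (v \<in> t \<longleftrightarrow> u \<in> t) \<and> card (cls L v \<inter> t) = card (cls L u \<inter> t)} \<le> 3"
      by simp
  qed
  ultimately show ?thesis unfolding fine_def using assms(1) last by blast
qed

lemma rigid_fine:
  assumes "t \<subseteq> U" "rigid t" shows "fine t"
proof -
  have fixed: "g u = u" if "g \<in> Stab t" "u \<in> U" for g u using assms(2) that by (auto simp: rigid_def)
  have "(\<lambda>g. g u) ` Stab t \<subseteq> {u}" if "u \<in> U" for u using fixed that by auto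
  then have c: "card ((\<lambda>g. g u) ` Stab t) \<le> 1" if "u \<in> U" for u
    using card_mono[of "{u}"] that by fastforce
  have "small_orbits t" unfolding small_orbits_def using c by fastforce
  moreover have "fixes_class t" unfolding fixes_class_def using neU fixed cls_self by (metis ex_in_conv)
  moreover have "movable t = {}" unfolding movable_def using fixed by auto
  ultimately show ?thesis unfolding fine_def isolating_def using assms by auto
qed

lemma block_eq: "{v \<in> U. l v = l u} = cls {l} u"
  unfolding cls_def by auto

lemma card_blocks: "card (cls {l} ` U) = card (l ` U)"
proof -
  have "bij_betw (\<lambda>x. {v \<in> U. l v = x}) (l ` U) (cls {l} ` U)"
    unfolding bij_betw_def by (auto simp: inj_on_def cls_def)
  then show ?thesis by (simp add: bij_betw_same_card)
qed

lemma cls_L_sub_block: "l \<in> L \<Longrightarrow> cls L u \<subseteq> cls {l} u"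
  unfolding cls_def by auto

lemma block_card_eq:
  assumes "l \<in> L" "u \<in> U"
  shows "card U = card (cls {l} u) * card (l ` U)" "card (cls {l} u) \<le> 4"
proof -
  show "card U = card (cls {l} u) * card (l ` U)"
    using card_cls_decomp[of "{l}" u] assms unfolding card_blocks by blast
  show "card (cls {l} u) \<le> 4"
    using block_le[OF assms] unfolding block_eq .
qed

text \<open>A block is a disjoint union of classes, which have equal size by transitivity.\<close>

lemma cls_dvd_block:
  assumes "l \<in> L" "u \<in> U" shows "card (cls L u) dvd card (cls {l} u)"
proof -
  have eq: "cls {l} u = \<Union> (cls L ` cls {l} u)"
  proof (intro equalityI subsetI)
    fix x assume "x \<in> cls {l} u"
    moreover from this have "x \<in> cls L x" using cls_sub cls_self by blast
    ultimately show "x \<in> \<Union> (cls L ` cls {l} u)" by (rule UN_I)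
  next
    fix x assume "x \<in> \<Union> (cls L ` cls {l} u)"
    then obtain y where "y \<in> cls {l} u" "x \<in> cls L y" by blast
    then have "x \<in> cls {l} y" using cls_L_sub_block[OF assms(1)] by (meson subsetD)
    then show "x \<in> cls {l} u" using cls_eq[OF \<open>y \<in> cls {l} u\<close>] by simp
  qed
  have "card (\<Union> (cls L ` cls {l} u)) = (\<Sum>X\<in>cls L ` cls {l} u. card X)"
  proof (rule card_Union_disjoint)
    show "pairwise disjnt (cls L ` cls {l} u)" by (rule cls_disjoint)
  qed auto
  also have "\<dots> = (\<Sum>X\<in>cls L ` cls {l} u. card (cls L u))"
  proof (rule sum.cong)
    fix X assume "X \<in> cls L ` cls {l} u"
    then obtain v where "v \<in> U" "X = cls L v" using cls_sub by blast
    then show "card X = card (cls L u)" using cls_card[OF order_refl _ assms(2)] by simp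
  qed simp
  finally have "card (cls {l} u) = card (cls L ` cls {l} u) * card (cls L u)"
    using eq by simp
  then show ?thesis by simp
qed

text \<open>An element of \<open>G\<close> permutes the label values, and a permutation of two
  values with a fixed point is the identity.\<close>

lemma binary_labels_fixed:
  assumes "l \<in> L" "card (l ` U) = 2" "g \<in> G" "u \<in> U" "l (g u) = l u" "v \<in> U"
  shows "l (g v) = l v"
proof (cases "l v = l u")
  case True then show ?thesis using lab[OF assms(1,3,6,4)] assms(5) by simp
next
  case False
  then have "l (g v) \<noteq> l u" using lab[OF assms(1,3,6,4)] assms(5) by simp
  moreover obtain a b where "l ` U = {a, b}" using assms(2) by (meson card_2_iff)
  moreover have "l (g v) \<in> l ` U" "l v \<in> l ` U" "l u \<in> l ` U" using maps assms by auto
  ultimately show ?thesis using False by auto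
qed

text \<open>A permutation of at most three values with two fixed points is the identity.\<close>

lemma labels_fixed:
  assumes l: "l \<in> L" and g: "g \<in> G" and u: "u \<in> U" "l (g u) = l u" and w: "w \<in> U" "l (g w) = l w"
    and uw: "l u \<noteq> l w" and v: "v \<in> U"
  shows "l (g v) = l v"
proof (cases "l v = l u \<or> l v = l w")
  case True then show ?thesis using lab[OF l g] u w v by metis
next
  case False
  then have ne: "l (g v) \<noteq> l u" "l (g v) \<noteq> l w" using lab[OF l g] u w v by metis+
  have sub: "{l u, l w, l v, l (g v)} \<subseteq> l ` U" using maps g u w v by auto
  have fin: "finite (l ` U)" using finU by simp
  show ?thesis
  proof (rule ccontr)
    assume "l (g v) \<noteq> l v"
    then have "card {l u, l w, l v, l (g v)} = 4" using ne False uw by auto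
    then have "4 \<le> card (l ` U)" using card_mono[OF fin sub] by simp
    then show False using card_lab[OF l] by auto
  qed
qed


lemma Stab_G: "g \<in> Stab t \<Longrightarrow> g \<in> G"
  unfolding Stab_def by simp

lemma Stab_mem: "g \<in> Stab t \<Longrightarrow> u \<in> U \<Longrightarrow> g u \<in> t \<longleftrightarrow> u \<in> t"
  unfolding Stab_def by simp

text \<open>Inside a block of \<open>l\<close>, points with equal \<open>l'\<close> form classes of
  the pair, all of one size by transitivity. As blocks have at most four points, this factorisation
  leaves few possibilities.\<close>

lemma block_split:
  assumes "l \<in> L" "l' \<in> L" "u \<in> U"
  shows "card (cls {l} u) = card (cls {l, l'} u) * card (l' ` cls {l} u)"
proof -
  have "card (cls {l} u) = (\<Sum>y\<in>l' ` cls {l} u. card {x \<in> cls {l} u. l' x = y})"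
    using sum.image_gen[of "cls {l} u" "\<lambda>_. 1::nat" l'] by simp
  also have "\<dots> = (\<Sum>y\<in>l' ` cls {l} u. card (cls {l, l'} u))"
  proof (rule sum.cong)
    fix y assume "y \<in> l' ` cls {l} u"
    then obtain v where v: "v \<in> cls {l} u" "y = l' v" by blast
    then have "{x \<in> cls {l} u. l' x = y} = cls {l, l'} v" unfolding cls_def by auto
    moreover have "v \<in> U" using v cls_sub by blast
    ultimately show "card {x \<in> cls {l} u. l' x = y} = card (cls {l, l'} u)"
      using cls_card[of "{l, l'}" v u] assms by simp
  qed simp
  finally show ?thesis by (simp add: mult.commute)
qed

text \<open>With three blocks of size four, a second labelling is constant on blocks or misses
  exactly one label on each block; a missing label cannot be moved.\<close>
lemma twelve_points:
  assumes U: "card U = 12" and l: "l \<in> L" and g: "g \<in> G" and gl: "\<And>u. u \<in> U \<Longrightarrow> l (g u) = l u"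
    and l': "l' \<in> L" and v: "v \<in> U"
  shows "l' (g v) = l' v"
proof -
  have three: "card (m ` U) = 3 \<and> card (cls {m} u) = 4" if "m \<in> L" "u \<in> U" for m u
    using block_card_eq[OF that] card_lab[OF that(1)] U by auto
  have gcls: "g u \<in> cls {l} u" if "u \<in> U" for u using gl maps[OF g] that by (simp add: cls_def)
  define e where "e = card (cls {l, l'} v)"
  have e: "e * card (l' ` cls {l} u) = 4 \<and> card (cls {l, l'} u) = e" if "u \<in> U" for u
    using block_split[OF l l' that] three[OF l that] cls_card[of "{l, l'}" u v] l l' v that
    by (simp add: e_def)
  have im3: "card (l' ` cls {l} u) \<le> 3" if "u \<in> U" for u
    using card_mono[of "l' ` U" "l' ` cls {l} u"] three[OF l' that] finU cls_sub by (simp add: image_mono)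
  show ?thesis
  proof (cases "e = 4")
    case True
    have "cls {l, l'} v = cls {l} v"
      by (rule card_subset_eq) (use e[OF v] three[OF l v] True in \<open>auto simp: cls_def finU\<close>)
    then show ?thesis using gcls[OF v] by (auto simp: cls_def)
  next
    case False
    have two: "card (l' ` cls {l} u) = 2" if "u \<in> U" for u
    proof -
      have "card (l' ` cls {l} u) \<noteq> 3"
      proof
        assume "card (l' ` cls {l} u) = 3"
        then have "e * 3 = 4" using e[OF that] by simp
        then show False by presburger
      qed
      moreover have "card (l' ` cls {l} u) \<noteq> 1" "card (l' ` cls {l} u) \<noteq> 0"
        using e[OF that] False by auto
      ultimately show ?thesis using im3[OF that] by linarith
    qed
    have miss: "\<exists>x\<in>U. l' x \<notin> l' ` cls {l} u \<and> l' (g x) = l' x" if u: "u \<in> U" for u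
    proof -
      have sub: "l' ` cls {l} u \<subseteq> l' ` U" using cls_sub by (rule image_mono)
      have "card (l' ` U - l' ` cls {l} u) = 1"
        using card_Diff_subset[OF _ sub] two[OF u] three[OF l' u] by simp
      then obtain m where m: "l' ` U - l' ` cls {l} u = {m}" by (rule card_1_singletonE)
      then have "m \<in> l' ` U" by blast
      then obtain x where x: "x \<in> U" "l' x = m" by auto
      have "l' (g x) = m"
      proof (rule ccontr)
        assume "l' (g x) \<noteq> m"
        moreover have "l' (g x) \<in> l' ` U" using maps[OF g x(1)] by simp
        ultimately have "l' (g x) \<in> l' ` cls {l} u" using m by (metis DiffI singletonD)
        then obtain w where w: "w \<in> cls {l} u" "l' (g x) = l' w" by auto
        have "g ` cls {l} u = cls {l} (g u)" using cls_image[of "{l}" g u] l g u by simp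
        also have "\<dots> = cls {l} u" using cls_eq[OF gcls[OF u]] .
        finally have "w \<in> g ` cls {l} u" using w by simp
        then obtain w' where w': "w' \<in> cls {l} u" "w = g w'" by auto
        have "w' \<in> U" using w'(1) cls_sub by (rule rev_subsetD)
        then have "l' x = l' w'" using lab[OF l' g x(1) \<open>w' \<in> U\<close>] w w' by simp
        then have "m \<in> l' ` cls {l} u" using w' x by simp
        then show False using m by auto
      qed
      moreover have "m \<notin> l' ` cls {l} u" using m by auto
      ultimately show ?thesis using x by (intro bexI[of _ x]) simp_all
    qed
    obtain x where x: "x \<in> U" "l' (g x) = l' x" using miss[OF v] by blast
    \<comment> \<open>The value of \<open>y\<close> is missing on the block of \<open>x\<close>,
      where the value of \<open>x\<close> occurs; so the two fixed values are different.\<close>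
    obtain y where y: "y \<in> U" "l' (g y) = l' y" "l' y \<notin> l' ` cls {l} x" using miss[OF x(1)] by blast
    have "l' x \<noteq> l' y" using y(3) imageI[OF cls_self[OF x(1), of "{l}"], of l'] by auto
    then show ?thesis by (rule labels_fixed[OF l' g x y(1,2) _ v])
  qed
qed

section \<open>Existence of a fine set, by the size of the classes\<close>

lemma labels_fixed_cls: "g \<in> G \<Longrightarrow> u \<in> U \<Longrightarrow> (\<And>l. l \<in> L \<Longrightarrow> l (g u) = l u) \<Longrightarrow> g u \<in> cls L u"
  unfolding cls_def using maps by auto

text \<open>Up to three points all stay white; beyond that three stay white and the remaining one or
  two turn black. No colour exceeds three points and no splitting is balanced.\<close>

lemma fine_no_labels:
  assumes "L = {}" shows "\<exists>t. fine t"
proof -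
  have c: "cls L u = U" for u using assms by (simp add: cls_def)
  have n: "card U \<le> 5" "card U > 0" using small[OF assms] finU neU by (auto simp: card_gt_0_iff)
  obtain t where t: "t \<subseteq> U" "card t = (if card U \<le> 3 then 0 else card U - 3)"
    by (meson obtain_subset_with_card_n diff_le_self le0)
  have d: "card (U - t) = card U - card t"
    using t(1) finU by (meson card_Diff_subset finite_subset)
  have "fine t"
    by (rule fine_by_counts)
      (use c t d n in \<open>auto simp: Int_absorb1 split: if_splits\<close>)
  then show ?thesis by blast
qed

text \<open>A block has at most four points, and a class size of at least three divides it; so
  blocks and classes agree and there are two or three of them. Distinct black counts hold every
  class in place.\<close>

lemma fine_large_classes:
  assumes l: "l \<in> L" and u0: "u0 \<in> U" and s: "card (cls L u0) \<ge> 3"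
  shows "\<exists>t. fine t"
proof -
  define s where "s = card (cls L u0)"
  have cs: "card (cls L u) = s" if "u \<in> U" for u using cls_card[OF order_refl that u0] s_def by simp
  have ks: "card (cls {l} u) = s" if u: "u \<in> U" for u
  proof -
    have "s dvd card (cls {l} u)" "card (cls {l} u) \<le> 4" "card (cls {l} u) > 0"
      using cls_dvd_block[OF l u] cs[OF u] block_card_eq[OF l u] cls_self[OF u, of "{l}"]
      by (auto simp: card_gt_0_iff)
    then obtain q where q: "card (cls {l} u) = s * q" "q > 0" by (auto elim: dvdE)
    have "q < 2"
    proof (rule ccontr)
      assume "\<not> q < 2"
      then have "3 * 2 \<le> s * q" using assms(3) s_def by (intro mult_le_mono) auto
      then show False using q \<open>card (cls {l} u) \<le> 4\<close> by simp
    qed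
    then have "q = 1" using q by simp
    then show ?thesis using q by simp
  qed
  have eqc: "cls L u = cls {l} u" if "u \<in> U" for u
    by (rule card_subset_eq) (use cls_L_sub_block[OF l] cs ks that in auto)
  define O' where "O' = cls L ` U"
  have "O' = cls {l} ` U" unfolding O'_def using eqc by simp
  then have cO: "card O' = card (l ` U)" by (simp add: card_blocks)
  have fO: "finite O'" unfolding O'_def using finU by simp
  then obtain h where h: "bij_betw h O' {0..<card O'}" using ex_bij_betw_finite_nat by blast
  \<comment> \<open>Counts starting at 0 would leave a class of four points entirely white, one
    point more than an orbit may have.\<close>
  define e where "e = (if s = 4 then 1 else 0 :: nat)"
  define \<tau> where "\<tau> X = h X + e" for X
  have s34: "s = 3 \<or> s = 4" using block_card_eq[OF l u0] ks[OF u0] s s_def by auto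
  have b23: "card O' = 2 \<or> card O' = 3" using card_lab[OF l] cO by simp
  have hlt: "h X < card O'" if "X \<in> O'" for X using h that by (auto simp: bij_betw_def)
  have tau: "\<tau> (cls L u) \<le> 3 \<and> \<tau> (cls L u) \<le> s \<and> s - \<tau> (cls L u) \<le> 3" if "u \<in> U" for u
    using hlt[of "cls L u"] that s34 b23 unfolding \<tau>_def e_def O'_def by (auto split: if_splits)
  obtain t where t: "t \<subseteq> U" "\<And>u. u \<in> U \<Longrightarrow> card (cls L u \<inter> t) = \<tau> (cls L u)"
      "card t = (\<Sum>X\<in>O'. \<tau> X)"
    using prescribed[of \<tau> L] tau cs unfolding O'_def by metis
  have "card t = (\<Sum>i\<in>{0..<card O'}. i + e)"
    unfolding t(3) \<tau>_def using sum.reindex_bij_betw[OF h, of "\<lambda>i. i + e"] by simp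
  then have ct: "card t = (if card O' = 2 then 1 else 3) + card O' * e"
    using b23 by (auto simp: numeral_2_eq_2 numeral_3_eq_3)
  have cU: "card U = s * card O'"
    using card_cls_decomp[OF order_refl u0] s_def O'_def by simp
  have inj: "cls L u = cls L v"
    if "u \<in> U" "v \<in> U" "card (cls L u \<inter> t) = card (cls L v \<inter> t)" for u v
  proof -
    have "h (cls L u) = h (cls L v)" using that t(2) by (simp add: \<tau>_def)
    then show ?thesis using h that unfolding bij_betw_def inj_on_def O'_def by blast
  qed
  have last: "2 * card t \<noteq> card U \<or> rigid t \<or> full_triple t"
  proof (cases "s = 4 \<and> card O' = 3")
    case False
    then have "2 * card t \<noteq> card U" using ct cU s34 b23 by (auto simp: e_def)
    then show ?thesis by blast
  next
    case True
    \<comment> \<open>Counts 1, 2, 3 in twelve points: the only balanced outcome here. In the class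
      with a single black point this point is fixed.\<close>
    obtain X where X: "X \<in> O'" "h X = 0"
      using h True unfolding bij_betw_def by (metis atLeastLessThan_iff imageE le0 zero_less_numeral)
    then obtain v where v: "v \<in> U" "X = cls L v" unfolding O'_def by blast
    then have "card (cls L v \<inter> t) = 1" using t(2) X True by (simp add: \<tau>_def e_def)
    then obtain x where x: "cls L v \<inter> t = {x}" by (rule card_1_singletonE)
    then have xU: "x \<in> U" "x \<in> t" "cls L x = cls L v" using cls_sub cls_eq by blast+
    have "g x = x" if "g \<in> Stab t" for g
    proof -
      have "g x \<in> cls L x" using Stab_cls_inj[OF order_refl that xU(1) inj] .
      then show ?thesis using Stab_mem[OF that xU(1)] xU x by auto
    qed
    moreover have "card {v \<in> U. l v = l u} = 4" if "u \<in> U" for u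
      using ks[OF that] True by (simp add: block_eq)
    ultimately have "full_triple t" unfolding full_triple_def using xU l cO True by auto
    then show ?thesis by blast
  qed
  have "fine t"
  proof (rule fine_by_counts[OF t(1) inj])
    fix u assume u: "u \<in> U"
    have "card (cls L u - t) = s - \<tau> (cls L u)"
      using card_Diff_subset_Int[of "cls L u" t] cs[OF u] t(2)[OF u] by simp
    then show "card (cls L u \<inter> t) \<le> 3 \<and> card (cls L u - t) \<le> 3" using tau[OF u] t(2)[OF u] by simp
  qed (use last in auto)
  then show ?thesis by blast
qed

text \<open>Leave one class white and give every other class one black point.\<close>
lemma fine_pairs:
  assumes l0: "l0 \<in> L" and u0: "u0 \<in> U" and s: "card (cls L u0) = 2"
  shows "\<exists>t. fine t"
proof -
  define X0 where "X0 = cls L u0"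
  define O' where "O' = cls L ` U"
  have cs: "card (cls L u) = 2" if "u \<in> U" for u using cls_card[OF order_refl that u0] s by simp
  define \<tau> where "\<tau> X = (if X = X0 then 0 else 1 :: nat)" for X
  have fO: "finite O'" unfolding O'_def using finU by simp
  have X0O: "X0 \<in> O'" unfolding X0_def O'_def using u0 by simp
  obtain t where t: "t \<subseteq> U" "\<And>u. u \<in> U \<Longrightarrow> card (cls L u \<inter> t) = \<tau> (cls L u)"
      "card t = (\<Sum>X\<in>O'. \<tau> X)"
  proof (rule prescribed[of \<tau> L, folded O'_def])
    show "\<tau> (cls L u) \<le> card (cls L u)" if "u \<in> U" for u using cs[OF that] by (simp add: \<tau>_def)
  qed auto
  have "(\<Sum>X\<in>O'. \<tau> X) = (\<Sum>X\<in>O' - {X0}. 1)"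
    unfolding \<tau>_def by (rule sum.mono_neutral_cong_right) (use fO in auto)
  then have ct: "card t = card O' - 1" using t(3) X0O by simp
  have cO: "card O' > 0" using fO X0O by (auto simp: card_gt_0_iff)
  have cU: "card U = 2 * card O'"
    using card_cls_decomp[OF order_refl u0] s O'_def by simp
  \<comment> \<open>Every class other than \<open>X0\<close> contributes half of its points,
    \<open>X0\<close> none.\<close>
  have last: "2 * card t \<noteq> card U" using ct cU cO by simp
  have fix0: "g u \<in> X0 \<longleftrightarrow> u \<in> X0" if g: "g \<in> Stab t" and u: "u \<in> U" for g u
  proof -
    have gu: "g u \<in> U" using maps[OF Stab_G[OF g] u] .
    have "card (cls L (g u) \<inter> t) = card (cls L u \<inter> t)" using cls_count[OF order_refl g u] .
    then have "cls L (g u) = X0 \<longleftrightarrow> cls L u = X0" using t(2)[OF u] t(2)[OF gu]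
      by (cases "cls L u = X0"; cases "cls L (g u) = X0") (simp_all add: \<tau>_def)
    then show ?thesis unfolding X0_def using cls_eq_iff[OF u0 u, of L] cls_eq_iff[OF u0 gu, of L] by simp
  qed
  define C where "C = {X \<in> O'. \<exists>g\<in>Stab t. \<exists>u\<in>X. g u \<notin> X}"
  have CO: "C \<subseteq> O' - {X0}"
  proof
    fix X assume X: "X \<in> C"
    then obtain g u where g: "g \<in> Stab t" "u \<in> X" "g u \<notin> X" unfolding C_def by auto
    have XO: "X \<in> O'" using X unfolding C_def by simp
    then have "u \<in> U" using g(2) cls_sub unfolding O'_def by auto
    then show "X \<in> O' - {X0}" using fix0[OF g(1)] g XO by auto
  qed
  have fC: "finite C" using CO fO by (meson finite_Diff finite_subset)
  have C_empty: "C = {}" if all: "\<And>g u. g \<in> Stab t \<Longrightarrow> u \<in> U \<Longrightarrow> g u \<in> cls L u"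
  proof -
    have "g u \<in> X" if X: "X \<in> O'" and g: "g \<in> Stab t" and u: "u \<in> X" for X g u
    proof -
      obtain v where v: "X = cls L v" using X unfolding O'_def by auto
      have "u \<in> U" using u v cls_sub by auto
      moreover have "cls L u = X" using cls_eq u v by simp
      ultimately show ?thesis using all[OF g] by auto
    qed
    then show ?thesis unfolding C_def by auto
  qed
  \<comment> \<open>Classes other than \<open>X0\<close> have one point of each colour. With at most
    two moving classes, an orbit that leaves its class has at most two points.\<close>
  have C2: "card C \<le> 2"
  proof (cases "\<exists>l\<in>L. card (l ` U) = 3")
    case False
    have "g u \<in> cls L u" if g: "g \<in> Stab t" and u: "u \<in> U" for g u
    proof (rule labels_fixed_cls[OF Stab_G[OF g] u])
      fix l assume l: "l \<in> L"
      then have "card (l ` U) = 2" using False card_lab by blast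
      moreover have "l (g u0) = l u0"
        using fix0[OF g u0] cls_self[OF u0] l unfolding X0_def by (auto simp: cls_def)
      ultimately show "l (g u) = l u" using binary_labels_fixed[OF l _ Stab_G[OF g] u0 _ u] by blast
    qed
    then have "C = {}" by (rule C_empty)
    then show ?thesis by simp
  next
    case True
    then obtain l where l: "l \<in> L" "card (l ` U) = 3" by blast
    have k: "card U = card (cls {l} u0) * 3" "card (cls {l} u0) \<le> 4"
      using block_card_eq[OF l(1) u0] l(2) by auto
    show ?thesis
    proof (cases "card U = 12")
      case False
      \<comment> \<open>The number of points is 3k and also twice the number of classes, so k is
        even. Apart from k = 4 at most three classes remain, and one of them is
        \<open>X0\<close>.\<close>
      moreover have "m \<le> 3" if "k \<noteq> 4" "k \<le> 4" "2 * m = k * 3" for k m :: nat using that by presburger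
      ultimately have "card O' \<le> 3" using k cU by (cases "card (cls {l} u0) = 4") auto
      moreover have "card C \<le> card O' - 1"
        using card_mono[OF _ CO] fO X0O by simp
      ultimately show ?thesis by linarith
    next
      case U12: True
      then have k4: "card (cls {l} u0) = 4" using k by simp
      have "g u \<in> cls L u" if g: "g \<in> Stab t" and u: "u \<in> U" for g u
      proof -
        have g': "g \<in> G" using Stab_G[OF g] .
        have "\<not> cls {l} u0 \<subseteq> cls L u0"
          using card_mono[of "cls L u0" "cls {l} u0"] k4 s by auto
        \<comment> \<open>The block of \<open>X0\<close> consists of \<open>X0\<close> and one
          further class, which is therefore held in place too. A label separating the two has two
          fixed values, hence all values fixed, and \<open>twelve_points\<close> carries this over
          to every other label.\<close>
        then obtain u1 where u1: "u1 \<in> cls {l} u0" "u1 \<notin> cls L u0" by blast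
        have u1U: "u1 \<in> U" using u1(1) cls_sub by (rule rev_subsetD)
        have un: "cls L u0 \<union> cls L u1 = cls {l} u0"
        proof (rule card_subset_eq)
          show "cls L u0 \<union> cls L u1 \<subseteq> cls {l} u0"
            using cls_L_sub_block[OF l(1), of u0] cls_L_sub_block[OF l(1), of u1] cls_eq[OF u1(1)] by simp
          have "cls L u0 \<inter> cls L u1 = {}" using cls_disj[of L u0 u1] cls_self[OF u1U, of L] u1(2) by auto
          then show "card (cls L u0 \<union> cls L u1) = card (cls {l} u0)"
            using card_Un_disjoint[of "cls L u0" "cls L u1"] cs[OF u0] cs[OF u1U] k4 by simp
        qed simp
        have g0: "g u0 \<in> cls L u0" using fix0[OF g u0] cls_self[OF u0] unfolding X0_def by blast
        have "g u1 \<notin> cls L u0" using fix0[OF g u1U] u1(2) unfolding X0_def by blast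
        moreover have "g u1 \<in> cls {l} (g u0)" using cls_map[of "{l}" g u0 u1] u1 l g' u0 u1U by simp
        then have "g u1 \<in> cls {l} u0" using cls_eq[of "g u0" "{l}" u0] g0 cls_L_sub_block[OF l(1), of u0] by blast
        ultimately have g1: "g u1 \<in> cls L u1" using un by blast
        obtain l' where l': "l' \<in> L" "l' u1 \<noteq> l' u0" using u1(2) u1U by (auto simp: cls_def)
        have "l' (g u0) = l' u0" "l' (g u1) = l' u1" using g0 g1 l' by (auto simp: cls_def)
        then have "l' (g v) = l' v" if "v \<in> U" for v
          using labels_fixed[OF l'(1) g' u0 _ u1U _ _ that] l'(2) by simp
        then have "m (g v) = m v" if "m \<in> L" "v \<in> U" for m v
          using twelve_points[OF U12 l'(1) g' _ that] by simp
        then show ?thesis using labels_fixed_cls[OF g' u] u by simp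
      qed
      then have "C = {}" by (rule C_empty)
      then show ?thesis by simp
    qed
  qed
  have "\<Union> C \<subseteq> U" using CO cls_sub unfolding O'_def by auto
  then have fUC: "finite {v \<in> \<Union> C. v \<in> t \<longleftrightarrow> b}" for b
    by (rule finite_subset[OF _ finU, OF subset_trans[rotated]]) auto
  have black: "card {v \<in> X. v \<in> t \<longleftrightarrow> b} \<le> 1" if X: "X \<in> O' - {X0}" for X b
  proof -
    obtain v where v: "v \<in> U" "X = cls L v" using X O'_def by blast
    have one: "card (X \<inter> t) = 1" using t(2)[OF v(1)] v X by (auto simp: \<tau>_def)
    have "card (X - t) = 1" using card_Diff_subset_Int[of X t] v cs one by simp
    then show ?thesis using one by (cases b) (auto simp: Int_def set_diff_eq)
  qed
  have one_each: "card {v \<in> \<Union> C. v \<in> t \<longleftrightarrow> b} \<le> 2" for b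
  proof -
    have "{v \<in> \<Union> C. v \<in> t \<longleftrightarrow> b} = (\<Union>X\<in>C. {v \<in> X. v \<in> t \<longleftrightarrow> b})" by auto
    then have "card {v \<in> \<Union> C. v \<in> t \<longleftrightarrow> b} \<le> (\<Sum>X\<in>C. card {v \<in> X. v \<in> t \<longleftrightarrow> b})"
      using card_UN_le[OF fC] by simp
    also have "\<dots> \<le> (\<Sum>X\<in>C. 1)" by (rule sum_mono) (use black CO in blast)
    finally show ?thesis using C2 by simp
  qed
  have movedC: "u \<in> \<Union> C \<and> g u \<in> \<Union> C" if g: "g \<in> Stab t" and u: "u \<in> U" and ne: "g u \<notin> cls L u" for g u
  proof -
    have gu: "g u \<in> U" using maps[OF Stab_G[OF g] u] .
    have "cls L u \<in> C" unfolding C_def O'_def using g u ne cls_self by blast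
    moreover have "g (g u) \<notin> cls L (g u)"
      using cls_map[OF order_refl Stab_G[OF g] u gu] ne by simp
    then have "cls L (g u) \<in> C" unfolding C_def O'_def using g gu cls_self by blast
    ultimately show ?thesis using cls_self[OF u] cls_self[OF gu] by blast
  qed
  have so: "small_orbits t" unfolding small_orbits_def
  proof
    fix u assume u: "u \<in> U"
    have "card ((\<lambda>g. g u) ` Stab t) \<le> 2"
    proof (cases "\<exists>g\<in>Stab t. g u \<notin> cls L u")
      case True
      then have uC: "u \<in> \<Union> C" using movedC u by blast
      have "g u \<in> \<Union> C" if g: "g \<in> Stab t" for g
      proof (cases "g u \<in> cls L u")
        case False then show ?thesis using movedC[OF g u] by simp
      next
        case True
        obtain v where v: "u \<in> cls L v" "cls L v \<in> C" using uC CO unfolding O'_def by blast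
        then show ?thesis using True cls_eq by blast
      qed
      then have "(\<lambda>g. g u) ` Stab t \<subseteq> {v \<in> \<Union> C. v \<in> t \<longleftrightarrow> u \<in> t}" using Stab_mem u by auto
      moreover have "finite {v \<in> \<Union> C. v \<in> t \<longleftrightarrow> u \<in> t}" by (rule fUC)
      ultimately show ?thesis using one_each[of "u \<in> t"] by (meson card_mono le_trans)
    next
      case False
      then have "(\<lambda>g. g u) ` Stab t \<subseteq> cls L u" by auto
      then show ?thesis using card_mono[of "cls L u"] cs[OF u] by fastforce
    qed
    then show "card ((\<lambda>g. g u) ` Stab t) \<le> 3 \<and>
       (card ((\<lambda>g. g u) ` Stab t) = 3 \<longrightarrow> (\<lambda>g. g u) ` Stab t \<subseteq> cls L u)" by simp
  qed
  moreover have "fixes_class t" unfolding fixes_class_def using u0 fix0[OF _ u0] cls_self[OF u0, of L] X0_def by auto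
  moreover have "isolating t" unfolding isolating_def
  proof
    fix u assume u: "u \<in> U"
    let ?S = "{v \<in> movable t. (v \<in> t \<longleftrightarrow> u \<in> t) \<and> card (cls L v \<inter> t) = card (cls L u \<inter> t)}"
    have "?S \<subseteq> X0 \<or> ?S \<subseteq> {v \<in> \<Union> C. v \<in> t \<longleftrightarrow> u \<in> t}"
    proof (cases "cls L u = X0")
      case True
      have "v \<in> X0" if "v \<in> ?S" for v
      proof -
        have v: "v \<in> U" using that by (simp add: movable_def)
        have "card (cls L v \<inter> t) = 0" using that True t(2)[OF u] by (simp add: \<tau>_def)
        then have "cls L v = X0" using t(2)[OF v] by (auto simp: \<tau>_def split: if_splits)
        then show ?thesis using cls_self[OF v, of L] by simp
      qed
      then show ?thesis by blast
    next
      case False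
      have "v \<in> \<Union> C" if vS: "v \<in> ?S" for v
      proof -
        obtain g where g: "g \<in> Stab t" "g v \<noteq> v" and v: "v \<in> U" using vS by (auto simp: movable_def)
        have "card (cls L v \<inter> t) = 1" using vS False t(2)[OF u] by (simp add: \<tau>_def)
        then have ne: "cls L v \<noteq> X0" using t(2)[OF v] by (auto simp: \<tau>_def)
        \<comment> \<open>The class has one point of each colour, so a point that moves must change
          its class.\<close>
        then have "card {x \<in> cls L v. x \<in> t \<longleftrightarrow> v \<in> t} \<le> 1" using black[of "cls L v"] v O'_def by simp
        moreover have "finite {x \<in> cls L v. x \<in> t \<longleftrightarrow> v \<in> t}" by simp
        moreover have "g v \<notin> {x \<in> cls L v. x \<in> t \<longleftrightarrow> v \<in> t} \<or> v \<notin> {x \<in> cls L v. x \<in> t \<longleftrightarrow> v \<in> t}"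
          using calculation g(2) by (metis (no_types, lifting) card_le_Suc0_iff_eq One_nat_def)
        ultimately have "g v \<notin> cls L v" using Stab_mem[OF g(1) v] cls_self[OF v] by blast
        then show ?thesis using movedC[OF g(1) v] by simp
      qed
      then show ?thesis by blast
    qed
    moreover have "finite X0" "card X0 = 2" using s by (auto simp: X0_def)
    moreover have "finite {v \<in> \<Union> C. v \<in> t \<longleftrightarrow> u \<in> t}" by (rule fUC)
    ultimately have "card ?S \<le> 2" using one_each[of "u \<in> t"] by (metis (no_types, lifting) card_mono le_trans)
    then show "card ?S \<le> 3" by simp
  qed
  ultimately have "fine t" unfolding fine_def using t(1) last by blast
  then show ?thesis by blast
qed

text \<open>If there is a label with three blocks of size k \<ge> 2, colour so that the blocks have different numbers of black
  points; otherwise a single black point suffices.\<close>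
lemma fine_singletons:
  assumes l0: "l0 \<in> L" and s: "\<And>u. u \<in> U \<Longrightarrow> cls L u = {u}"
  shows "\<exists>t. fine t"
proof -
  obtain u0 where u0: "u0 \<in> U" using neU by blast
  have rigidI: "rigid t" if "\<And>g u. g \<in> Stab t \<Longrightarrow> u \<in> U \<Longrightarrow> g u \<in> cls L u" for t
    using that s unfolding rigid_def by blast
  show ?thesis
  proof (cases "\<exists>l\<in>L. card (l ` U) = 3")
    case False
    have "rigid {u0}"
    proof (rule rigidI)
      fix g u assume g: "g \<in> Stab {u0}" and u: "u \<in> U"
      have "g u0 = u0" using Stab_mem[OF g u0] by simp
      then show "g u \<in> cls L u"
        using labels_fixed_cls[OF Stab_G[OF g] u] binary_labels_fixed[OF _ _ Stab_G[OF g] u0 _ u] False card_lab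
        by metis
    qed
    then show ?thesis using rigid_fine[of "{u0}"] u0 by blast
  next
    case True
    then obtain l where l: "l \<in> L" "card (l ` U) = 3" by blast
    define k where "k = card (cls {l} u0)"
    have ck: "card (cls {l} u) = k" if "u \<in> U" for u
      using cls_card[of "{l}" u u0] l u0 that k_def by simp
    have cU: "card U = k * 3" "k \<le> 4" using block_card_eq[OF l(1) u0] l(2) k_def by auto
    have "k > 0" using cU finU neU by (metis card_gt_0_iff mult_is_0 not_gr0)
    then consider "k = 1" | "k = 4" | "k = 2 \<or> k = 3" using cU(2) by linarith
    then show ?thesis
    proof cases
      case 1
      \<comment> \<open>With three points one black point suffices: the other two may still be
        exchanged, but orbits of size two may cross classes.\<close>
      have c3: "card U = 3" using cU 1 by simp
      have g0: "g u0 = u0" if "g \<in> Stab {u0}" for g using Stab_mem[OF that u0] by simp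
      have c2: "card (U - {u0}) = 2" using c3 u0 finU by simp
      have "small_orbits {u0}" unfolding small_orbits_def
      proof
        fix u assume u: "u \<in> U"
        have "(\<lambda>g. g u) ` Stab {u0} \<subseteq> {u0} \<or> (\<lambda>g. g u) ` Stab {u0} \<subseteq> U - {u0}"
          using orb_sub[OF u, of "{u0}"] by (cases "u = u0") auto
        then have "card ((\<lambda>g. g u) ` Stab {u0}) \<le> 2"
        proof
          assume "(\<lambda>g. g u) ` Stab {u0} \<subseteq> {u0}"
          from card_mono[OF _ this] show ?thesis by simp
        next
          assume "(\<lambda>g. g u) ` Stab {u0} \<subseteq> U - {u0}"
          from card_mono[OF _ this] show ?thesis using c2 finU by simp
        qed
        then show "card ((\<lambda>g. g u) ` Stab {u0}) \<le> 3 \<and>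
           (card ((\<lambda>g. g u) ` Stab {u0}) = 3 \<longrightarrow> (\<lambda>g. g u) ` Stab {u0} \<subseteq> cls L u)" by simp
      qed
      moreover have "fixes_class {u0}" unfolding fixes_class_def
      proof (rule bexI[OF _ u0], rule ballI)
        fix g assume "g \<in> Stab {u0}"
        from g0[OF this] show "g u0 \<in> cls L u0" using u0 by simp
      qed
      moreover have "isolating {u0}" unfolding isolating_def
      proof
        fix u
        have "{v \<in> movable {u0}. (v \<in> {u0} \<longleftrightarrow> u \<in> {u0}) \<and> card (cls L v \<inter> {u0}) = card (cls L u \<inter> {u0})} \<subseteq> U - {u0}"
          unfolding movable_def using g0 by auto
        from card_mono[OF _ this] c2 finU
        show "card {v \<in> movable {u0}. (v \<in> {u0} \<longleftrightarrow> u \<in> {u0}) \<and> card (cls L v \<inter> {u0}) = card (cls L u \<inter> {u0})} \<le> 3"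
          by simp
      qed
      ultimately have "fine {u0}" unfolding fine_def using u0 c3 by simp
      then show ?thesis by blast
    next
      case 2
      have "card (cls {l} ` U) = 3" using card_blocks l by metis
      \<comment> \<open>The blocks get 0, 1 and 2 black points, which fixes the values of
        \<open>l\<close>; \<open>twelve_points\<close> extends this to all labels.\<close>
      then obtain h where h: "bij_betw h (cls {l} ` U) {0..<3::nat}"
        using ex_bij_betw_finite_nat[of "cls {l} ` U"] finU by auto
      have hlt: "h (cls {l} u) < 3" if "u \<in> U" for u using h that by (auto simp: bij_betw_def)
      obtain t where t: "t \<subseteq> U" "\<And>u. u \<in> U \<Longrightarrow> card (cls {l} u \<inter> t) = h (cls {l} u)"
      proof (rule prescribed[of h "{l}"])
        show "h (cls {l} u) \<le> card (cls {l} u)" if "u \<in> U" for u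
          using hlt[OF that] ck[OF that] 2 by simp
      qed auto
      have inj: "cls {l} u = cls {l} v"
        if "u \<in> U" "v \<in> U" "card (cls {l} u \<inter> t) = card (cls {l} v \<inter> t)" for u v
        using that t(2) h unfolding bij_betw_def inj_on_def by (metis imageI)
      have "rigid t"
      proof (rule rigidI)
        fix g u assume g: "g \<in> Stab t" and u: "u \<in> U"
        have "l (g v) = l v" if "v \<in> U" for v
          using Stab_cls_inj[of "{l}" g t v, OF _ g that inj] l by (simp add: cls_def)
        then show "g u \<in> cls L u"
          using twelve_points[of l g _ u, OF _ l(1) Stab_G[OF g]] labels_fixed_cls[OF Stab_G[OF g] u] cU 2 u by simp
      qed
      then show ?thesis using rigid_fine t(1) by blast
    next
      case 3
      then have "\<not> cls {l} u0 \<subseteq> {u0}" using k_def card_mono[of "{u0}" "cls {l} u0"] by auto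
      then obtain u1 where u1: "u1 \<in> cls {l} u0" "u1 \<noteq> u0" by blast
      then have u1U: "u1 \<in> U" using cls_sub by blast
      have "u1 \<notin> cls L u0" using s[OF u0] u1 by blast
      then obtain l' where l': "l' \<in> L" "l' u1 \<noteq> l' u0" using u1U by (auto simp: cls_def)
      have prod: "k = card (cls {l, l'} u0) * card (l' ` cls {l} u0)"
        using block_split[OF l(1) l'(1) u0] k_def by simp
      \<comment> \<open>2 and 3 are prime, so the factorisation of \<open>k\<close> leaves classes
        of size one for the pair of labels: \<open>l'\<close> is injective on every block of
        \<open>l\<close>.\<close>
      have "card (l' ` cls {l} u0) \<noteq> 1"
      proof
        assume "card (l' ` cls {l} u0) = 1"
        then obtain z where "l' ` cls {l} u0 = {z}" by (rule card_1_singletonE)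
        then have "l' u1 \<in> {z}" "l' u0 \<in> {z}" using u1 cls_self[OF u0, of "{l}"] by blast+
        then show False using l'(2) by simp
      qed
      moreover have "e = 1" if "k = e * c" "c \<noteq> 1" for e c :: nat
      proof -
        have "k > 0" "k \<le> 3" using 3 by auto
        moreover have "e dvd k" using that by simp
        ultimately have "e \<le> 3" "e \<noteq> 0" using dvd_imp_le[of e k] by auto
        then consider "e = 1" | "e = 2" | "e = 3" by linarith
        then show ?thesis
        proof cases
          case 2
          then have "k = 2 * c" using that by simp
          then show ?thesis using that \<open>k > 0\<close> \<open>k \<le> 3\<close> by presburger
        next
          case 3
          then have "k = 3 * c" using that by simp
          then show ?thesis using that \<open>k > 0\<close> \<open>k \<le> 3\<close> by presburger
        qed
      qed
      ultimately have "card (cls {l, l'} u0) = 1" using prod by blast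
      then have "card (cls {l, l'} u) = 1" if "u \<in> U" for u
        using cls_card[of "{l, l'}" u u0] l l' u0 that by simp
      then have one: "cls {l, l'} u = {u}" if "u \<in> U" for u
        using cls_self[OF that, of "{l, l'}"] that by (metis card_1_singletonE singletonD)
      \<comment> \<open>Once the blocks are held, a point is determined by its value of
        \<open>l'\<close>, and two fixed points with different values fix all values.\<close>
      have two_points: "rigid t"
        if blk: "\<And>g u. g \<in> Stab t \<Longrightarrow> u \<in> U \<Longrightarrow> l (g u) = l u"
          and a: "a \<in> U" "\<And>g. g \<in> Stab t \<Longrightarrow> g a = a"
          and b: "b \<in> U" "\<And>g. g \<in> Stab t \<Longrightarrow> g b = b" and ab: "l' a \<noteq> l' b" for t a b
      proof (rule rigidI)
        fix g u assume g: "g \<in> Stab t" and u: "u \<in> U"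
        have "l' (g u) = l' u" using labels_fixed[OF l'(1) Stab_G[OF g] a(1) _ b(1) _ ab u] a(2)[OF g] b(2)[OF g] by simp
        then have "g u \<in> cls {l, l'} u" using blk[OF g u] maps[OF Stab_G[OF g] u] by (auto simp: cls_def)
        then show "g u \<in> cls L u" using one[OF u] s[OF u] by simp
      qed
      have diff: "l' a \<noteq> l' b" if "a \<in> U" "b \<in> cls {l} a" "a \<noteq> b" for a b
        using one[OF that(1)] that by (auto simp: cls_def)
      have "card (cls {l} ` U) = 3" using card_blocks l by metis
      then obtain h where h: "bij_betw h (cls {l} ` U) {0..<3::nat}"
        using ex_bij_betw_finite_nat[of "cls {l} ` U"] finU by auto
      have hlt: "h (cls {l} u) < 3" if "u \<in> U" for u using h that by (auto simp: bij_betw_def)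
      have blkI: "l (g u) = l u"
        if "g \<in> Stab t" "u \<in> U" "\<And>u v. u \<in> U \<Longrightarrow> v \<in> U \<Longrightarrow>
          card (cls {l} u \<inter> t) = card (cls {l} v \<inter> t) \<Longrightarrow> cls {l} u = cls {l} v" for g t u
        using Stab_cls_inj[of "{l}" g t u, OF _ that] l by (simp add: cls_def)
      have hinj: "cls {l} u = cls {l} v" if "u \<in> U" "v \<in> U" "h (cls {l} u) = h (cls {l} v)" for u v
        using h that unfolding bij_betw_def inj_on_def by (meson imageI)
      have hsurj: "\<exists>v\<in>U. h (cls {l} v) = i" if "i < 3" for i
        using h that unfolding bij_betw_def by (metis atLeastLessThan_iff imageE le0)
      have stay: "g a = a" if "g \<in> Stab t" "a \<in> U" "l (g a) = l a" "\<And>x. x \<in> cls {l} a \<Longrightarrow> (x \<in> t \<longleftrightarrow> a \<in> t) \<Longrightarrow> x = a"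
        for g t a
      proof -
        have "g a \<in> cls {l} a" using that maps[OF Stab_G[OF that(1)] that(2)] by (simp add: cls_def)
        then show ?thesis using that(4) Stab_mem[OF that(1,2)] by blast
      qed
      from 3 show ?thesis
      proof
        assume k2: "k = 2"
        obtain t where t: "t \<subseteq> U" "\<And>u. u \<in> U \<Longrightarrow> card (cls {l} u \<inter> t) = h (cls {l} u)"
        proof (rule prescribed[of h "{l}"])
          show "h (cls {l} u) \<le> card (cls {l} u)" if "u \<in> U" for u
            using hlt[OF that] ck[OF that] k2 by simp
        qed auto
        have blk: "l (g u) = l u" if "g \<in> Stab t" "u \<in> U" for g u
          by (rule blkI[OF that]) (use t(2) hinj in auto)
        \<comment> \<open>In the block with one black and one white point both points are
          fixed.\<close>
        obtain v where v: "v \<in> U" "h (cls {l} v) = 1" using hsurj[of 1] by auto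
        have c1: "card (cls {l} v \<inter> t) = 1" using t(2)[OF v(1)] v(2) by simp
        then obtain a where a: "cls {l} v \<inter> t = {a}" by (rule card_1_singletonE)
        have "card (cls {l} v - t) = 1"
          using card_Diff_subset_Int[of "cls {l} v" t] ck[OF v(1)] k2 c1 by simp
        then obtain b where b: "cls {l} v - t = {b}" by (rule card_1_singletonE)
        have av: "a \<in> cls {l} v" "a \<in> t" "b \<in> cls {l} v" "b \<notin> t" using a b by auto
        have aU: "a \<in> U" "b \<in> U" using av cls_sub by auto
        have ca: "cls {l} a = cls {l} v" "cls {l} b = cls {l} v" using av cls_eq by auto
        have "rigid t"
        proof (rule two_points[of t a b])
          show "l (g u) = l u" if "g \<in> Stab t" "u \<in> U" for g u by (rule blk[OF that])
          show "g a = a" if "g \<in> Stab t" for g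
            by (rule stay[OF that aU(1) blk[OF that aU(1)]]) (use a ca av in auto)
          show "g b = b" if "g \<in> Stab t" for g
            by (rule stay[OF that aU(2) blk[OF that aU(2)]]) (use b ca av in auto)
          show "l' a \<noteq> l' b" using diff[of a b] aU av ca by auto
        qed (use aU in auto)
        then show ?thesis using rigid_fine t(1) by blast
      next
        assume k3: "k = 3"
        obtain v where v: "v \<in> U" "h (cls {l} v) = 0" using hsurj[of 0] by auto
        obtain w where w: "w \<in> U" "h (cls {l} w) = 1" using hsurj[of 1] by auto
        have "\<exists>b\<in>cls {l} w. l' b \<noteq> l' v"
        proof (rule ccontr)
          assume "\<not> ?thesis"
          then have "cls {l} w \<subseteq> {w}" using diff[OF w(1)] cls_self[OF w(1), of "{l}"] by force
          then show False using card_mono[of "{w}" "cls {l} w"] ck[OF w(1)] k3 by simp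
        qed
        then obtain b where b: "b \<in> cls {l} w" "l' b \<noteq> l' v" by blast
        have bU: "b \<in> U" using b(1) cls_sub by (rule rev_subsetD)
        have cb: "cls {l} b = cls {l} w" using cls_eq[OF b(1)] .
        \<comment> \<open>The blocks get 1, 2 and 0 black points. The only black point
          \<open>v\<close> of the first and the only white point \<open>b\<close> of the second are
          fixed. As \<open>l'\<close> takes three values on a block, \<open>b\<close> could be
          chosen with a value different from that of \<open>v\<close>.\<close>
        define t where "t = insert v (cls {l} w - {b})"
        have "cls {l} v \<noteq> cls {l} w" using v(2) w(2) by (metis zero_neq_one)
        then have dis: "cls {l} v \<inter> cls {l} w = {}" by (rule cls_disj)
        have cnt: "card (cls {l} u \<inter> t) = (if h (cls {l} u) = 0 then 1 else if h (cls {l} u) = 1 then 2 else 0)"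
          if u: "u \<in> U" for u
        proof -
          consider "h (cls {l} u) = 0" | "h (cls {l} u) = 1" | "h (cls {l} u) = 2" using hlt[OF u] by linarith
          then show ?thesis
          proof cases
            case 1
            then have "cls {l} u = cls {l} v" using hinj u v by simp
            then have "cls {l} u \<inter> t = {v}" unfolding t_def using dis cls_self[OF v(1)] by blast
            then show ?thesis using 1 by simp
          next
            case 2
            then have "cls {l} u = cls {l} w" using hinj u w by simp
            then have "cls {l} u \<inter> t = cls {l} w - {b}" unfolding t_def using dis cls_self[OF v(1)] by blast
            then show ?thesis using 2 ck[OF w(1)] k3 b(1) by simp
          next
            case 3
            then have "h (cls {l} u) \<noteq> h (cls {l} v)" "h (cls {l} u) \<noteq> h (cls {l} w)" using v w by auto
            then have "cls {l} u \<noteq> cls {l} v" "cls {l} u \<noteq> cls {l} w" by auto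
            then have "cls {l} u \<inter> cls {l} v = {}" "cls {l} u \<inter> cls {l} w = {}"
              using cls_disj by auto
            then have "cls {l} u \<inter> t = {}" unfolding t_def using cls_self[OF v(1)] by blast
            then show ?thesis using 3 by simp
          qed
        qed
        have blk: "l (g u) = l u" if "g \<in> Stab t" "u \<in> U" for g u
        proof (rule blkI[OF that])
          fix u v assume uv: "u \<in> U" "v \<in> U" "card (cls {l} u \<inter> t) = card (cls {l} v \<inter> t)"
          have aux: "i = j" if "i < 3" "j < 3"
            "(if i = 0 then 1 else if i = 1 then 2 else 0 :: nat) = (if j = 0 then 1 else if j = 1 then 2 else 0)"
            for i j :: nat
            using that by (cases "i = 0"; cases "i = 1"; cases "j = 0"; cases "j = 1") auto
          have "h (cls {l} u) = h (cls {l} v)"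
            by (rule aux[OF hlt[OF uv(1)] hlt[OF uv(2)]])
              (use uv(3) in \<open>simp only: cnt[OF uv(1)] cnt[OF uv(2)]\<close>)
          then show "cls {l} u = cls {l} v" using hinj uv by simp
        qed
        have "rigid t"
        proof (rule two_points[of t v b])
          show "l (g u) = l u" if "g \<in> Stab t" "u \<in> U" for g u by (rule blk[OF that])
          show "g v = v" if "g \<in> Stab t" for g
            by (rule stay[OF that v(1) blk[OF that v(1)]]) (use dis in \<open>auto simp: t_def\<close>)
          show "g b = b" if "g \<in> Stab t" for g
          proof (rule stay[OF that bU blk[OF that bU]])
            have "b \<noteq> v" using b(2) by blast
            then have "b \<notin> t" by (simp add: t_def)
            then show "x = b" if "x \<in> cls {l} b" "(x \<in> t) = (b \<in> t)" for x
              using that unfolding cb by (simp add: t_def)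
          qed
          show "l' v \<noteq> l' b" using b(2) by simp
        qed (use v bU in auto)
        moreover have "t \<subseteq> U" unfolding t_def using v cls_sub[of "{l}" w] by blast
        ultimately show ?thesis using rigid_fine by auto
      qed
    qed
  qed
qed

lemma exists_fine: "\<exists>t. fine t"
proof (cases "L = {}")
  case True then show ?thesis by (rule fine_no_labels)
next
  case False
  then obtain l where l: "l \<in> L" by blast
  obtain u0 where u0: "u0 \<in> U" using neU by blast
  have pos: "card (cls L u0) > 0" using cls_self[OF u0] by (auto simp: card_gt_0_iff)
  then consider "card (cls L u0) = 1" | "card (cls L u0) = 2" | "card (cls L u0) \<ge> 3" by linarith
  then show ?thesis
  proof cases
    case 1
    have "cls L u = {u}" if "u \<in> U" for u
      using cls_card[OF order_refl that u0] 1 cls_self[OF that] by (metis card_1_singletonE singletonD)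
    then show ?thesis using fine_singletons[OF l] by blast
  qed (use fine_pairs[OF l u0] fine_large_classes[OF l u0] in auto)
qed

end

section \<open>Graphs with infinite motion\<close>

locale motion_graph =
  fixes E :: "'a \<Rightarrow> 'a \<Rightarrow> bool"
  assumes simple: "simple_graph E" and conn: "connected_graph E"
    and deg: "max_degree_le E 5" and motion: "infinite_motion E"
begin

lemma E_sym: "E u v \<Longrightarrow> E v u"
  using simple unfolding simple_graph_def by blast

lemma finite_nbrs: "finite {w. E v w}" and card_nbrs: "card {w. E v w} \<le> 5"
  using deg unfolding max_degree_le_def neighbours_def by auto

section \<open>Graph distance and automorphisms\<close>

abbreviation R :: "('a \<times> 'a) set" where "R \<equiv> {(x, y). E x y}"

definition d :: "'a \<Rightarrow> 'a \<Rightarrow> nat" where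
  "d u v = (LEAST n. (u, v) \<in> R ^^ n)"

lemma d_relpow: "(u, v) \<in> R ^^ d u v"
proof -
  have "(u, v) \<in> R\<^sup>*" using conn unfolding connected_graph_def by blast
  then obtain n where "(u, v) \<in> R ^^ n" using rtrancl_imp_relpow by blast
  then show ?thesis unfolding d_def by (rule LeastI)
qed

lemma d_le: "(u, v) \<in> R ^^ n \<Longrightarrow> d u v \<le> n"
  unfolding d_def by (rule Least_le)

lemma d_self [simp]: "d u u = 0"
  using d_le[of u u 0] by simp

lemma d_eq_0 [simp]: "d u v = 0 \<longleftrightarrow> u = v"
proof
  assume "d u v = 0"
  then show "u = v" using d_relpow[of u v] by simp
qed simp

lemma d_edge: "E u v \<Longrightarrow> d w v \<le> Suc (d w u)"
  using d_relpow[of w u] by (intro d_le) auto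

lemma d_pred:
  assumes "d u v = Suc n" shows "\<exists>p. E p v \<and> d u p = n"
proof -
  have "(u, v) \<in> R ^^ Suc n" using d_relpow[of u v] assms by simp
  then obtain p where p: "(u, p) \<in> R ^^ n" "E p v" by auto
  then have "d u p \<le> n" "Suc n \<le> Suc (d u p)" using d_le d_edge[OF p(2), of u] assms by auto
  then show ?thesis using p by auto
qed

lemma d_sym: "d u v = d v u"
proof -
  have "(y, x) \<in> R ^^ n" if "(x, y) \<in> R ^^ n" for x y n
    using that
  proof (induction n arbitrary: y)
    case (Suc n)
    then obtain z where "(x, z) \<in> R ^^ n" "E z y" by auto
    then have "(z, x) \<in> R ^^ n" "(y, z) \<in> R" using Suc E_sym by auto
    then show ?case by (rule relpow_Suc_I2[rotated])
  qed simp
  then show ?thesis using d_relpow d_le by (meson le_antisym)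
qed

lemma d_triangle: "d u w \<le> d u v + d v w"
proof (rule d_le)
  have "(u, w) \<in> R ^^ d u v O R ^^ d v w" using d_relpow by blast
  then show "(u, w) \<in> R ^^ (d u v + d v w)" by (simp add: relpow_add)
qed

lemma finite_ball: "finite {v. d u v \<le> n}"
proof (induction n)
  case (Suc n)
  have "{v. d u v \<le> Suc n} \<subseteq> {v. d u v \<le> n} \<union> (\<Union>p\<in>{v. d u v \<le> n}. {w. E p w})"
  proof
    fix v assume "v \<in> {v. d u v \<le> Suc n}"
    then have "d u v \<le> n \<or> d u v = Suc n" by auto
    then show "v \<in> {v. d u v \<le> n} \<union> (\<Union>p\<in>{v. d u v \<le> n}. {w. E p w})"
      using d_pred[of u v n] by blast
  qed
  then show ?case using Suc finite_nbrs by (meson finite_UN finite_Un finite_subset)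
qed simp

definition Aut :: "('a \<Rightarrow> 'a) set" where "Aut = {g. graph_aut E g}"

lemma Aut_E: "g \<in> Aut \<Longrightarrow> E (g u) (g v) \<longleftrightarrow> E u v"
  unfolding Aut_def graph_aut_def by blast

lemma Aut_bij: "g \<in> Aut \<Longrightarrow> bij g"
  unfolding Aut_def graph_aut_def by blast

lemma Aut_inj: "g \<in> Aut \<Longrightarrow> g u = g v \<longleftrightarrow> u = v"
  using Aut_bij by (metis bij_is_inj injD)

lemma Aut_id: "id \<in> Aut"
  unfolding Aut_def graph_aut_def by auto

lemma Aut_comp: "g \<in> Aut \<Longrightarrow> h \<in> Aut \<Longrightarrow> g \<circ> h \<in> Aut"
  unfolding Aut_def graph_aut_def by (auto intro: bij_comp)

lemma Aut_inv_right: "g \<in> Aut \<Longrightarrow> g (inv g v) = v"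
  by (simp add: Aut_bij bij_is_surj surj_f_inv_f)

lemma Aut_inv_left: "g \<in> Aut \<Longrightarrow> inv g (g v) = v"
  by (simp add: Aut_bij bij_is_inj)

lemma Aut_inv: "g \<in> Aut \<Longrightarrow> inv g \<in> Aut"
proof -
  assume g: "g \<in> Aut"
  have "E u v \<longleftrightarrow> E (inv g u) (inv g v)" for u v
    using Aut_E[OF g, of "inv g u" "inv g v"] by (simp add: Aut_inv_right[OF g])
  then show ?thesis unfolding Aut_def graph_aut_def using bij_imp_bij_inv[OF Aut_bij[OF g]] by simp
qed

lemma Aut_d_le: assumes "g \<in> Aut" shows "d (g u) (g v) \<le> d u v"
proof (rule d_le)
  have "(g u, g w) \<in> R ^^ n" if "(u, w) \<in> R ^^ n" for n w
    using that
  proof (induction n arbitrary: w)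
    case (Suc n)
    then obtain z where "(u, z) \<in> R ^^ n" "E z w" by auto
    then have "(g u, g z) \<in> R ^^ n" "(g z, g w) \<in> R" using Suc Aut_E[OF assms] by auto
    then show ?case by auto
  qed simp
  then show "(g u, g v) \<in> R ^^ d u v" using d_relpow by blast
qed

lemma Aut_d: assumes "g \<in> Aut" shows "d (g u) (g v) = d u v"
  using Aut_d_le[OF assms, of u v] Aut_d_le[OF Aut_inv[OF assms], of "g u" "g v"]
  by (simp add: Aut_inv_left[OF assms])

text \<open>Extending an automorphism by the identity outside a finite set gives a finitary automorphism,
  which is trivial by infinite motion.\<close>
lemma patch:
  assumes g: "g \<in> Aut" and D: "finite D" "g ` D = D"
    and bd: "\<And>v w. v \<in> D \<Longrightarrow> w \<notin> D \<Longrightarrow> E v w \<longleftrightarrow> E (g v) w" and v: "v \<in> D"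
  shows "g v = v"
proof -
  define h where "h v = (if v \<in> D then g v else v)" for v
  have gD: "g v \<in> D \<longleftrightarrow> v \<in> D" for v
    using D(2) Aut_inj[OF g] by (metis (no_types, lifting) imageE imageI)
  have hD: "h v \<in> D \<longleftrightarrow> v \<in> D" for v using gD by (simp add: h_def)
  have "inj h"
  proof (rule injI)
    fix x y assume xy: "h x = h y"
    then have "x \<in> D \<longleftrightarrow> y \<in> D" using hD by metis
    then show "x = y" using xy Aut_inj[OF g] by (auto simp: h_def split: if_splits)
  qed
  moreover have "surj h"
  proof -
    have "\<exists>x. y = h x" for y
    proof (cases "y \<in> D")
      case True
      then obtain x where "x \<in> D" "y = g x" using D(2) by blast
      then show ?thesis by (auto simp: h_def)
    qed (auto simp: h_def)
    then show ?thesis by (auto simp: surj_def)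
  qed
  ultimately have "bij h" by (simp add: bij_def)
  moreover have "E x y \<longleftrightarrow> E (h x) (h y)" for x y
    using bd[of x y] bd[of y x] Aut_E[OF g] E_sym by (auto simp: h_def)
  ultimately have "graph_aut E h" unfolding graph_aut_def by blast
  moreover have "finite {v. h v \<noteq> v}"
    by (rule finite_subset[OF _ D(1)]) (auto simp: h_def)
  ultimately have "h = id" using motion unfolding infinite_motion_def by blast
  then have "h v = v" by simp
  then show ?thesis using v by (simp add: h_def)
qed

end

locale rooted_graph = motion_graph E for E :: "'a \<Rightarrow> 'a \<Rightarrow> bool" +
  fixes r :: 'a
begin

section \<open>Parents, children and the colour groups of the rooted graph\<close>

definition par :: "'a \<Rightarrow> 'a set" where
  "par v = {p. E p v \<and> d r v = Suc (d r p)}"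

definition kids :: "'a \<Rightarrow> 'a set" where
  "kids v = {w. v \<in> par w}"

definition Gam :: "('a \<Rightarrow> bool) \<Rightarrow> nat \<Rightarrow> ('a \<Rightarrow> 'a) set" where
  "Gam c n = {g \<in> Aut. g r = r \<and> (\<forall>v. d r v \<le> n \<longrightarrow> c (g v) = c v)}"

definition orb :: "('a \<Rightarrow> bool) \<Rightarrow> nat \<Rightarrow> 'a \<Rightarrow> 'a set" where
  "orb c n u = (\<lambda>g. g u) ` Gam c n"

lemma par_level: "p \<in> par v \<Longrightarrow> d r v = Suc (d r p)"
  unfolding par_def by simp

lemma par_E: "p \<in> par v \<Longrightarrow> E p v"
  unfolding par_def by simp

lemma par_nonempty: "d r v = Suc n \<Longrightarrow> \<exists>p. p \<in> par v"
  using d_pred[of r v n] unfolding par_def by auto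

lemma finite_par: "finite (par v)"
  by (rule finite_subset[OF _ finite_nbrs[of v]]) (auto simp: par_def E_sym)

lemma kids_sub: "kids v \<subseteq> {w. E v w}"
  unfolding kids_def par_def by auto

lemma finite_kids: "finite (kids v)"
  using kids_sub finite_nbrs finite_subset by blast

lemma card_kids: "card (kids v) \<le> 5"
  using card_mono[OF finite_nbrs kids_sub, of v] card_nbrs[of v] by simp

lemma card_kids_par:
  assumes "v \<noteq> r" shows "card (kids v) + card (par v) \<le> 5"
proof -
  have "kids v \<inter> par v = {}" unfolding kids_def par_def by auto
  then have "card (kids v) + card (par v) = card (kids v \<union> par v)"
    using card_Un_disjoint finite_kids finite_par by metis
  also have "\<dots> \<le> card {w. E v w}"
    by (rule card_mono[OF finite_nbrs]) (auto simp: kids_def par_def E_sym)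
  finally show ?thesis using card_nbrs[of v] by simp
qed

lemma card_par_pos: assumes "v \<noteq> r" shows "card (par v) > 0"
proof -
  have "d r v \<noteq> 0" using assms by auto
  then obtain n where "d r v = Suc n" using not0_implies_Suc by blast
  then show ?thesis using par_nonempty finite_par by (metis card_gt_0_iff empty_iff)
qed

lemma card_kids4: "v \<noteq> r \<Longrightarrow> card (kids v) \<le> 4"
  using card_kids_par card_par_pos by fastforce

lemma edge_levels: "E u v \<Longrightarrow> d r u = d r v \<or> u \<in> par v \<or> v \<in> par u"
proof -
  assume "E u v"
  moreover from this have "E v u" by (rule E_sym)
  ultimately have "d r v \<le> Suc (d r u)" "d r u \<le> Suc (d r v)" "E u v" "E v u" using d_edge by auto
  then show ?thesis unfolding par_def by auto
qed

lemma Gam_Aut: "g \<in> Gam c n \<Longrightarrow> g \<in> Aut"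
  unfolding Gam_def by simp

lemma Gam_col: "g \<in> Gam c n \<Longrightarrow> d r v \<le> n \<Longrightarrow> c (g v) = c v"
  unfolding Gam_def by simp

lemma Gam_r: "g \<in> Gam c n \<Longrightarrow> g r = r"
  unfolding Gam_def by simp

lemma Aut_level: "g \<in> Aut \<Longrightarrow> g r = r \<Longrightarrow> d r (g v) = d r v"
  using Aut_d[of g r v] by simp

lemma Gam_level [simp]: "g \<in> Gam c n \<Longrightarrow> d r (g v) = d r v"
  using Aut_level Gam_Aut Gam_r by blast

lemma Gam_id: "id \<in> Gam c n"
  unfolding Gam_def using Aut_id by auto

lemma Gam_comp: "g \<in> Gam c n \<Longrightarrow> h \<in> Gam c n \<Longrightarrow> g \<circ> h \<in> Gam c n"
proof -
  assume g: "g \<in> Gam c n" and h: "h \<in> Gam c n"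
  have "c (g (h v)) = c v" if "d r v \<le> n" for v
    using Gam_col[OF g, of "h v"] Gam_col[OF h that] Gam_level[OF h, of v] that by simp
  then show "g \<circ> h \<in> Gam c n"
    using Aut_comp[OF Gam_Aut[OF g] Gam_Aut[OF h]] Gam_r[OF g] Gam_r[OF h] unfolding Gam_def by simp
qed

lemma Gam_inv: assumes g: "g \<in> Gam c n" shows "inv g \<in> Gam c n"
proof -
  have A: "g \<in> Aut" using Gam_Aut[OF g] .
  have lev: "d r (inv g v) = d r v" for v
    using Gam_level[OF g, of "inv g v"] Aut_inv_right[OF A] by simp
  have "c (inv g v) = c v" if "d r v \<le> n" for v
    using Gam_col[OF g, of "inv g v"] that lev Aut_inv_right[OF A] by simp
  moreover have "inv g r = r" using Aut_inv_left[OF A, of r] Gam_r[OF g] by simp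
  ultimately show ?thesis unfolding Gam_def using Aut_inv[OF A] by simp
qed

lemma Gam_mono: "m \<le> n \<Longrightarrow> Gam c n \<subseteq> Gam c m"
  unfolding Gam_def by auto

lemma Gam_cong:
  assumes "\<And>v. d r v \<le> n \<Longrightarrow> c v = c' v" shows "Gam c n = Gam c' n"
proof -
  have step: "Gam a n \<subseteq> Gam b n" if "\<And>v. d r v \<le> n \<Longrightarrow> a v = b v" for a b
    using that Aut_level unfolding Gam_def by auto
  show ?thesis using step[of c c'] step[of c' c] assms by auto
qed

lemma Gam_Suc: "g \<in> Gam c (Suc n) \<longleftrightarrow> g \<in> Gam c n \<and> (\<forall>v. d r v = Suc n \<longrightarrow> c (g v) = c v)"
  unfolding Gam_def by (auto simp: le_Suc_eq)

lemma par_image: assumes "g \<in> Gam c n" shows "par (g v) = g ` par v"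
proof
  have A: "g \<in> Aut" using Gam_Aut[OF assms] .
  show "g ` par v \<subseteq> par (g v)"
    using assms Aut_E[OF A] by (auto simp: par_def)
  show "par (g v) \<subseteq> g ` par v"
  proof
    fix p assume p: "p \<in> par (g v)"
    have "E (inv g p) v" using p Aut_E[OF A, of "inv g p" v] Aut_inv_right[OF A] by (simp add: par_def)
    moreover have "d r (inv g p) = d r p" using Gam_inv[OF assms] by simp
    ultimately have "inv g p \<in> par v" using p assms by (simp add: par_def)
    then show "p \<in> g ` par v" using Aut_inv_right[OF A] by (metis imageI)
  qed
qed

lemma par_mem: "g \<in> Gam c n \<Longrightarrow> g p \<in> par (g v) \<longleftrightarrow> p \<in> par v"
  using Aut_E[OF Gam_Aut] by (simp add: par_def)

lemma orb_self [simp]: "u \<in> orb c n u"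
  unfolding orb_def by (rule image_eqI[OF _ Gam_id]) simp

lemma orb_I: "g \<in> Gam c n \<Longrightarrow> g u \<in> orb c n u"
  unfolding orb_def by simp

lemma orb_closed: "g \<in> Gam c n \<Longrightarrow> v \<in> orb c n u \<Longrightarrow> g v \<in> orb c n u"
proof -
  assume g: "g \<in> Gam c n" and "v \<in> orb c n u"
  then obtain h where "h \<in> Gam c n" "v = h u" unfolding orb_def by auto
  then show "g v \<in> orb c n u" using orb_I[OF Gam_comp[OF g], of h u] by simp
qed

lemma orb_trans: assumes "v \<in> orb c n u" "w \<in> orb c n u" shows "\<exists>g\<in>Gam c n. g v = w"
proof -
  obtain g h where gh: "g \<in> Gam c n" "v = g u" "h \<in> Gam c n" "w = h u"
    using assms unfolding orb_def by auto
  have "(h \<circ> inv g) v = w" using gh Aut_inv_left[OF Gam_Aut[OF gh(1)]] by simp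
  then show ?thesis using Gam_comp[OF gh(3) Gam_inv[OF gh(1)]] by blast
qed

lemma orb_eq: assumes "v \<in> orb c n u" shows "orb c n v = orb c n u"
proof
  obtain g where g: "g \<in> Gam c n" "g v = u" using orb_trans[OF assms orb_self] by blast
  show "orb c n v \<subseteq> orb c n u" using orb_closed assms unfolding orb_def[of c n v] by auto
  have "u \<in> orb c n v" using g orb_I by metis
  then show "orb c n u \<subseteq> orb c n v" using orb_closed unfolding orb_def[of c n u] by auto
qed

lemma orb_level: "v \<in> orb c n u \<Longrightarrow> d r v = d r u"
  unfolding orb_def by auto

lemma finite_orb [simp]: "finite (orb c n u)"
  by (rule finite_subset[OF _ finite_ball[of r "d r u"]]) (auto dest: orb_level)

lemma orb_mono: "m \<le> n \<Longrightarrow> orb c n u \<subseteq> orb c m u"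
  unfolding orb_def using Gam_mono by blast

lemma orb_image: "g \<in> Gam c n \<Longrightarrow> g ` orb c n u = orb c n u"
proof
  assume g: "g \<in> Gam c n"
  show "g ` orb c n u \<subseteq> orb c n u" using orb_closed[OF g] by blast
  show "orb c n u \<subseteq> g ` orb c n u"
  proof
    fix v assume v: "v \<in> orb c n u"
    have "inv g v \<in> orb c n u" using orb_closed[OF Gam_inv[OF g] v] .
    then show "v \<in> g ` orb c n u" using Aut_inv_right[OF Gam_Aut[OF g]] by (metis imageI)
  qed
qed

lemma card_orb_pos: "card (orb c n u) > 0"
  using orb_self finite_orb by (metis card_gt_0_iff empty_iff)

lemma orb_1_iff: "card (orb c n u) = 1 \<longleftrightarrow> (\<forall>g\<in>Gam c n. g u = u)"
proof
  assume "card (orb c n u) = 1"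
  then obtain x where "orb c n u = {x}" by (rule card_1_singletonE)
  then show "\<forall>g\<in>Gam c n. g u = u" using orb_self orb_I by (metis singletonD)
next
  assume "\<forall>g\<in>Gam c n. g u = u"
  then have "orb c n u = {u}" using orb_self[of u c n] unfolding orb_def by auto
  then show "card (orb c n u) = 1" by simp
qed


section \<open>Good colourings\<close>

definition relevant :: "('a \<Rightarrow> bool) \<Rightarrow> nat \<Rightarrow> 'a \<Rightarrow> 'a \<Rightarrow> bool" where
  "relevant c n u a \<longleftrightarrow> (\<exists>x\<in>orb c n u. \<exists>y\<in>orb c n u. a \<in> par x \<and> a \<notin> par y)"

definition Lab :: "('a \<Rightarrow> bool) \<Rightarrow> nat \<Rightarrow> 'a \<Rightarrow> ('a \<Rightarrow> 'a set) set" where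
  "Lab c n u = (\<lambda>a w. par w \<inter> orb c n a) ` {a. relevant c n u a}"

text \<open>\<open>G1\<close> and \<open>G2\<close> are exactly what is needed to truncate an element of \<open>Gam c (Suc n)\<close> to
  an automorphism in \<open>Gam_fixes\<close>.\<close>
definition G1 :: "('a \<Rightarrow> bool) \<Rightarrow> nat \<Rightarrow> bool" where
  "G1 c n \<longleftrightarrow> (\<forall>u. d r u = n \<longrightarrow> card (orb c n u) \<le> 3 \<and>
     (card (orb c n u) = 3 \<longrightarrow> (\<forall>v\<in>orb c n u. par v = par u)))"

definition G2 :: "('a \<Rightarrow> bool) \<Rightarrow> nat \<Rightarrow> bool" where
  "G2 c n \<longleftrightarrow> (\<forall>w v. d r w = Suc n \<and> v \<in> par w \<and> card (orb c n v) = 2 \<and> \<not> orb c n v \<subseteq> par w \<longrightarrow>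
     (\<forall>g\<in>Gam c (Suc n). g v = v))"

definition good :: "('a \<Rightarrow> bool) \<Rightarrow> bool" where
  "good c \<longleftrightarrow> (\<forall>n. G1 c n \<and> G2 c n)"

definition black :: "('a \<Rightarrow> bool) \<Rightarrow> nat \<Rightarrow> 'a \<Rightarrow> 'a set" where
  "black c n u = {v \<in> orb c n u. c v}"

definition strong :: "('a \<Rightarrow> bool) \<Rightarrow> nat \<Rightarrow> bool" where
  "strong c n \<longleftrightarrow> (\<forall>u. d r u = Suc n \<longrightarrow>
     labelled_action.fine (Gam c n) (orb c n u) (Lab c n u) (black c n u))"

lemma par_orb_image: "g \<in> Gam c n \<Longrightarrow> par (g w) \<inter> orb c n a = g ` (par w \<inter> orb c n a)"
  using par_image[of g c n w] orb_image[of g c n a] Aut_inj[OF Gam_Aut, of g c n] 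
  by (simp add: image_Int inj_def)

lemma relevant_level: "relevant c n u a \<Longrightarrow> d r u = Suc (d r a)"
  unfolding relevant_def using par_level orb_level by metis

text \<open>The root is fixed, hence a parent of the whole orbit or of no point of it. This buys the
  bound of four children for the vertices that define labels.\<close>

lemma relevant_not_root: "relevant c n u a \<Longrightarrow> a \<noteq> r"
proof
  assume "relevant c n u a" "a = r"
  then obtain x y where xy: "x \<in> orb c n u" "y \<in> orb c n u" "r \<in> par x" "r \<notin> par y"
    unfolding relevant_def by auto
  obtain g where "g \<in> Gam c n" "g x = y" using orb_trans[OF xy(1,2)] by blast
  then show False using par_mem[of g c n r x] xy Gam_r by force
qed

lemma label_card:
  assumes "x \<in> orb c n u" "y \<in> orb c n u"
  shows "card (par x \<inter> orb c n a) = card (par y \<inter> orb c n a)"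
proof -
  obtain g where g: "g \<in> Gam c n" "g x = y" using orb_trans[OF assms] by blast
  have "inj_on g (par x \<inter> orb c n a)"
    using Aut_inj[OF Gam_Aut[OF g(1)]] by (auto simp: inj_on_def)
  then show ?thesis using par_orb_image[OF g(1), of x a] g(2) by (simp add: card_image)
qed

lemma label_proper:
  assumes "relevant c n u a" "x \<in> orb c n u"
  shows "0 < card (par x \<inter> orb c n a)" "card (par x \<inter> orb c n a) < card (orb c n a)"
proof -
  obtain y z where yz: "y \<in> orb c n u" "z \<in> orb c n u" "a \<in> par y" "a \<notin> par z"
    using assms(1) unfolding relevant_def by blast
  have "a \<in> par y \<inter> orb c n a" using yz orb_self by blast
  then have "0 < card (par y \<inter> orb c n a)" by (auto simp: card_gt_0_iff)
  then show "0 < card (par x \<inter> orb c n a)" using label_card[OF assms(2) yz(1)] by simp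
  have "a \<in> orb c n a" "a \<notin> par z \<inter> orb c n a" using yz by auto
  then have "par z \<inter> orb c n a \<subset> orb c n a" by blast
  then have "card (par z \<inter> orb c n a) < card (orb c n a)" by (simp add: psubset_card_mono)
  then show "card (par x \<inter> orb c n a) < card (orb c n a)" using label_card[OF assms(2) yz(2)] by simp
qed

lemma relevant_orb_card:
  assumes "relevant c n u a" shows "2 \<le> card (orb c n a)"
  using label_proper[OF assms orb_self] by linarith

text \<open>Parent sets inside an orbit of two or three vertices are proper, non-empty and of
  constant size, so a binomial coefficient bounds the number of values by three. Points with equal
  labels are children of a common vertex other than the root. Without labels all points have the
  same parents, and five bounds the children of any vertex.\<close>

lemma orbit_action:
  assumes G1: "G1 c n" and u: "d r u = Suc n"
  shows "labelled_action (Gam c n) (orb c n u) (Lab c n u)"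
proof
  show "finite (orb c n u)" by simp
  show "orb c n u \<noteq> {}" using orb_self by blast
  show "g v \<in> orb c n u" if "g \<in> Gam c n" "v \<in> orb c n u" for g v using orb_closed[OF that] .
  show "inj_on g (orb c n u)" if "g \<in> Gam c n" for g
    using Aut_inj[OF Gam_Aut[OF that]] by (auto simp: inj_on_def)
  show "\<exists>g\<in>Gam c n. g v = w" if "v \<in> orb c n u" "w \<in> orb c n u" for v w using orb_trans[OF that] .
next
  fix l g v w assume l: "l \<in> Lab c n u" and g: "g \<in> Gam c n"
  obtain a where a: "l = (\<lambda>w. par w \<inter> orb c n a)" using l unfolding Lab_def by auto
  show "l (g v) = l (g w) \<longleftrightarrow> l v = l w"
    unfolding a par_orb_image[OF g] using Aut_inj[OF Gam_Aut[OF g]] by (simp add: inj_image_eq_iff inj_def)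
next
  fix l assume l: "l \<in> Lab c n u"
  obtain a where a: "l = (\<lambda>w. par w \<inter> orb c n a)" "relevant c n u a" using l unfolding Lab_def by auto
  have Q: "card (orb c n a) \<le> 3" using G1 relevant_level[OF a(2)] u unfolding G1_def by auto
  define j where "j = card (par u \<inter> orb c n a)"
  have j: "0 < j" "j < card (orb c n a)" using label_proper[OF a(2) orb_self] j_def by auto
  have subB: "l ` orb c n u \<subseteq> {B. B \<subseteq> orb c n a \<and> card B = j}"
    using label_card[OF _ orb_self] unfolding a(1) j_def by auto
  have "card {B. B \<subseteq> orb c n a \<and> card B = j} = card (orb c n a) choose j"
    by (rule n_subsets) simp
  moreover have "finite {B. B \<subseteq> orb c n a \<and> card B = j}" by simp
  ultimately have "card (l ` orb c n u) \<le> card (orb c n a) choose j" using card_mono[OF _ subB] by simp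
  moreover have "card (orb c n a) choose j \<le> 3"
  proof -
    consider "card (orb c n a) = 2" "j = 1" | "card (orb c n a) = 3" "j = 1" | "card (orb c n a) = 3" "j = 2"
      using j Q by linarith
    then show ?thesis by cases (simp_all add: numeral_2_eq_2 numeral_3_eq_3)
  qed
  moreover have "card (l ` orb c n u) \<ge> 2"
  proof -
    obtain x y where xy: "x \<in> orb c n u" "y \<in> orb c n u" "a \<in> par x" "a \<notin> par y"
      using a(2) unfolding relevant_def by blast
    then have "a \<in> l x" "a \<notin> l y" unfolding a(1) by auto
    then have "l x \<noteq> l y" by auto
    then have "card {l x, l y} = 2" by simp
    moreover have "{l x, l y} \<subseteq> l ` orb c n u" using xy by auto
    ultimately show ?thesis using card_mono[of "l ` orb c n u" "{l x, l y}"] by simp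
  qed
  ultimately show "card (l ` orb c n u) = 2 \<or> card (l ` orb c n u) = 3" by linarith
next
  fix l x assume l: "l \<in> Lab c n u" and x: "x \<in> orb c n u"
  obtain a where a: "l = (\<lambda>w. par w \<inter> orb c n a)" "relevant c n u a" using l unfolding Lab_def by auto
  have "par x \<inter> orb c n a \<noteq> {}" using label_proper(1)[OF a(2) x] by auto
  then obtain b where b: "b \<in> par x" "b \<in> orb c n a" by blast
  have "b \<noteq> r"
  proof
    assume "b = r"
    then have "d r a = 0" using orb_level[OF b(2)] by simp
    then show False using relevant_not_root[OF a(2)] by simp
  qed
  then have "card (kids b) \<le> 4" by (rule card_kids4)
  moreover have "{v \<in> orb c n u. l v = l x} \<subseteq> kids b" using b unfolding a(1) kids_def by blast
  ultimately show "card {v \<in> orb c n u. l v = l x} \<le> 4" using card_mono[OF finite_kids] by (meson le_trans)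
next
  assume "Lab c n u = {}"
  then have nr: "\<not> relevant c n u a" for a unfolding Lab_def by auto
  obtain p where p: "p \<in> par u" using par_nonempty[OF u] by blast
  then have "orb c n u \<subseteq> kids p" using nr[of p] orb_self unfolding relevant_def kids_def by blast
  then show "card (orb c n u) \<le> 5" using card_mono[OF finite_kids] card_kids by (meson le_trans)
qed

text \<open>Vertices that are not relevant are parents of all points of the orbit or of none, so
  equal labels mean equal parent sets.\<close>

lemma orbit_cls:
  assumes "G1 c n" "d r u = Suc n" "w \<in> orb c n u"
  shows "labelled_action.cls (orb c n u) (Lab c n u) w = {v \<in> orb c n u. par v = par w}"
proof -
  interpret A: labelled_action "Gam c n" "orb c n u" "Lab c n u" using orbit_action assms by blast
  have "par v = par w" if v: "v \<in> orb c n u" and eq: "\<And>l. l \<in> Lab c n u \<Longrightarrow> l v = l w" for v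
  proof (rule set_eqI)
    fix a
    show "a \<in> par v \<longleftrightarrow> a \<in> par w"
    proof (cases "relevant c n u a")
      case True
      then have "par v \<inter> orb c n a = par w \<inter> orb c n a" using eq unfolding Lab_def by blast
      then show ?thesis using orb_self by blast
    next
      case False
      then show ?thesis using v assms(3) unfolding relevant_def by blast
    qed
  qed
  then show ?thesis unfolding A.cls_def by (auto simp: Lab_def)
qed

text \<open>Only an inclusion, since an element of \<open>Gam c (Suc n)\<close> respects all orbits
  of the level at once. The requirements collected in \<open>fine\<close> therefore have to pass to
  smaller groups, and they do.\<close>

lemma Gam_Suc_Stab:
  assumes "G1 c n" "d r u = Suc n"
  shows "Gam c (Suc n) \<subseteq> labelled_action.Stab (Gam c n) (orb c n u) (black c n u)"
proof -
  interpret A: labelled_action "Gam c n" "orb c n u" "Lab c n u" using orbit_action assms by blast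
  show ?thesis
  proof
    fix g assume g: "g \<in> Gam c (Suc n)"
    then have g': "g \<in> Gam c n" using Gam_Suc by blast
    have "g v \<in> black c n u \<longleftrightarrow> v \<in> black c n u" if v: "v \<in> orb c n u" for v
      using Gam_col[OF g, of v] orb_closed[OF g' v] orb_level[OF v] v assms(2) unfolding black_def by simp
    then show "g \<in> A.Stab (black c n u)" using g' unfolding A.Stab_def by simp
  qed
qed

lemma strong_G1:
  assumes G1: "G1 c n" and st: "strong c n" shows "G1 c (Suc n)"
  unfolding G1_def
proof (intro allI impI)
  fix u assume u: "d r u = Suc n"
  interpret A: labelled_action "Gam c n" "orb c n u" "Lab c n u" using orbit_action G1 u by blast
  let ?O = "(\<lambda>g. g u) ` A.Stab (black c n u)"
  have sub: "orb c (Suc n) u \<subseteq> ?O" unfolding orb_def[of c "Suc n"] using Gam_Suc_Stab[OF G1 u] by blast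
  have fin: "finite ?O" using A.orb_sub[of u "black c n u"] by (rule finite_subset) auto
  have "A.fine (black c n u)" using st u unfolding strong_def by simp
  then have "A.small_orbits (black c n u)" unfolding A.fine_def by simp
  then have so: "card ?O \<le> 3" "card ?O = 3 \<Longrightarrow> ?O \<subseteq> A.cls (Lab c n u) u"
    unfolding A.small_orbits_def using orb_self[of u c n] by (blast, blast)
  have le: "card (orb c (Suc n) u) \<le> card ?O" using card_mono[OF fin sub] .
  show "card (orb c (Suc n) u) \<le> 3 \<and> (card (orb c (Suc n) u) = 3 \<longrightarrow> (\<forall>v\<in>orb c (Suc n) u. par v = par u))"
  proof (intro conjI impI ballI)
    show "card (orb c (Suc n) u) \<le> 3" using le so by simp
    fix v assume "card (orb c (Suc n) u) = 3" "v \<in> orb c (Suc n) u"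
    then have "v \<in> A.cls (Lab c n u) u" using le so sub by auto
    then show "par v = par u" using orbit_cls[OF G1 u orb_self] by simp
  qed
qed

text \<open>A class held in place has a parent set preserved by \<open>g\<close>. By
  \<open>label_card\<close> this set meets the pair in exactly one point; that point is fixed, and
  with it its partner.\<close>

lemma strong_G2:
  assumes G1: "G1 c n" and st: "strong c n" shows "G2 c n"
  unfolding G2_def
proof (intro allI impI ballI, elim conjE)
  fix w v g assume w: "d r w = Suc n" and v: "v \<in> par w" "card (orb c n v) = 2" "\<not> orb c n v \<subseteq> par w"
    and g: "g \<in> Gam c (Suc n)"
  interpret A: labelled_action "Gam c n" "orb c n w" "Lab c n w" using orbit_action G1 w by blast
  have g': "g \<in> Gam c n" using g Gam_Suc by blast
  have "A.fine (black c n w)" using st w unfolding strong_def by simp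
  then have "A.fixes_class (black c n w)" unfolding A.fine_def by simp
  then obtain u where u: "u \<in> orb c n w" "g u \<in> A.cls (Lab c n w) u"
    using Gam_Suc_Stab[OF G1 w] g unfolding A.fixes_class_def by blast
  then have pu: "par (g u) = par u" using orbit_cls[OF G1 w u(1)] by simp
  have "par w \<inter> orb c n v \<subset> orb c n v" using v(3) by blast
  then have "card (par w \<inter> orb c n v) < 2" using v(2) psubset_card_mono[OF finite_orb] by metis
  moreover have "v \<in> par w \<inter> orb c n v" using v(1) by simp
  then have "card (par w \<inter> orb c n v) > 0" by (auto simp: card_gt_0_iff)
  ultimately have "card (par u \<inter> orb c n v) = 1" using label_card[OF u(1) orb_self, of v] by simp
  then obtain x where x: "par u \<inter> orb c n v = {x}" by (rule card_1_singletonE)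
  have "{x} = g ` {x}" using par_orb_image[OF g', of u v] pu x by simp
  then have gx: "g x = x" by simp
  show "g v = v"
  proof (cases "v = x")
    case False
    have xv: "x \<in> orb c n v" using x by blast
    obtain a b where ab: "orb c n v = {a, b}" using v(2) by (meson card_2_iff)
    have "g v \<in> orb c n v" using orb_I[OF g'] .
    moreover have "g v \<noteq> x" using gx False Aut_inj[OF Gam_Aut[OF g'], of v x] by simp
    ultimately show ?thesis using ab xv False orb_self[of v c n] by auto
  qed (use gx in simp)
qed

text \<open>Count the edges between the two orbits: the size of the first, 1 or 2, times the common
  degree \<open>kk\<close> is a multiple of 3. So 3 divides \<open>kk\<close>, and 0 <
  \<open>kk\<close> \<le> 3 makes the bipartite graph complete.\<close>

lemma pair_triple_adj:
  assumes v: "card (orb c n v) \<le> 2" and w: "card (orb c n w) = 3" and E: "E v w" and x: "x \<in> orb c n v"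
  shows "E x w"
proof -
  let ?A = "orb c n v" and ?T = "orb c n w"
  have k: "card {y \<in> ?T. E x y} = card {y \<in> ?T. E x' y}" if xA: "x \<in> ?A" "x' \<in> ?A" for x x'
  proof -
    obtain g where g: "g \<in> Gam c n" "g x = x'" using orb_trans[OF xA] by blast
    note A = Gam_Aut[OF g(1)]
    have "{y \<in> ?T. E x' y} = g ` {y \<in> ?T. E x y}"
    proof
      show "g ` {y \<in> ?T. E x y} \<subseteq> {y \<in> ?T. E x' y}"
        using g Aut_E[OF A] orb_closed[OF g(1)] by auto
      show "{y \<in> ?T. E x' y} \<subseteq> g ` {y \<in> ?T. E x y}"
      proof
        fix y assume y: "y \<in> {y \<in> ?T. E x' y}"
        have "inv g y \<in> ?T" using orb_closed[OF Gam_inv[OF g(1)]] y by blast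
        moreover have "E x (inv g y)" using Aut_E[OF A, of x "inv g y"] Aut_inv_right[OF A] g y by simp
        ultimately show "y \<in> g ` {y \<in> ?T. E x y}" using Aut_inv_right[OF A, of y] by (metis (mono_tags, lifting) imageI mem_Collect_eq)
      qed
    qed
    moreover have "inj_on g {y \<in> ?T. E x y}" using Aut_inj[OF A] by (auto simp: inj_on_def)
    ultimately show ?thesis by (simp add: card_image)
  qed
  have e: "card {z \<in> ?A. E z y} = card {z \<in> ?A. E z w}" if yT: "y \<in> ?T" for y
  proof -
    obtain g where g: "g \<in> Gam c n" "g w = y" using orb_trans[OF orb_self yT] by blast
    note A = Gam_Aut[OF g(1)]
    have "{z \<in> ?A. E z y} = g ` {z \<in> ?A. E z w}"
    proof
      show "g ` {z \<in> ?A. E z w} \<subseteq> {z \<in> ?A. E z y}"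
        using g Aut_E[OF A] orb_closed[OF g(1)] by auto
      show "{z \<in> ?A. E z y} \<subseteq> g ` {z \<in> ?A. E z w}"
      proof
        fix z assume z: "z \<in> {z \<in> ?A. E z y}"
        have "inv g z \<in> ?A" using orb_closed[OF Gam_inv[OF g(1)]] z by blast
        moreover have "E (inv g z) w" using Aut_E[OF A, of "inv g z" w] Aut_inv_right[OF A] g z by simp
        ultimately show "z \<in> g ` {z \<in> ?A. E z w}" using Aut_inv_right[OF A, of z] by (metis (mono_tags, lifting) imageI mem_Collect_eq)
      qed
    qed
    moreover have "inj_on g {z \<in> ?A. E z w}" using Aut_inj[OF A] by (auto simp: inj_on_def)
    ultimately show ?thesis by (simp add: card_image)
  qed
  define kk where "kk = card {y \<in> ?T. E x y}"
  have "(\<Sum>z\<in>?A. card {y \<in> ?T. E z y}) = card {z \<in> ?A. E z w} * card ?T"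
  proof (rule sum_multicount)
    show "\<forall>y\<in>?T. card {z \<in> ?A. E z y} = card {z \<in> ?A. E z w}" using e by blast
  qed simp_all
  moreover have "(\<Sum>z\<in>?A. card {y \<in> ?T. E z y}) = (\<Sum>z\<in>?A. kk)"
  proof (rule sum.cong)
    show "card {y \<in> ?T. E z y} = kk" if "z \<in> ?A" for z using k[OF that x] kk_def by simp
  qed simp
  ultimately have eq: "card ?A * kk = card {z \<in> ?A. E z w} * 3" using w by simp
  have "w \<in> {y \<in> ?T. E v y}" using E by simp
  then have "{y \<in> ?T. E v y} \<noteq> {}" by blast
  moreover have "finite {y \<in> ?T. E v y}" by simp
  ultimately have "card {y \<in> ?T. E v y} > 0" unfolding card_gt_0_iff by blast
  then have kpos: "kk > 0" using k[OF x orb_self] kk_def by simp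
  have kle: "kk \<le> 3" unfolding kk_def using card_mono[of ?T "{y \<in> ?T. E x y}"] w by auto
  have "card ?A = 1 \<or> card ?A = 2" using card_orb_pos[of c n v] v by linarith
  moreover have "kk = 3" if "a * kk = b * 3" "a = 1 \<or> a = 2" for a b :: nat
  proof -
    have "kk = b * 3 \<or> 2 * kk = b * 3" using that by auto
    then show ?thesis using kpos kle by presburger
  qed
  ultimately have "kk = 3" using eq by blast
  then have "{y \<in> ?T. E x y} = ?T"
    using w kk_def by (intro card_subset_eq) auto
  moreover have "w \<in> ?T" by (rule orb_self)
  ultimately show ?thesis by blast
qed

text \<open>Truncate at \<open>W\<close>, which omits from the ball of radius n only the orbits of
  size three on level n. An edge leaving \<open>W\<close> ends in such a triple, either from the
  same level, where adjacency to the triple is complete, or from a parent, and parents are common to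
  the triple; or it ends on level n + 1, where by \<open>G2\<close> its other end is fixed or the
  whole orbit of that end consists of parents.\<close>

lemma Gam_fixes:
  assumes G: "G1 c n" "G2 c n" and g: "g \<in> Gam c (Suc n)"
    and v: "d r v < n \<or> d r v = n \<and> card (orb c n v) \<le> 2"
  shows "g v = v"
proof -
  define W where "W = {v. d r v < n \<or> d r v = n \<and> card (orb c n v) \<le> 2}"
  have WI: "h x \<in> W" if "h \<in> Gam c (Suc n)" "x \<in> W" for h x
  proof -
    have h: "h \<in> Gam c n" using that Gam_Suc by blast
    have "orb c n (h x) = orb c n x" using orb_eq[OF orb_I[OF h]] .
    then show ?thesis using that(2) Gam_level[OF h, of x] by (simp add: W_def)
  qed
  have step: "E (h x) w" if h: "h \<in> Gam c (Suc n)" and x: "x \<in> W" and w: "w \<notin> W" and E: "E x w" for h x w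
  proof -
    have h': "h \<in> Gam c n" using h Gam_Suc by blast
    have xn: "d r x \<le> n" using x by (auto simp: W_def)
    consider "d r w = n" "card (orb c n w) > 2" | "d r w > n" using w unfolding W_def by (auto simp: not_le) linarith
    then show ?thesis
    proof cases
      case 1
      then have c3: "card (orb c n w) = 3" using G(1) unfolding G1_def by (metis le_antisym Suc_leI numeral_2_eq_2 numeral_3_eq_3)
      consider "d r x = n" | "x \<in> par w" using edge_levels[OF E] 1 xn by (auto dest: par_level)
      then show ?thesis
      proof cases
        assume "d r x = n"
        then have "card (orb c n x) \<le> 2" using x by (auto simp: W_def)
        then show ?thesis using pair_triple_adj[OF _ c3 E orb_I[OF h']] by blast
      next
        assume "x \<in> par w"
        then have "h x \<in> par (h w)" using par_mem[OF h'] by simp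
        moreover have "par (h w) = par w" using G(1) 1 c3 orb_I[OF h'] unfolding G1_def by blast
        ultimately show ?thesis using par_E by simp
      qed
    next
      case 2
      then have xw: "x \<in> par w" using edge_levels[OF E] xn by (auto dest: par_level)
      then have lev: "d r x = n" "d r w = Suc n" using par_level[OF xw] 2 xn by auto
      then have le2: "card (orb c n x) \<le> 2" using x by (auto simp: W_def)
      show ?thesis
      proof (cases "orb c n x \<subseteq> par w")
        case True
        then show ?thesis using orb_I[OF h'] par_E by blast
      next
        case False
        have "card (orb c n x) \<noteq> 1"
        proof
          assume "card (orb c n x) = 1"
          then obtain z where "orb c n x = {z}" by (rule card_1_singletonE)
          then have "orb c n x = {x}" using orb_self[of x c n] by simp
          then show False using False xw by simp
        qed
        then have "card (orb c n x) = 2" using le2 card_orb_pos[of c n x] by linarith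
        then have "h x = x" using G(2) lev xw False h unfolding G2_def by blast
        then show ?thesis using E by simp
      qed
    qed
  qed
  have A: "g \<in> Aut" using Gam_Aut[OF g] .
  show ?thesis
  proof (rule patch[OF A])
    show "finite W" by (rule finite_subset[OF _ finite_ball[of r n]]) (auto simp: W_def)
    show "g ` W = W"
    proof
      show "g ` W \<subseteq> W" using WI[OF g] by blast
      show "W \<subseteq> g ` W"
      proof
        fix x assume "x \<in> W"
        then have "inv g x \<in> W" using WI[OF Gam_inv[OF g]] by blast
        then show "x \<in> g ` W" using Aut_inv_right[OF A, of x] by (metis imageI)
      qed
    qed
    show "v \<in> W" using v by (simp add: W_def)
    fix x w assume x: "x \<in> W" and w: "w \<notin> W"
    show "E x w \<longleftrightarrow> E (g x) w"
    proof
      assume "E (g x) w"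
      then show "E x w" using step[OF Gam_inv[OF g] WI[OF g x] w] Aut_inv_left[OF A, of x] by simp
    qed (rule step[OF g x w])
  qed
qed

text \<open>Two levels are lost: \<open>Gam_fixes\<close> consumes the colours of one further level,
  and orbits of size three may survive on level m - 1.\<close>

lemma good_fixes:
  assumes "good c" "g \<in> Gam c m" "d r v + 2 \<le> m" shows "g v = v"
proof -
  obtain n where n: "m = Suc n" using assms(3) by (cases m) auto
  then show ?thesis using Gam_fixes[of c n g v] assms unfolding good_def by auto
qed


section \<open>Colouring level by level\<close>

lemma orb_cong: "(\<And>v. d r v \<le> n \<Longrightarrow> c v = c' v) \<Longrightarrow> orb c n = orb c' n"
  unfolding orb_def using Gam_cong[of n c c'] by auto

lemma Lab_cong: "(\<And>v. d r v \<le> n \<Longrightarrow> c v = c' v) \<Longrightarrow> Lab c n = Lab c' n"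
  unfolding Lab_def relevant_def using orb_cong[of n c c'] by simp

lemma G1_cong: "(\<And>v. d r v \<le> n \<Longrightarrow> c v = c' v) \<Longrightarrow> G1 c n = G1 c' n"
  unfolding G1_def using orb_cong[of n c c'] by simp

lemma G2_cong:
  assumes "\<And>v. d r v \<le> Suc n \<Longrightarrow> c v = c' v" shows "G2 c n = G2 c' n"
proof -
  have "orb c n = orb c' n" "Gam c (Suc n) = Gam c' (Suc n)"
    using orb_cong[of n c c'] Gam_cong[of "Suc n" c c'] assms by auto
  then show ?thesis unfolding G2_def by simp
qed

lemma strong_cong:
  assumes "\<And>v. d r v \<le> Suc n \<Longrightarrow> c v = c' v" shows "strong c n = strong c' n"
proof -
  have "orb c n = orb c' n" "Lab c n = Lab c' n" "Gam c n = Gam c' n"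
    using orb_cong[of n c c'] Lab_cong[of n c c'] Gam_cong[of n c c'] assms by auto
  moreover from this have "black c n u = black c' n u" if "d r u = Suc n" for u
    using assms orb_level[of _ c n u] that unfolding black_def by auto
  ultimately show ?thesis unfolding strong_def by simp
qed

lemma orb_Lab_eq: "orb c n v = orb c n u \<Longrightarrow> Lab c n v = Lab c n u"
  unfolding Lab_def relevant_def by simp

lemma strong_step:
  assumes "G1 c n"
  shows "\<exists>c'. (\<forall>v. d r v \<le> n \<longrightarrow> c' v = c v) \<and> strong c' n"
proof -
  \<comment> \<open>The choice depends on \<open>u\<close> only through its orbit and its labels, so
    all points of an orbit choose the same set.\<close>
  define T where "T u = (SOME t. labelled_action.fine (Gam c n) (orb c n u) (Lab c n u) t)" for u
  have T: "labelled_action.fine (Gam c n) (orb c n u) (Lab c n u) (T u)" if "d r u = Suc n" for u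
    unfolding T_def using labelled_action.exists_fine[OF orbit_action[OF assms that]] by (rule someI_ex)
  define c' where "c' v = (if d r v = Suc n then v \<in> T v else c v)" for v
  have agree: "c' v = c v" if "d r v \<le> n" for v using that by (simp add: c'_def)
  have eqs: "orb c' n = orb c n" "Lab c' n = Lab c n" "Gam c' n = Gam c n"
    using orb_cong[of n c' c] Lab_cong[of n c' c] Gam_cong[of n c' c] agree by auto
  have "black c' n u = T u" if u: "d r u = Suc n" for u
  proof -
    have "c' v \<longleftrightarrow> v \<in> T u" if v: "v \<in> orb c n u" for v
    proof -
      have "T v = T u" using orb_eq[OF v] orb_Lab_eq[OF orb_eq[OF v]] by (simp add: T_def)
      then show ?thesis using orb_level[OF v] u by (simp add: c'_def)
    qed
    then have "black c' n u = {v \<in> orb c n u. v \<in> T u}"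
      unfolding black_def eqs by blast
    also have "\<dots> = T u"
    proof -
      interpret A: labelled_action "Gam c n" "orb c n u" "Lab c n u" using orbit_action[OF assms u] .
      show ?thesis using T[OF u] unfolding A.fine_def by auto
    qed
    finally show ?thesis .
  qed
  then have "strong c' n" unfolding strong_def eqs using T by simp
  then show ?thesis using agree by blast
qed

text \<open>\<open>G1 c m\<close> depends on the colours up to level m, \<open>G2 c m\<close> on
  those up to level m + 1; hence the different ranges in the assumptions.\<close>

lemma extend:
  assumes G: "\<And>m. m \<le> N \<Longrightarrow> G1 c m" "\<And>m. m < N \<Longrightarrow> G2 c m"
  shows "\<exists>c'. (\<forall>v. d r v \<le> N \<longrightarrow> c' v = c v) \<and> (\<forall>n\<ge>N. strong c' n) \<and> good c'"
proof -
  define nxt where "nxt k f = (SOME f'. (\<forall>v. d r v \<le> N + k \<longrightarrow> f' v = f v) \<and> strong f' (N + k))" for k f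
  define F where "F = rec_nat c nxt"
  have F0: "F 0 = c" and FS: "F (Suc k) = nxt k (F k)" for k by (simp_all add: F_def)
  have nxt: "(\<forall>v. d r v \<le> N + k \<longrightarrow> nxt k f v = f v) \<and> strong (nxt k f) (N + k)" if "G1 f (N + k)" for k f
    unfolding nxt_def by (rule someI_ex[OF strong_step[OF that]])
  have G1F: "G1 (F k) (N + k)" for k
  proof (induction k)
    case 0 then show ?case using G F0 by simp
  next
    case (Suc k)
    have "G1 (F (Suc k)) (N + k)" using Suc G1_cong[of "N + k" "F (Suc k)" "F k"] nxt[OF Suc] FS by simp
    then show ?case using strong_G1[of "F (Suc k)" "N + k"] nxt[OF Suc] FS by simp
  qed
  have agree1: "F (Suc k) v = F k v" if "d r v \<le> N + k" for k v using nxt[OF G1F] FS that by simp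
  have agree: "F (k + j) v = F k v" if "d r v \<le> N + k" for k j v
    using that by (induction j) (auto simp: agree1)
  \<comment> \<open>Stage k settles the levels up to N + k; truncated subtraction assigns stage 0 to
    all levels up to N.\<close>
  define c' where "c' v = F (d r v - N) v" for v
  have c'F: "c' v = F k v" if "d r v \<le> N + k" for k v
    using agree[of v "d r v - N" "k - (d r v - N)"] that by (simp add: c'_def)
  have a0: "c' v = c v" if "d r v \<le> N" for v using c'F[of v 0] that F0 by simp
  have st: "strong c' n" if nN: "n \<ge> N" for n
  proof -
    obtain k where k: "n = N + k" using le_Suc_ex[OF nN] by blast
    have "strong (F (Suc k)) n" using nxt[OF G1F[of k]] FS k by simp
    then show ?thesis using strong_cong[of n c' "F (Suc k)"] c'F[of _ "Suc k"] k by simp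
  qed
  have g1: "G1 c' n" for n
  proof (cases "n \<le> N")
    case True
    then show ?thesis using G1_cong[of n c' c] a0 G(1) by simp
  next
    case False
    then obtain k where k: "n = N + k" using le_Suc_ex[of N n] by auto
    then show ?thesis using G1F[of k] G1_cong[of n c' "F k"] c'F[of _ k] by simp
  qed
  have "G2 c' n" for n
  proof (cases "n < N")
    case True
    then show ?thesis using G2_cong[of n c' c] a0 G(2) by simp
  next
    case False
    then show ?thesis using strong_G2[OF g1] st by simp
  qed
  then show ?thesis using a0 st g1 unfolding good_def by blast
qed

lemma G1_0: "G1 c 0"
proof -
  have "orb c 0 r \<subseteq> {r}" unfolding orb_def using Gam_r[of _ c 0] by auto
  then have "orb c 0 r = {r}" using orb_self[of r c 0] by blast
  then show ?thesis unfolding G1_def by simp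
qed

text \<open>Every orbit of a strong level is of one of three types. Exchanging its colours is detected by counting black
  vertices if it is unbalanced; the other two types are treated by recolouring and by descent, respectively.\<close>
definition unbalanced :: "('a \<Rightarrow> bool) \<Rightarrow> nat \<Rightarrow> 'a \<Rightarrow> bool" where
  "unbalanced c n u \<longleftrightarrow> 2 * card (black c n u) \<noteq> card (orb c n u)"

text \<open>Only the colours of this orbit are assumed to be preserved, not those of its level. So
  the condition can still be used after another orbit has been recoloured.\<close>

definition pinned :: "('a \<Rightarrow> bool) \<Rightarrow> nat \<Rightarrow> 'a \<Rightarrow> bool" where
  "pinned c n u \<longleftrightarrow>
     (\<forall>g\<in>Gam c n. (\<forall>x\<in>orb c n u. c (g x) = c x) \<longrightarrow> (\<forall>x\<in>orb c n u. g x = x)) \<and>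
     (\<forall>x\<in>orb c n u. \<forall>y\<in>orb c n u. par x = par y \<longrightarrow> x = y)"

definition triple_orb :: "('a \<Rightarrow> bool) \<Rightarrow> nat \<Rightarrow> 'a \<Rightarrow> bool" where
  "triple_orb c n u \<longleftrightarrow> (\<exists>x\<in>orb c n u. \<forall>g\<in>Gam c (Suc n). g x = x) \<and>
     (\<exists>a. card (orb c n a) = 3 \<and> d r a = n \<and> orb c n u = (\<Union>x\<in>orb c n a. kids x) \<and>
       (\<forall>x\<in>orb c n a. card (kids x) = 4) \<and> (\<forall>w\<in>orb c n u. card (par w \<inter> orb c n a) = 1))"

definition isolated :: "('a \<Rightarrow> bool) \<Rightarrow> nat \<Rightarrow> 'a \<Rightarrow> bool" where
  "isolated c n u \<longleftrightarrow> card {y \<in> orb c n u. (\<exists>g\<in>Gam c (Suc n). g y \<noteq> y) \<and> c y = c u \<and>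
     card {z \<in> orb c n u. par z = par y \<and> c z} = card {z \<in> orb c n u. par z = par u \<and> c z}} \<le> 3"

text \<open>A translation of \<open>fine\<close> into the graph. The work lies in the exceptional
  case, where three blocks of four points must be shown to come from a three-point orbit with all
  its children.\<close>

lemma strong_orbits:
  assumes G1: "G1 c n" and st: "strong c n" and u: "d r u = Suc n"
  shows "isolated c n u" "unbalanced c n u \<or> pinned c n u \<or> triple_orb c n u"
proof -
  interpret A: labelled_action "Gam c n" "orb c n u" "Lab c n u" using orbit_action[OF G1 u] .
  let ?t = "black c n u"
  have fine: "A.fine ?t" using st u unfolding strong_def by simp
  have sub: "Gam c (Suc n) \<subseteq> A.Stab ?t" using Gam_Suc_Stab[OF G1 u] .
  have cl: "card (A.cls (Lab c n u) y \<inter> ?t) = card {z \<in> orb c n u. par z = par y \<and> c z}" if "y \<in> orb c n u" for y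
    unfolding orbit_cls[OF G1 u that] black_def by (rule arg_cong[of _ _ card]) auto
  have "{y \<in> orb c n u. (\<exists>g\<in>Gam c (Suc n). g y \<noteq> y) \<and> c y = c u \<and>
     card {z \<in> orb c n u. par z = par y \<and> c z} = card {z \<in> orb c n u. par z = par u \<and> c z}}
    \<subseteq> {v \<in> A.movable ?t. (v \<in> ?t \<longleftrightarrow> u \<in> ?t) \<and> card (A.cls (Lab c n u) v \<inter> ?t) = card (A.cls (Lab c n u) u \<inter> ?t)}"
    using sub cl orb_self[of u c n] unfolding A.movable_def black_def[of c n u] by auto
  moreover have "finite (A.movable ?t)" unfolding A.movable_def by simp
  ultimately have "card {y \<in> orb c n u. (\<exists>g\<in>Gam c (Suc n). g y \<noteq> y) \<and> c y = c u \<and>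
     card {z \<in> orb c n u. par z = par y \<and> c z} = card {z \<in> orb c n u. par z = par u \<and> c z}}
    \<le> card {v \<in> A.movable ?t. (v \<in> ?t \<longleftrightarrow> u \<in> ?t) \<and> card (A.cls (Lab c n u) v \<inter> ?t) = card (A.cls (Lab c n u) u \<inter> ?t)}"
    by (intro card_mono) auto
  moreover have "A.isolating ?t" using fine unfolding A.fine_def by simp
  ultimately show "isolated c n u" unfolding isolated_def A.isolating_def using orb_self[of u c n] by (meson le_trans)
  have "unbalanced c n u \<or> A.rigid ?t \<or> A.full_triple ?t"
    using fine unfolding A.fine_def unbalanced_def by simp
  moreover have "pinned c n u" if "A.rigid ?t"
  proof -
    have r1: "g x = x" if "g \<in> A.Stab ?t" "x \<in> orb c n u" for g x
      using \<open>A.rigid ?t\<close> that unfolding A.rigid_def by simp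
    have r2: "A.cls (Lab c n u) x = {x}" if "x \<in> orb c n u" for x
      using \<open>A.rigid ?t\<close> that unfolding A.rigid_def by simp
    have "g \<in> A.Stab ?t" if "g \<in> Gam c n" "\<forall>x\<in>orb c n u. c (g x) = c x" for g
      using that orb_closed[OF that(1)] unfolding A.Stab_def black_def by auto
    moreover have "x = y" if xy: "x \<in> orb c n u" "y \<in> orb c n u" "par x = par y" for x y
      using r2[OF xy(2)] orbit_cls[OF G1 u xy(2)] xy by auto
    ultimately show ?thesis unfolding pinned_def using r1 by blast
  qed
  moreover have "triple_orb c n u" if ft: "A.full_triple ?t"
  proof -
    obtain x where x: "x \<in> orb c n u" "\<And>g. g \<in> A.Stab ?t \<Longrightarrow> g x = x"
      using ft unfolding A.full_triple_def by auto
    obtain l where l: "l \<in> Lab c n u" "card (l ` orb c n u) = 3"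
        "\<And>v. v \<in> orb c n u \<Longrightarrow> card {w \<in> orb c n u. l w = l v} = 4"
      using ft unfolding A.full_triple_def by auto
    obtain a where a: "l = (\<lambda>w. par w \<inter> orb c n a)" "relevant c n u a" using l(1) unfolding Lab_def by auto
    have cU: "card (orb c n u) = 12"
      using A.block_card_eq(1)[OF l(1) orb_self] l(2) l(3)[OF orb_self] by (simp add: A.block_eq)
    have da: "d r a = n" using relevant_level[OF a(2)] u by simp
    have cQ: "card (orb c n a) \<le> 3" using G1 da unfolding G1_def by blast
    define j where "j = card (par u \<inter> orb c n a)"
    have j: "j > 0" using label_proper(1)[OF a(2) orb_self] j_def by simp
    let ?K = "\<lambda>b. {w \<in> orb c n u. b \<in> par w}"
    have Kk: "?K b \<subseteq> kids b" for b by (auto simp: kids_def)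
    have k4: "card (kids b) \<le> 4" if "b \<in> orb c n a" for b
      using card_kids4[of b] orb_level[OF that] relevant_not_root[OF a(2)] by (metis d_eq_0)
    have K4: "card (?K b) \<le> 4" if "b \<in> orb c n a" for b
      using card_mono[OF finite_kids Kk, of b] k4[OF that] by linarith
    \<comment> \<open>Double counting of the parent relation gives 12j, while at most three vertices
      with at most four children each give at most 12. Hence j = 1 and equality holds
      throughout.\<close>
    have "(\<Sum>b\<in>orb c n a. card (?K b)) = (\<Sum>w\<in>orb c n u. j)"
    proof (rule sum_multicount_gen)
      show "\<forall>w\<in>orb c n u. card {b \<in> orb c n a. b \<in> par w} = j"
      proof
        fix w assume w: "w \<in> orb c n u"
        have "{b \<in> orb c n a. b \<in> par w} = par w \<inter> orb c n a" by blast
        then show "card {b \<in> orb c n a. b \<in> par w} = j"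
          unfolding j_def using label_card[OF w orb_self, of a] by simp
      qed
    qed simp_all
    then have sum12: "(\<Sum>b\<in>orb c n a. card (?K b)) = 12 * j" using cU by simp
    moreover have "(\<Sum>b\<in>orb c n a. card (?K b)) \<le> (\<Sum>b\<in>orb c n a. 4)" by (rule sum_mono[OF K4])
    ultimately have c3: "card (orb c n a) = 3" "j = 1" using j cQ by auto
    have all4: "card (?K b) = 4" if b: "b \<in> orb c n a" for b
    proof (rule ccontr)
      assume "card (?K b) \<noteq> 4"
      then have "card (?K b) < 4" using K4[OF b] by simp
      then have "(\<Sum>b\<in>orb c n a. card (?K b)) < (\<Sum>b\<in>orb c n a. 4)"
        using K4 b by (intro sum_strict_mono_ex1) auto
      then show False using sum12 c3 by simp
    qed
    have Keq: "?K b = kids b" if b: "b \<in> orb c n a" for b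
    proof (rule card_seteq[OF finite_kids Kk])
      show "card (kids b) \<le> card (?K b)" using all4[OF b] k4[OF b] by simp
    qed
    have "orb c n u = (\<Union>b\<in>orb c n a. kids b)"
    proof
      show "orb c n u \<subseteq> (\<Union>b\<in>orb c n a. kids b)"
      proof
        fix w assume w: "w \<in> orb c n u"
        have "par w \<inter> orb c n a \<noteq> {}" using label_proper(1)[OF a(2) w] by auto
        then show "w \<in> (\<Union>b\<in>orb c n a. kids b)" by (auto simp: kids_def)
      qed
      show "(\<Union>b\<in>orb c n a. kids b) \<subseteq> orb c n u" using Keq by blast
    qed
    moreover have "card (kids b) = 4" if "b \<in> orb c n a" for b using Keq[OF that] all4[OF that] by simp
    moreover have "card (par w \<inter> orb c n a) = 1" if "w \<in> orb c n u" for w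
      using label_card[OF that orb_self, of a] j_def c3 by simp
    ultimately show ?thesis unfolding triple_orb_def using c3 da x sub by blast
  qed
  ultimately show "unbalanced c n u \<or> pinned c n u \<or> triple_orb c n u" by blast
qed


text \<open>\<open>G1\<close> and \<open>G2\<close> see the colouring only through the groups, so a
  recolouring that leaves the groups alone stays good. This is the freedom exploited against
  automorphisms that move the root.\<close>

lemma good_of_Gam:
  assumes "\<And>m. Gam c' m = Gam c m" "good c" shows "good c'"
proof -
  have o: "orb c' m = orb c m" for m unfolding orb_def using assms(1) by simp
  have "G1 c' n = G1 c n" "G2 c' n = G2 c n" for n
    unfolding G1_def G2_def o assms(1) by (rule refl)+
  then show ?thesis using assms(2) unfolding good_def by simp
qed

text \<open>Changing one level can affect the groups only in the step to that level, and there old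
  and new colours are assumed to have the same stabiliser in \<open>Gam c n\<close>.\<close>

lemma Gam_modify:
  assumes lev: "\<And>v. c' v \<noteq> c v \<Longrightarrow> d r v = Suc n"
    and step: "\<And>g. g \<in> Gam c n \<Longrightarrow>
      (\<forall>v. d r v = Suc n \<longrightarrow> c' (g v) = c' v) \<longleftrightarrow> (\<forall>v. d r v = Suc n \<longrightarrow> c (g v) = c v)"
  shows "Gam c' m = Gam c m"
proof (induction m)
  case 0
  show ?case by (rule Gam_cong) (use lev in force)
next
  case (Suc m)
  show ?case
  proof (cases "m = n")
    case True
    show ?thesis
    proof (rule set_eqI)
      fix g
      show "g \<in> Gam c' (Suc m) \<longleftrightarrow> g \<in> Gam c (Suc m)"
        unfolding Gam_Suc Suc.IH unfolding True using step[of g] by auto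
    qed
  next
    case False
    have "(\<forall>v. d r v = Suc m \<longrightarrow> c' (g v) = c' v) \<longleftrightarrow> (\<forall>v. d r v = Suc m \<longrightarrow> c (g v) = c v)"
      if g: "g \<in> Gam c m" for g
    proof -
      have "c' (g v) = c (g v) \<and> c' v = c v" if "d r v = Suc m" for v
        using lev[of v] lev[of "g v"] Gam_level[OF g, of v] that False by auto
      then show ?thesis by auto
    qed
    note eq = this
    show ?thesis
    proof (rule set_eqI)
      fix g
      show "g \<in> Gam c' (Suc m) \<longleftrightarrow> g \<in> Gam c (Suc m)"
        unfolding Gam_Suc Suc.IH using eq[of g] by auto
    qed
  qed
qed

section \<open>Recolouring orbits, counting black vertices, and chains of exceptional orbits\<close>

definition flip :: "'a set \<Rightarrow> ('a \<Rightarrow> bool) \<Rightarrow> 'a \<Rightarrow> bool" where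
  "flip U c v = (if v \<in> U then \<not> c v else c v)"

text \<open>The orbit is invariant under \<open>Gam c n\<close>, so a vertex and its image are
  flipped together.\<close>

lemma Gam_flip:
  assumes u: "d r u = Suc n" shows "Gam (flip (orb c n u) c) m = Gam c m"
proof (rule Gam_modify)
  show "d r v = Suc n" if "flip (orb c n u) c v \<noteq> c v" for v
    using that orb_level[of v c n u] u by (auto simp: flip_def split: if_splits)
  fix g assume g: "g \<in> Gam c n"
  have "g v \<in> orb c n u \<longleftrightarrow> v \<in> orb c n u" for v
    using orb_closed[OF g] orb_closed[OF Gam_inv[OF g], of "g v"] Aut_inv_left[OF Gam_Aut[OF g]] by metis
  then show "(\<forall>v. d r v = Suc n \<longrightarrow> flip (orb c n u) c (g v) = flip (orb c n u) c v) \<longleftrightarrow>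
      (\<forall>v. d r v = Suc n \<longrightarrow> c (g v) = c v)"
    by (simp add: flip_def)
qed

lemma card_flip:
  assumes "finite U" shows "card {v \<in> U. flip U c v} + card {v \<in> U. c v} = card U"
proof -
  have "{v \<in> U. flip U c v} \<union> {v \<in> U. c v} = U" "{v \<in> U. flip U c v} \<inter> {v \<in> U. c v} = {}"
    by (auto simp: flip_def)
  then show ?thesis using card_Un_disjoint[of "{v \<in> U. flip U c v}" "{v \<in> U. c v}"] assms by simp
qed

lemma ball_count:
  assumes g: "g \<in> Aut" and "\<And>v. c (g v) = c v"
  shows "card {v. d (g x) v \<le> k \<and> c v} = card {v. d x v \<le> k \<and> c v}"
proof -
  have "{v. d (g x) v \<le> k \<and> c v} = g ` {v. d x v \<le> k \<and> c v}"
  proof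
    show "g ` {v. d x v \<le> k \<and> c v} \<subseteq> {v. d (g x) v \<le> k \<and> c v}" using Aut_d[OF g] assms by auto
    show "{v. d (g x) v \<le> k \<and> c v} \<subseteq> g ` {v. d x v \<le> k \<and> c v}"
    proof
      fix v assume v: "v \<in> {v. d (g x) v \<le> k \<and> c v}"
      have "d x (inv g v) \<le> k \<and> c (inv g v)"
        using v Aut_d[OF g, of x "inv g v"] assms(2)[of "inv g v"] Aut_inv_right[OF g, of v] by simp
      then show "v \<in> g ` {v. d x v \<le> k \<and> c v}"
        using Aut_inv_right[OF g, of v] by (intro image_eqI[of _ _ "inv g v"]) auto
    qed
  qed
  moreover have "inj_on g {v. d x v \<le> k \<and> c v}" using Aut_inj[OF g] by (auto simp: inj_on_def)
  ultimately show ?thesis by (simp add: card_image)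
qed

text \<open>The exceptional orbit seen from a parent \<open>b\<close> of \<open>v\<close>. Singling
  out \<open>b\<close> lets a property of \<open>v\<close> be handed to \<open>b\<close>, and so on
  towards the root.\<close>

definition cover :: "('a \<Rightarrow> bool) \<Rightarrow> nat \<Rightarrow> 'a \<Rightarrow> 'a \<Rightarrow> bool" where
  "cover c k v b \<longleftrightarrow> d r b = k \<and> card (orb c k b) = 3 \<and> orb c k v = (\<Union>x\<in>orb c k b. kids x) \<and>
     (\<forall>x\<in>orb c k b. card (kids x) = 4) \<and> b \<in> par v \<and> (\<exists>x\<in>orb c k v. \<forall>g\<in>Gam c (Suc k). g x = x)"

lemma triple_orb_cover:
  assumes "triple_orb c k v" shows "\<exists>b. cover c k v b"
proof -
  obtain a where a: "card (orb c k a) = 3" "d r a = k" "orb c k v = (\<Union>x\<in>orb c k a. kids x)"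
      "\<forall>x\<in>orb c k a. card (kids x) = 4" and x: "\<exists>x\<in>orb c k v. \<forall>g\<in>Gam c (Suc k). g x = x"
    using assms unfolding triple_orb_def by blast
  have "v \<in> (\<Union>x\<in>orb c k a. kids x)" using a(3) orb_self by blast
  then obtain b where b: "b \<in> orb c k a" "v \<in> kids b" by blast
  have "orb c k b = orb c k a" using orb_eq[OF b(1)] .
  then have "cover c k v b" unfolding cover_def using a x b orb_level[OF b(1)] by (simp add: kids_def)
  then show ?thesis by blast
qed

text \<open>The whole orbit hangs below \<open>x\<close>. A pinned orbit with one parent set is a
  single point, hence unbalanced, and an exceptional orbit would need three different
  parents.\<close>

lemma single_par_unbalanced:
  assumes G1: "G1 c n" and st: "strong c n" and w: "d r w = Suc n" and x: "par w = {x}"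
    and fx: "\<And>g. g \<in> Gam c n \<Longrightarrow> g x = x"
  shows "unbalanced c n w" "\<And>v. v \<in> orb c n w \<Longrightarrow> par v = {x}"
proof -
  show P: "par v = {x}" if v: "v \<in> orb c n w" for v
  proof -
    obtain g where g: "g \<in> Gam c n" "v = g w" using v unfolding orb_def by auto
    then show ?thesis using par_image[OF g(1), of w] x fx[OF g(1)] by simp
  qed
  have "\<not> triple_orb c n w"
  proof
    assume "triple_orb c n w"
    then obtain b where b: "cover c n w b" using triple_orb_cover by blast
    have "y = x" if y: "y \<in> orb c n b" for y
    proof -
      have "card (kids y) = 4" using b y unfolding cover_def by blast
      then obtain v where v: "v \<in> kids y" by (metis card.empty equals0I zero_neq_numeral)
      then have "v \<in> orb c n w" using b y unfolding cover_def by blast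
      then show ?thesis using P[of v] v by (simp add: kids_def)
    qed
    then have "orb c n b \<subseteq> {x}" by blast
    then have "card (orb c n b) \<le> 1" using card_mono[of "{x}"] by fastforce
    then show False using b unfolding cover_def by simp
  qed
  moreover have "unbalanced c n w" if "pinned c n w"
  proof -
    have "y = w" if "y \<in> orb c n w" for y
      using \<open>pinned c n w\<close> that P[OF that] P[OF orb_self] orb_self[of w c n] unfolding pinned_def by auto
    then have "orb c n w = {w}" using orb_self[of w c n] by auto
    then show ?thesis unfolding unbalanced_def by simp
  qed
  ultimately show "unbalanced c n w" using strong_orbits(2)[OF G1 st w] by blast
qed

text \<open>A descending chain of three full triples produces a vertex whose only parent is fixed.\<close>
lemma triple_chain:
  assumes gd: "\<And>n. G1 c n" and st: "\<And>n. n \<ge> K \<Longrightarrow> strong c n"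
    and step: "\<And>v k. bad v \<Longrightarrow> d r v = Suc k \<Longrightarrow> k \<ge> K \<Longrightarrow> card (orb c (Suc k) v) \<ge> 2 \<Longrightarrow>
      \<exists>b. cover c k v b \<and> bad b"
    and a: "bad a" "d r a = Suc (Suc (Suc q))" "card (orb c (Suc (Suc (Suc q))) a) \<ge> 2" and q: "q \<ge> K"
  shows "\<exists>b1 b2 x v g. bad b1 \<and> bad b2 \<and> d r b1 = Suc q \<and> card (orb c (Suc q) b1) = 3 \<and>
    x \<in> orb c q b1 \<and> (\<forall>h\<in>Gam c (Suc q). h x = x) \<and> v \<in> orb c (Suc q) b2 \<and> g \<in> Gam c q \<and>
    par (g v) = {x} \<and> d r (g v) = Suc (Suc q) \<and> unbalanced c (Suc q) (g v)"
proof -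
  obtain b2 where b2: "cover c (Suc (Suc q)) a b2" "bad b2" using step[OF a(1,2) _ a(3)] q by auto
  have l2: "d r b2 = Suc (Suc q)" "card (orb c (Suc (Suc q)) b2) = 3" "card (kids b2) = 4"
    using b2(1) orb_self unfolding cover_def by auto
  obtain b1 where b1: "cover c (Suc q) b2 b1" "bad b1" using step[OF b2(2) l2(1)] l2(2) q by auto
  have l1: "d r b1 = Suc q" "card (orb c (Suc q) b1) = 3" "card (kids b1) = 4"
      "kids b1 \<subseteq> orb c (Suc q) b2"
    using b1(1) orb_self[of b1 c "Suc q"] unfolding cover_def by auto
  obtain b0 where b0: "cover c q b1 b0" using step[OF b1(2) l1(1)] l1(2) q by auto
  obtain x where x: "x \<in> orb c q b1" "\<forall>h\<in>Gam c (Suc q). h x = x" using b0 unfolding cover_def by blast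
  obtain v where v: "v \<in> kids b1" using l1(3) by (metis card.empty equals0I zero_neq_numeral)
  have vo: "v \<in> orb c (Suc q) b2" using v l1(4) by blast
  have "b2 \<noteq> r" using l2 by auto
  \<comment> \<open>Four children use up all but one of at most five neighbours.\<close>
  then have "card (par b2) \<le> 1" "card (par b2) > 0" using card_kids_par[of b2] card_par_pos l2(3) by auto
  then have one: "card (par b2) = 1" by linarith
  obtain h where h: "h \<in> Gam c (Suc q)" "v = h b2" using vo unfolding orb_def by auto
  have "card (par v) = card (par b2)"
    using par_image[OF h(1), of b2] h(2) Aut_inj[OF Gam_Aut[OF h(1)]]
    by (simp add: card_image inj_on_def)
  then obtain y where "par v = {y}" using one by (metis card_1_singletonE)
  then have pv: "par v = {b1}" using v by (auto simp: kids_def)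
  \<comment> \<open>The larger group \<open>Gam c q\<close> carries \<open>b1\<close> to the point
    \<open>x\<close> fixed by \<open>Gam c (Suc q)\<close>; the child \<open>v\<close> of
    \<open>b1\<close> goes to a vertex whose only parent is \<open>x\<close>.\<close>
  obtain g where g: "g \<in> Gam c q" "g b1 = x" using orb_trans[OF orb_self x(1)] by blast
  have pg: "par (g v) = {x}" using par_image[OF g(1), of v] pv g(2) by simp
  have lg: "d r (g v) = Suc (Suc q)" using Gam_level[OF g(1), of v] par_level[of b1 v] pv l1 by simp
  have "unbalanced c (Suc q) (g v)"
    by (rule single_par_unbalanced(1)[OF gd st lg pg]) (use q x in auto)
  then show ?thesis using b1(2) b2(2) l1 x vo g(1) pg lg by blast
qed

end

section \<open>Moving the root\<close>

text \<open>The margin 2 lets \<open>good_fixes\<close> apply to \<open>r'\<close>, so the groups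
  from level N on fix both roots. The hypothesis \<open>witness\<close> ranges over
  \<open>good\<close> colourings because this is the property that recolouring is known to
  keep.\<close>

locale stuck = rooted_graph +
  fixes c :: "'a \<Rightarrow> bool" and N :: nat and r' :: 'a
  assumes ne: "r' \<noteq> r" and good: "good c" and strong: "\<And>n. n \<ge> N \<Longrightarrow> strong c n"
    and N: "d r r' + 2 \<le> N"
    and witness: "\<And>c'. good c' \<Longrightarrow> (\<And>v. d r v \<le> N \<Longrightarrow> c' v = c v) \<Longrightarrow>
      \<exists>g\<in>Aut. g r = r' \<and> (\<forall>v. c' (g v) = c' v)"
begin

lemma G1: "G1 c n" and G2: "G2 c n"
  using good unfolding good_def by auto

lemma Gam_r': "g \<in> Gam c n \<Longrightarrow> n \<ge> N \<Longrightarrow> g r' = r'"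
  using good_fixes[OF good, of g n r'] N by simp

lemma Gam_d': "g \<in> Gam c n \<Longrightarrow> n \<ge> N \<Longrightarrow> d r' (g v) = d r' v"
  using Aut_d[OF Gam_Aut, of g c n r' v] Gam_r'[of g n] by simp

text \<open>If \<open>u\<close> lies outside the ball around \<open>r'\<close>, so does its whole
  orbit, because the group fixes \<open>r'\<close>. Flipping the orbit then changes the number of
  black vertices in the ball around \<open>r\<close> but not around \<open>r'\<close>, although the
  two numbers agree before and after, by automorphisms taking \<open>r\<close> to
  \<open>r'\<close>.\<close>

lemma unbalanced_near:
  assumes n: "n \<ge> N" and u: "d r u = Suc n" and F: "unbalanced c n u"
  shows "d r' u \<le> Suc n"
proof (rule ccontr)
  assume far: "\<not> d r' u \<le> Suc n"
  let ?U = "orb c n u"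
  let ?c = "flip ?U c"
  have far': "\<not> d r' v \<le> Suc n" if v: "v \<in> ?U" for v
  proof -
    obtain g where "g \<in> Gam c n" "v = g u" using v unfolding orb_def by auto
    then show ?thesis using Gam_d'[of g n u] n far by simp
  qed
  have near: "d r v = Suc n" if "v \<in> ?U" for v using orb_level[OF that] u by simp
  obtain g where g: "g \<in> Aut" "g r = r'" "\<And>v. c (g v) = c v" using witness[OF good] by auto
  have "good ?c" by (rule good_of_Gam[OF Gam_flip[OF u] good])
  moreover have "?c v = c v" if "d r v \<le> N" for v
    using near[of v] that n by (auto simp: flip_def)
  ultimately obtain h where h: "h \<in> Aut" "h r = r'" "\<And>v. ?c (h v) = ?c v" using witness by blast
  have "{v. d r' v \<le> Suc n \<and> ?c v} = {v. d r' v \<le> Suc n \<and> c v}"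
    using far' by (auto simp: flip_def)
  then have eq: "card {v. d r v \<le> Suc n \<and> ?c v} = card {v. d r v \<le> Suc n \<and> c v}"
    using ball_count[of g c r "Suc n", OF g(1,3)] ball_count[of h ?c r "Suc n", OF h(1,3)] g(2) h(2) by simp
  have split: "card {v. d r v \<le> Suc n \<and> f v} = card {v \<in> ?U. f v} + card {v. d r v \<le> Suc n \<and> v \<notin> ?U \<and> f v}" for f
  proof -
    have "{v. d r v \<le> Suc n \<and> f v} = {v \<in> ?U. f v} \<union> {v. d r v \<le> Suc n \<and> v \<notin> ?U \<and> f v}"
      using near by auto
    moreover have "finite {v. d r v \<le> Suc n \<and> v \<notin> ?U \<and> f v}"
      by (rule finite_subset[OF _ finite_ball[of r "Suc n"]]) auto
    moreover have "{v \<in> ?U. f v} \<inter> {v. d r v \<le> Suc n \<and> v \<notin> ?U \<and> f v} = {}" by auto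
    ultimately show ?thesis using card_Un_disjoint[of "{v \<in> ?U. f v}"] by simp
  qed
  have "{v. d r v \<le> Suc n \<and> v \<notin> ?U \<and> ?c v} = {v. d r v \<le> Suc n \<and> v \<notin> ?U \<and> c v}"
    by (auto simp: flip_def)
  then have "card {v \<in> ?U. ?c v} = card {v \<in> ?U. c v}" using eq split[of ?c] split[of c] by simp
  then show False using card_flip[of ?U c] F unfolding unbalanced_def black_def by simp
qed

definition far :: "'a \<Rightarrow> bool" where "far u \<longleftrightarrow> d r u < d r' u"

lemma far_par: "far u \<Longrightarrow> p \<in> par u \<Longrightarrow> far p"
  using d_edge[of p u r'] par_E[of p u] par_level[of p u] unfolding far_def by linarith

lemma far_Gam: "g \<in> Gam c n \<Longrightarrow> n \<ge> N \<Longrightarrow> far (g u) \<longleftrightarrow> far u"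
  unfolding far_def using Gam_d'[of g n u] by simp

lemma far_orb: "v \<in> orb c n u \<Longrightarrow> n \<ge> N \<Longrightarrow> far v \<longleftrightarrow> far u"
  unfolding orb_def using far_Gam by auto

lemma far_not_F: "n \<ge> N \<Longrightarrow> d r u = Suc n \<Longrightarrow> far u \<Longrightarrow> \<not> unbalanced c n u"
  using unbalanced_near[of n u] unfolding far_def by auto

text \<open>A far vertex has no unbalanced orbit, and a pinned orbit would be fixed by the next
  group. The exceptional type remains, and farness passes to parents.\<close>

lemma far_step:
  assumes "far v" "d r v = Suc k" "k \<ge> N" "card (orb c (Suc k) v) \<ge> 2"
  shows "\<exists>b. cover c k v b \<and> far b"
proof -
  have "\<not> pinned c k v"
  proof
    assume P: "pinned c k v"
    have "g v = v" if g: "g \<in> Gam c (Suc k)" for g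
    proof -
      have "g \<in> Gam c k" "\<forall>x\<in>orb c k v. c (g x) = c x"
        using g Gam_Suc assms(2) orb_level by auto
      then show ?thesis using P orb_self unfolding pinned_def by blast
    qed
    then have "card (orb c (Suc k) v) = 1" using orb_1_iff by blast
    then show False using assms(4) by simp
  qed
  then have "triple_orb c k v"
    using strong_orbits(2)[OF G1 strong assms(2)] far_not_F[OF assms(3,2,1)] assms(3) by blast
  then obtain b where b: "cover c k v b" using triple_orb_cover by blast
  then have "b \<in> par v" unfolding cover_def by simp
  then show ?thesis using b far_par[OF assms(1)] by blast
qed

text \<open>Otherwise no vertex is relevant and the orbit has one common parent set. Then a pinned
  orbit is a single point, which is unbalanced, and in an exceptional orbit each point would have
  all three parents instead of one.\<close>

lemma nontrivial_parent:
  assumes "n \<ge> N" "d r u = Suc n" "\<not> unbalanced c n u"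
  shows "\<exists>a\<in>par u. card (orb c n a) \<ge> 2"
proof -
  have "\<exists>a. relevant c n u a"
  proof (rule ccontr)
    assume nr: "\<not> ?thesis"
    then have same: "par x = par y" if "x \<in> orb c n u" "y \<in> orb c n u" for x y
      using that unfolding relevant_def by blast
    have "\<not> pinned c n u"
    proof
      assume "pinned c n u"
      then have "x = u" if "x \<in> orb c n u" for x
        using that same[OF that orb_self] orb_self[of u c n] unfolding pinned_def by blast
      then have "orb c n u = {u}" using orb_self[of u c n] by blast
      then show False using assms(3) unfolding unbalanced_def by simp
    qed
    then have "triple_orb c n u" using strong_orbits(2)[OF G1 strong assms(2)] assms by blast
    then obtain a where a: "card (orb c n a) = 3" "orb c n u = (\<Union>x\<in>orb c n a. kids x)"
        "\<forall>x\<in>orb c n a. card (kids x) = 4" "card (par u \<inter> orb c n a) = 1"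
      unfolding triple_orb_def using orb_self[of u c n] by blast
    have "orb c n a \<subseteq> par u"
    proof
      fix x assume x: "x \<in> orb c n a"
      then have "card (kids x) = 4" using a(3) by blast
      then obtain v where v: "v \<in> kids x" by (metis card.empty equals0I zero_neq_numeral)
      then have "v \<in> orb c n u" using a(2) x by blast
      then show "x \<in> par u" using same[OF _ orb_self, of v] v by (simp add: kids_def)
    qed
    then show False using a by (simp add: Int_absorb1)
  qed
  then obtain a where a: "relevant c n u a" by blast
  have "par u \<inter> orb c n a \<noteq> {}" using label_proper(1)[OF a orb_self] by auto
  then obtain b where b: "b \<in> par u" "b \<in> orb c n a" by blast
  then show ?thesis using relevant_orb_card[OF a] orb_eq[OF b(2)] by (intro bexI[of _ b]) simp_all
qed

text \<open>One step leads to a far parent in a non-trivial orbit, three further steps to a far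
  vertex in an unbalanced orbit, which cannot exist. This is the origin of the constant 4.\<close>

lemma not_far:
  assumes "d r u \<ge> N + 4" shows "\<not> far u"
proof
  assume far: "far u"
  obtain q where q: "d r u = Suc (Suc (Suc (Suc q)))" "q \<ge> N"
  proof -
    obtain k where "d r u = N + 4 + k" using assms le_Suc_ex by blast
    then show ?thesis using that[of "N + k"] by simp
  qed
  obtain a where a: "a \<in> par u" "card (orb c (Suc (Suc (Suc q))) a) \<ge> 2"
    using nontrivial_parent[OF _ q(1)] far_not_F[OF _ q(1) far] q(2) by auto
  have la: "d r a = Suc (Suc (Suc q))" using par_level[OF a(1)] q by simp
  obtain b1 b2 x v g where *: "far b2" "v \<in> orb c (Suc q) b2" "g \<in> Gam c q"
      "d r (g v) = Suc (Suc q)" "unbalanced c (Suc q) (g v)"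
    using triple_chain[of c N far, OF G1 strong far_step far_par[OF far a(1)] la a(2) q(2)] by blast
  have "far (g v)" using far_Gam[OF *(3) q(2), of v] far_orb[OF *(2)] *(1) q(2) by simp
  then show False using far_not_F[OF _ *(4)] *(5) q(2) by simp
qed

text \<open>For large n the ball around \<open>r\<close> lies in the ball around \<open>r'\<close>;
  they have equal finite size by an automorphism taking \<open>r\<close> to \<open>r'\<close>.
  Vertices below level N + 4 are caught by the triangle inequality.\<close>

lemma equal_balls: "\<exists>K. \<forall>n\<ge>K. \<forall>v. d r v \<le> n \<longleftrightarrow> d r' v \<le> n"
proof -
  let ?K = "N + 4 + d r r'"
  have "{v. d r v \<le> n} = {v. d r' v \<le> n}" if n: "n \<ge> ?K" for n
  proof (rule card_subset_eq[OF finite_ball])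
    show "{v. d r v \<le> n} \<subseteq> {v. d r' v \<le> n}"
    proof
      fix v assume v: "v \<in> {v. d r v \<le> n}"
      show "v \<in> {v. d r' v \<le> n}"
      proof (cases "d r v \<ge> N + 4")
        case True
        then show ?thesis using not_far[of v] v unfolding far_def by simp
      next
        case False
        then show ?thesis using d_triangle[of r' v r] d_sym[of r r'] n by simp
      qed
    qed
    obtain g where g: "g \<in> Aut" "g r = r'" using witness[OF good] by auto
    show "card {v. d r v \<le> n} = card {v. d r' v \<le> n}"
      using ball_count[of g "\<lambda>_. True" r n] g by simp
  qed
  then show ?thesis by blast
qed

end

locale tame = stuck +
  fixes \<gamma> :: "'a \<Rightarrow> 'a"
  assumes balls: "\<And>n v. n \<ge> N \<Longrightarrow> d r v \<le> n \<longleftrightarrow> d r' v \<le> n"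
    and \<gamma>: "\<gamma> \<in> Aut" and \<gamma>r: "\<gamma> r = r'" and \<gamma>c: "\<And>v. c (\<gamma> v) = c v"
begin

section \<open>The action of \<gamma> on balls, levels, groups and orbits\<close>

lemma ball_\<gamma>: "n \<ge> N \<Longrightarrow> d r (\<gamma> v) \<le> n \<longleftrightarrow> d r v \<le> n"
  using balls[of n "\<gamma> v"] Aut_d[OF \<gamma>, of r v] \<gamma>r by simp

lemma ball_inv: "n \<ge> N \<Longrightarrow> d r (inv \<gamma> v) \<le> n \<longleftrightarrow> d r v \<le> n"
  using ball_\<gamma>[of n "inv \<gamma> v"] Aut_inv_right[OF \<gamma>] by simp

lemma inv_c: "c (inv \<gamma> v) = c v"
  using \<gamma>c[of "inv \<gamma> v"] Aut_inv_right[OF \<gamma>] by simp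

text \<open>A level above N is the difference of two consecutive balls, both invariant under
  \<gamma>.\<close>

lemma level_\<gamma>:
  assumes "N < d r v \<or> N < d r (\<gamma> v)" shows "d r (\<gamma> v) = d r v"
proof (rule ccontr)
  assume "d r (\<gamma> v) \<noteq> d r v"
  then consider "d r (\<gamma> v) < d r v" | "d r v < d r (\<gamma> v)" by linarith
  then show False
  proof cases
    case 1
    then obtain m where m: "d r v = Suc m" by (cases "d r v") auto
    then show False using ball_\<gamma>[of m v] 1 assms by auto
  next
    case 2
    then obtain m where m: "d r (\<gamma> v) = Suc m" by (cases "d r (\<gamma> v)") auto
    then show False using ball_\<gamma>[of m v] 2 assms by auto
  qed
qed

lemma par_\<gamma>:
  assumes "d r v > Suc N" shows "par (\<gamma> v) = \<gamma> ` par v"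
proof
  have lv: "d r (\<gamma> v) = d r v" using level_\<gamma> assms by simp
  show "\<gamma> ` par v \<subseteq> par (\<gamma> v)"
  proof
    fix p assume "p \<in> \<gamma> ` par v"
    then obtain q where q: "q \<in> par v" "p = \<gamma> q" by blast
    have "d r v = Suc (d r q)" using par_level[OF q(1)] .
    then have "d r (\<gamma> q) = d r q" using level_\<gamma>[of q] assms by simp
    then show "p \<in> par (\<gamma> v)" using q lv Aut_E[OF \<gamma>, of q v] by (simp add: par_def)
  qed
  show "par (\<gamma> v) \<subseteq> \<gamma> ` par v"
  proof
    fix p assume p: "p \<in> par (\<gamma> v)"
    let ?q = "inv \<gamma> p"
    have pq: "\<gamma> ?q = p" using Aut_inv_right[OF \<gamma>] .
    have "d r p > N" using par_level[OF p] lv assms by simp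
    then have "d r ?q = d r p" using level_\<gamma>[of ?q] pq by simp
    moreover have "E ?q v" using par_E[OF p] Aut_E[OF \<gamma>, of ?q v] pq by simp
    ultimately have "?q \<in> par v" using par_level[OF p] lv by (simp add: par_def)
    then show "p \<in> \<gamma> ` par v" using pq by (metis imageI)
  qed
qed

text \<open>Colours survive conjugation because \<gamma> preserves balls and colours. The root stays
  fixed because \<open>Gam c n\<close> fixes both the image and the preimage of \<open>r\<close>
  under \<gamma>, each at distance \<open>d r r'\<close> from \<open>r\<close>.\<close>

lemma conj_Gam:
  assumes n: "n \<ge> N" and g: "g \<in> Gam c n"
  shows "\<gamma> \<circ> g \<circ> inv \<gamma> \<in> Gam c n" "inv \<gamma> \<circ> g \<circ> \<gamma> \<in> Gam c n"
proof -
  have A: "g \<in> Aut" using Gam_Aut[OF g] .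
  have "d r (inv \<gamma> r) = d r r'"
    using Aut_d[OF \<gamma>, of r "inv \<gamma> r"] Aut_inv_right[OF \<gamma>, of r] \<gamma>r d_sym[of r r'] by simp
  then have "g (inv \<gamma> r) = inv \<gamma> r" using good_fixes[OF good g, of "inv \<gamma> r"] N n by simp
  then have 1: "\<gamma> (g (inv \<gamma> r)) = r" using Aut_inv_right[OF \<gamma>] by simp
  have "c (\<gamma> (g (inv \<gamma> v))) = c v" if "d r v \<le> n" for v
    using Gam_col[OF g, of "inv \<gamma> v"] ball_inv[OF n, of v] that \<gamma>c inv_c by simp
  then show "\<gamma> \<circ> g \<circ> inv \<gamma> \<in> Gam c n"
    using 1 Aut_comp[OF Aut_comp[OF \<gamma> A] Aut_inv[OF \<gamma>]] unfolding Gam_def by simp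
  have "g (\<gamma> r) = \<gamma> r" using Gam_r'[OF g n] \<gamma>r by simp
  then have 2: "inv \<gamma> (g (\<gamma> r)) = r" using Aut_inv_left[OF \<gamma>] by simp
  have "c (inv \<gamma> (g (\<gamma> v))) = c v" if "d r v \<le> n" for v
    using Gam_col[OF g, of "\<gamma> v"] ball_\<gamma>[OF n, of v] that \<gamma>c inv_c by simp
  then show "inv \<gamma> \<circ> g \<circ> \<gamma> \<in> Gam c n"
    using 2 Aut_comp[OF Aut_comp[OF Aut_inv[OF \<gamma>] A] \<gamma>] unfolding Gam_def by simp
qed

lemma orb_\<gamma>: assumes n: "n \<ge> N" shows "orb c n (\<gamma> v) = \<gamma> ` orb c n v"
proof
  show "orb c n (\<gamma> v) \<subseteq> \<gamma> ` orb c n v"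
  proof
    fix x assume "x \<in> orb c n (\<gamma> v)"
    then obtain g where g: "g \<in> Gam c n" "x = g (\<gamma> v)" unfolding orb_def by auto
    have "x = \<gamma> ((inv \<gamma> \<circ> g \<circ> \<gamma>) v)" using g Aut_inv_right[OF \<gamma>] by simp
    then show "x \<in> \<gamma> ` orb c n v" using orb_I[OF conj_Gam(2)[OF n g(1)]] by (metis imageI)
  qed
  show "\<gamma> ` orb c n v \<subseteq> orb c n (\<gamma> v)"
  proof
    fix x assume "x \<in> \<gamma> ` orb c n v"
    then obtain g where g: "g \<in> Gam c n" "x = \<gamma> (g v)" unfolding orb_def by auto
    have "x = (\<gamma> \<circ> g \<circ> inv \<gamma>) (\<gamma> v)" using g Aut_inv_left[OF \<gamma>] by simp
    then show "x \<in> orb c n (\<gamma> v)" using orb_I[OF conj_Gam(1)[OF n g(1)], of "\<gamma> v"] by simp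
  qed
qed

lemma card_orb_\<gamma>: "n \<ge> N \<Longrightarrow> card (orb c n (\<gamma> v)) = card (orb c n v)"
  unfolding orb_\<gamma> using Aut_inj[OF \<gamma>] by (simp add: card_image inj_on_def)

lemma pres_orb: "n \<ge> N \<Longrightarrow> \<gamma> x \<in> orb c n u \<Longrightarrow> x \<in> orb c n u \<Longrightarrow> y \<in> orb c n u \<Longrightarrow> \<gamma> y \<in> orb c n u"
  using orb_\<gamma>[of n x] orb_eq[of x c n u] orb_eq[of "\<gamma> x" c n u] by blast

text \<open>Any witness for \<open>c'\<close> differs from \<gamma> by an element of
  \<open>Gam c n\<close>, so it sends the orbits of this group to the same places as
  \<gamma>.\<close>

lemma witness_coset:
  assumes n: "n \<ge> N" and g: "good c'" and ag: "\<And>v. d r v \<le> n \<Longrightarrow> c' v = c v"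
  shows "\<exists>h\<in>Gam c n. \<forall>v. c' (\<gamma> (h v)) = c' v"
proof -
  obtain k where k: "k \<in> Aut" "k r = r'" "\<And>v. c' (k v) = c' v" using witness[OF g] ag n by auto
  let ?h = "inv \<gamma> \<circ> k"
  have "?h r = r" using k(2) \<gamma>r Aut_inv_left[OF \<gamma>, of r] by simp
  moreover have "c (?h v) = c v" if v: "d r v \<le> n" for v
  proof -
    have "d r' (k v) \<le> n" using Aut_d[OF k(1), of r v] k(2) v by simp
    then have "d r (k v) \<le> n" using balls[OF n] by simp
    then show ?thesis using ag[of "k v"] ag[OF v] k(3)[of v] inv_c by simp
  qed
  ultimately have "?h \<in> Gam c n" unfolding Gam_def using Aut_comp[OF Aut_inv[OF \<gamma>] k(1)] by simp
  moreover have "c' (\<gamma> (?h v)) = c' v" for v using k(3) Aut_inv_right[OF \<gamma>] by simp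
  ultimately show ?thesis by blast
qed

lemma count_image:
  assumes n: "n \<ge> N" and h: "h \<in> Gam c n" and c': "\<And>v. c' (\<gamma> (h v)) = c' v"
  shows "card {v \<in> orb c n (\<gamma> u). c' v} = card {v \<in> orb c n u. c' v}"
proof -
  have A: "\<gamma> \<circ> h \<in> Aut" using Aut_comp[OF \<gamma> Gam_Aut[OF h]] .
  have "orb c n (\<gamma> u) = (\<gamma> \<circ> h) ` orb c n u"
    using orb_\<gamma>[OF n, of u] orb_image[OF h, of u] by (metis image_comp)
  then have "{v \<in> orb c n (\<gamma> u). c' v} = (\<gamma> \<circ> h) ` {v \<in> orb c n u. c' v}" using c' by auto
  moreover have "inj_on (\<gamma> \<circ> h) {v \<in> orb c n u. c' v}" using Aut_inj[OF A] unfolding inj_on_def by blast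
  ultimately show ?thesis by (simp only: card_image)
qed

lemma Gam_id_count: "n \<ge> N \<Longrightarrow> card {v \<in> orb c n (\<gamma> u). c v} = card {v \<in> orb c n u. c v}"
  using count_image[of n id c u] Gam_id \<gamma>c by simp

text \<open>If \<gamma> sends the orbit elsewhere, flip it. The image orbit keeps its colours, so
  the orbit would have the same number of black points before and after the flip.\<close>

lemma unbalanced_preserved:
  assumes n: "n \<ge> N" and u: "d r u = Suc n" and F: "unbalanced c n u"
  shows "\<gamma> u \<in> orb c n u"
proof (rule ccontr)
  assume out: "\<gamma> u \<notin> orb c n u"
  let ?c = "flip (orb c n u) c"
  have disj: "v \<notin> orb c n u" if "v \<in> orb c n (\<gamma> u)" for v
    using out orb_eq[OF that] orb_eq[of v c n u] orb_self by metis
  have ag: "?c v = c v" if "d r v \<le> n" for v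
    using that orb_level[of v c n u] u by (auto simp: flip_def)
  obtain h where h: "h \<in> Gam c n" "\<And>v. ?c (\<gamma> (h v)) = ?c v"
    using witness_coset[OF n good_of_Gam[OF Gam_flip[OF u] good] ag] by blast
  have "{v \<in> orb c n (\<gamma> u). ?c v} = {v \<in> orb c n (\<gamma> u). c v}" using disj by (auto simp: flip_def)
  then have "card {v \<in> orb c n u. ?c v} = card {v \<in> orb c n u. c v}"
    using count_image[where c' = ?c and h = h and u = u, OF n h(1) h(2)] Gam_id_count[OF n, of u] by simp
  then show False using card_flip[of "orb c n u" c] F unfolding unbalanced_def black_def by simp
qed

section \<open>Orbits that \<gamma> might not keep\<close>

definition moved :: "'a \<Rightarrow> bool" where
  "moved v \<longleftrightarrow> card (orb c (d r v) v) \<ge> 2 \<and> \<gamma> v \<notin> orb c (d r v) v"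

lemma three_set_meet:
  assumes "A \<subseteq> K" "B \<subseteq> K" "finite K" "card K \<le> 3" "card A \<ge> 2" "card B \<ge> 2"
  shows "A \<inter> B \<noteq> {}"
proof
  assume "A \<inter> B = {}"
  then have "card (A \<union> B) = card A + card B"
    using assms finite_subset by (metis card_Un_disjoint)
  moreover have "card (A \<union> B) \<le> card K" using assms by (intro card_mono) auto
  ultimately show False using assms by linarith
qed

text \<open>The orbits of \<open>v\<close> and \<open>\<gamma> v\<close> under the new group both
  lie in the set of at most three points given by \<open>isolated\<close>, since colour and black
  count are kept by the group and by \<gamma>. With at least two points each they meet, hence
  coincide.\<close>

lemma isolated_preserved:
  assumes n: "n > N" and v: "d r v = Suc n" and c2: "card (orb c (Suc n) v) \<ge> 2"
    and pres: "\<gamma> v \<in> orb c n v"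
  shows "\<gamma> v \<in> orb c (Suc n) v"
proof -
  let ?U = "orb c n v"
  define cnt where "cnt y = card {z \<in> ?U. par z = par y \<and> c z}" for y
  define K where "K = {y \<in> ?U. (\<exists>g\<in>Gam c (Suc n). g y \<noteq> y) \<and> c y = c v \<and> cnt y = cnt v}"
  have "isolated c n v" using strong_orbits(1)[OF G1 strong v] n by simp
  then have K3: "card K \<le> 3" unfolding isolated_def K_def cnt_def .
  have finK: "finite K" unfolding K_def by simp
  have lev: "d r y = Suc n" if "y \<in> ?U" for y using orb_level[OF that] v by simp
  have nontriv: "\<exists>g\<in>Gam c (Suc n). g y \<noteq> y" if "card (orb c (Suc n) y) \<ge> 2" for y
    using orb_1_iff[of c "Suc n" y] that by auto
  have cnt_f: "cnt (f y) = cnt y"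
    if f: "f \<in> Aut" "f ` ?U = ?U" "\<And>z. z \<in> ?U \<Longrightarrow> par (f z) = f ` par z" "\<And>z. z \<in> ?U \<Longrightarrow> c (f z) = c z"
      and y: "y \<in> ?U" for f y
  proof -
    have "{z \<in> ?U. par z = par (f y) \<and> c z} = f ` {z \<in> ?U. par z = par y \<and> c z}"
    proof
      show "f ` {z \<in> ?U. par z = par y \<and> c z} \<subseteq> {z \<in> ?U. par z = par (f y) \<and> c z}"
        using f y by auto
      show "{z \<in> ?U. par z = par (f y) \<and> c z} \<subseteq> f ` {z \<in> ?U. par z = par y \<and> c z}"
      proof
        fix z assume z: "z \<in> {z \<in> ?U. par z = par (f y) \<and> c z}"
        then have "z \<in> f ` ?U" using f(2) by simp
        then obtain x where x: "x \<in> ?U" "z = f x" by blast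
        have "f ` par x = f ` par y" using z x f(3)[OF x(1)] f(3)[OF y] by simp
        then have "par x = par y" using Aut_inj[OF f(1)] by (simp add: inj_image_eq_iff inj_def)
        then show "z \<in> f ` {z \<in> ?U. par z = par y \<and> c z}" using x z f(4)[OF x(1)] by auto
      qed
    qed
    moreover have "inj_on f {z \<in> ?U. par z = par y \<and> c z}" using Aut_inj[OF f(1)] by (auto simp: inj_on_def)
    ultimately show ?thesis unfolding cnt_def by (simp add: card_image)
  qed
  have sub: "orb c (Suc n) y \<subseteq> K" if y: "y \<in> ?U" "c y = c v" "cnt y = cnt v" "card (orb c (Suc n) y) \<ge> 2" for y
  proof
    fix x assume x: "x \<in> orb c (Suc n) y"
    then obtain g where g: "g \<in> Gam c (Suc n)" "x = g y" unfolding orb_def by auto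
    have g': "g \<in> Gam c n" using g Gam_Suc by blast
    have xU: "x \<in> ?U" using orb_closed[OF g' y(1)] g(2) by simp
    have cz: "c (g z) = c z" if "z \<in> ?U" for z using Gam_col[OF g(1), of z] lev[OF that] by simp
    have "cnt x = cnt y"
      unfolding g(2) by (rule cnt_f[OF Gam_Aut[OF g'] orb_image[OF g'] par_image[OF g'] cz y(1)])
    moreover have "c x = c y" using cz[OF y(1)] g(2) by simp
    moreover have "card (orb c (Suc n) x) \<ge> 2" using orb_eq[OF x] y(4) by simp
    ultimately show "x \<in> K" unfolding K_def using xU nontriv y by simp
  qed
  have \<gamma>U: "\<gamma> ` ?U = ?U" using orb_\<gamma>[of n v] orb_eq[OF pres] n by simp
  have "cnt (\<gamma> v) = cnt v"
    by (rule cnt_f[OF \<gamma> \<gamma>U par_\<gamma> \<gamma>c orb_self]) (use lev n in auto)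
  then have "orb c (Suc n) (\<gamma> v) \<subseteq> K" using sub[OF pres \<gamma>c] card_orb_\<gamma>[of "Suc n" v] c2 n by simp
  moreover have "orb c (Suc n) v \<subseteq> K" using sub[OF orb_self refl refl c2] .
  ultimately have "orb c (Suc n) (\<gamma> v) \<inter> orb c (Suc n) v \<noteq> {}"
    using three_set_meet[OF _ _ finK K3] card_orb_\<gamma>[of "Suc n" v] c2 n by simp
  then obtain x where "x \<in> orb c (Suc n) (\<gamma> v)" "x \<in> orb c (Suc n) v" by blast
  then have "orb c (Suc n) (\<gamma> v) = orb c (Suc n) v" using orb_eq by metis
  then show ?thesis using orb_self by blast
qed

text \<open>\<open>\<gamma> v\<close> is a child of \<open>\<gamma> b\<close>, and the orbit of
  \<open>v\<close> consists of all children of the orbit of \<open>b\<close>.\<close>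

lemma cover_preserved:
  assumes "cover c k v b" "\<gamma> b \<in> orb c k b" "k > N"
  shows "\<gamma> v \<in> orb c k v"
proof -
  have "b \<in> par v" using assms(1) unfolding cover_def by simp
  moreover have "d r v > Suc N" using par_level[OF calculation] assms unfolding cover_def by simp
  ultimately have "\<gamma> b \<in> par (\<gamma> v)" using par_\<gamma> by simp
  then have "\<gamma> v \<in> kids (\<gamma> b)" by (simp add: kids_def)
  then show ?thesis using assms unfolding cover_def by blast
qed

lemma pinned_trivial: "pinned c k v \<Longrightarrow> d r v = Suc k \<Longrightarrow> card (orb c (Suc k) v) = 1"
proof -
  assume P: "pinned c k v" and v: "d r v = Suc k"
  have "g v = v" if g: "g \<in> Gam c (Suc k)" for g
  proof -
    have "g \<in> Gam c k" "\<forall>x\<in>orb c k v. c (g x) = c x"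
      using g Gam_Suc v orb_level by auto
    then show ?thesis using P orb_self unfolding pinned_def by blast
  qed
  then show ?thesis using orb_1_iff by blast
qed

text \<open>By \<open>isolated_preserved\<close> already the larger orbit of \<open>v\<close> is not
  kept. This leaves the exceptional type, and then \<open>b\<close> is moved because otherwise
  \<open>v\<close> would be kept.\<close>

lemma moved_step:
  assumes m: "moved v" and v: "d r v = Suc k" and k: "k \<ge> Suc N"
  shows "\<exists>b. cover c k v b \<and> moved b"
proof -
  have c2: "card (orb c (Suc k) v) \<ge> 2" and out: "\<gamma> v \<notin> orb c (Suc k) v" using m v unfolding moved_def by auto
  have np: "\<gamma> v \<notin> orb c k v" using isolated_preserved[OF _ v c2] out k by auto
  then have "triple_orb c k v"
    using strong_orbits(2)[OF G1 strong v] unbalanced_preserved[OF _ v] pinned_trivial[OF _ v] c2 k by auto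
  then obtain b where b: "cover c k v b" using triple_orb_cover by blast
  have "\<gamma> b \<notin> orb c k b" using cover_preserved[OF b] np k by auto
  then have "moved b" using b unfolding moved_def cover_def by simp
  then show ?thesis using b by blast
qed

text \<open>The chain yields a vertex \<open>w\<close> in an unbalanced orbit below the single
  parent \<open>x\<close>. That orbit is kept, so \<gamma> fixes \<open>x\<close>. But
  \<open>x\<close> lies in the \<open>Gam c q\<close>-orbit of the moved vertex \<open>b1\<close>,
  which is then kept, and \<open>isolated_preserved\<close> passes this to
  \<open>Gam c (Suc q)\<close>.\<close>

lemma not_moved:
  assumes "d r a \<ge> N + 4" shows "\<not> moved a"
proof
  assume m: "moved a"
  obtain k where k: "d r a = N + 4 + k" using assms le_Suc_ex by blast
  define q where "q = N + 1 + k"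
  have q: "d r a = Suc (Suc (Suc q))" "q \<ge> Suc N" using k q_def by auto
  have c2: "card (orb c (Suc (Suc (Suc q))) a) \<ge> 2" using m q unfolding moved_def by simp
  have "\<exists>b1 b2 x v g. moved b1 \<and> moved b2 \<and> d r b1 = Suc q \<and> card (orb c (Suc q) b1) = 3 \<and>
    x \<in> orb c q b1 \<and> (\<forall>h\<in>Gam c (Suc q). h x = x) \<and> v \<in> orb c (Suc q) b2 \<and> g \<in> Gam c q \<and>
    par (g v) = {x} \<and> d r (g v) = Suc (Suc q) \<and> unbalanced c (Suc q) (g v)"
    by (rule triple_chain[of c "Suc N" moved, OF G1 strong moved_step m q(1) c2 q(2)]) auto
  then obtain b1 x w where *: "moved b1" "d r b1 = Suc q" "card (orb c (Suc q) b1) = 3"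
      "x \<in> orb c q b1" "\<And>h. h \<in> Gam c (Suc q) \<Longrightarrow> h x = x" "par w = {x}" "d r w = Suc (Suc q)" "unbalanced c (Suc q) w"
    by blast
  have "\<gamma> w \<in> orb c (Suc q) w" using unbalanced_preserved[OF _ *(7,8)] q by simp
  moreover have "N \<le> Suc q" using q by simp
  ultimately have "par (\<gamma> w) = {x}"
    by (intro single_par_unbalanced(2)[OF G1 _ *(7) *(6)] strong *(5)) auto
  moreover have "par (\<gamma> w) = {\<gamma> x}" using par_\<gamma>[of w] *(6,7) q by simp
  ultimately have "\<gamma> x = x" by simp
  then have "\<gamma> b1 \<in> orb c q b1" using pres_orb[of q x b1 b1] *(4) q by simp
  then have "\<gamma> b1 \<in> orb c (Suc q) b1" using isolated_preserved[OF _ *(2)] *(3) q by simp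
  then show False using *(1,2) unfolding moved_def by simp
qed

lemma nontrivial_preserved:
  "d r v \<ge> N + 4 \<Longrightarrow> card (orb c (d r v) v) \<ge> 2 \<Longrightarrow> \<gamma> v \<in> orb c (d r v) v"
  using not_moved unfolding moved_def by blast

text \<open>If \<open>a\<close> moved, each parent set would contain both \<open>a\<close> and
  \<open>g a\<close> or neither. In an orbit of at most three vertices one parent set would then
  have at least two elements and another at most one, against \<open>label_card\<close>.\<close>

lemma pinned_fixes_relevant:
  assumes g: "g \<in> Gam c n" and fx: "\<And>x. x \<in> orb c n u \<Longrightarrow> g x = x" and u: "d r u = Suc n"
    and a: "relevant c n u a"
  shows "g a = a"
proof (rule ccontr)
  assume ne: "g a \<noteq> a"
  let ?Q = "orb c n a"
  have pg: "g b \<in> par x \<longleftrightarrow> b \<in> par x" if "x \<in> orb c n u" for x b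
    using par_mem[OF g, of b x] fx[OF that] by simp
  obtain x y where xy: "x \<in> orb c n u" "y \<in> orb c n u" "a \<in> par x" "a \<notin> par y"
    using a unfolding relevant_def by blast
  have ga: "g a \<in> ?Q" using orb_I[OF g] .
  have Q3: "card ?Q \<le> 3" using G1 relevant_level[OF a] u unfolding G1_def by auto
  have "{a, g a} \<subseteq> par x \<inter> ?Q" using xy pg[OF xy(1), of a] ga by simp
  then have "card {a, g a} \<le> card (par x \<inter> ?Q)" by (intro card_mono) auto
  then have "2 \<le> card (par x \<inter> ?Q)" using ne by simp
  moreover have "par y \<inter> ?Q \<subseteq> ?Q - {a, g a}" using xy pg[OF xy(2), of a] by auto
  then have "card (par y \<inter> ?Q) \<le> card (?Q - {a, g a})" by (intro card_mono) auto
  moreover have "card (?Q - {a, g a}) = card ?Q - card {a, g a}"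
    using ga by (intro card_Diff_subset) auto
  ultimately show False using label_card[OF xy(1,2), of a] Q3 ne by simp
qed

text \<open>If the image orbit W differs from the orbit U of \<open>u\<close>, painting W white does
  not change the groups: preserving the colours of U forces \<open>g\<close> to fix U pointwise, and
  \<open>fixW\<close> transports this to W. A witness maps U, with its old colours, to the white
  orbit W; so U has no black point and is unbalanced.\<close>

lemma pinned_preserved:
  assumes n: "n \<ge> N + 4" and u: "d r u = Suc n" and P: "pinned c n u"
  shows "\<gamma> u \<in> orb c n u"
proof (rule ccontr)
  assume out: "\<gamma> u \<notin> orb c n u"
  let ?U = "orb c n u" and ?W = "orb c n (\<gamma> u)"
  have nN: "n \<ge> N" using n by simp
  have W: "?W = \<gamma> ` ?U" using orb_\<gamma>[OF nN] .
  have disj: "v \<notin> ?W" if "v \<in> ?U" for v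
    using out orb_eq[OF that] orb_eq[of v c n "\<gamma> u"] orb_self[of "\<gamma> u" c n] by auto
  have lW: "d r v = Suc n" if "v \<in> ?W" for v
    using orb_level[OF that] level_\<gamma>[of u] u nN by simp
  \<comment> \<open>Relevant vertices lie in non-trivial orbits, which \<gamma> keeps at this depth,
    and relevance is invariant under \<open>Gam c n\<close>.\<close>
  have relg: "\<gamma> a \<in> {a. relevant c n u a}" if a: "a \<in> {a. relevant c n u a}" for a
  proof -
    have ra: "relevant c n u a" using a by simp
    have la: "d r a = n" using relevant_level[OF ra] u by simp
    have "\<gamma> a \<in> orb c n a" using nontrivial_preserved[of a] relevant_orb_card[OF ra] la n by simp
    then obtain g where g: "g \<in> Gam c n" "\<gamma> a = g a" unfolding orb_def by auto
    obtain x y where "x \<in> ?U" "y \<in> ?U" "a \<in> par x" "a \<notin> par y" using ra unfolding relevant_def by blast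
    then have "g x \<in> ?U" "g y \<in> ?U" "g a \<in> par (g x)" "g a \<notin> par (g y)"
      using orb_closed[OF g(1)] par_mem[OF g(1)] by auto
    then show ?thesis using g(2) unfolding relevant_def by auto
  qed
  have "finite {a. relevant c n u a}"
    by (rule finite_subset[OF _ finite_ball[of r n]]) (use relevant_level u in force)
  moreover have "inj_on \<gamma> {a. relevant c n u a}" using Aut_inj[OF \<gamma>] by (auto simp: inj_on_def)
  ultimately have relim: "\<gamma> ` {a. relevant c n u a} = {a. relevant c n u a}"
    using relg by (intro endo_inj_surj) auto
  \<comment> \<open>By conjugation \<open>g\<close> acts at \<open>w = \<gamma> x\<close> as
    \<open>?h\<close> acts at \<open>x\<close>. Since parents separate the points of a pinned orbit,
    it is enough that \<open>g\<close> preserves the parents of \<open>w\<close>.\<close>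
  have fixW: "g w = w" if g: "g \<in> Gam c n" and fx: "\<And>x. x \<in> ?U \<Longrightarrow> g x = x" and w: "w \<in> ?W" for g w
  proof -
    obtain x where x: "x \<in> ?U" "w = \<gamma> x" using w W by blast
    have lx: "d r x = Suc n" using orb_level[OF x(1)] u by simp
    let ?h = "inv \<gamma> \<circ> g \<circ> \<gamma>"
    have h: "?h \<in> Gam c n" using conj_Gam(2)[OF nN g] .
    have gh: "g (\<gamma> b) = \<gamma> (?h b)" for b using Aut_inv_right[OF \<gamma>] by simp
    have pw: "par w = \<gamma> ` par x" using par_\<gamma>[of x] x lx n by simp
    have "g ` par w \<subseteq> par w"
    proof
      fix z assume "z \<in> g ` par w"
      then obtain a where a: "a \<in> par w" "z = g a" by blast
      then obtain b where b: "b \<in> par x" "a = \<gamma> b" using pw by blast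
      show "z \<in> par w"
      proof (cases "relevant c n u a")
        case True
        then show ?thesis using pinned_fixes_relevant[OF g fx u True] a by simp
      next
        case False
        \<comment> \<open>As \<open>b\<close> is not relevant, it is a parent of all points of the
          orbit, so also of the preimage of \<open>x\<close> under \<open>?h\<close>.\<close>
        then have nb: "\<not> relevant c n u b" using relg[of b] b by auto
        let ?y = "inv ?h x"
        have yU: "?y \<in> ?U" using orb_closed[OF Gam_inv[OF h] x(1)] .
        then have "b \<in> par ?y" using nb b(1) x(1) unfolding relevant_def by blast
        then have "?h b \<in> par (?h ?y)" using par_mem[OF h] by blast
        then have "?h b \<in> par x" unfolding Aut_inv_right[OF Gam_Aut[OF h]] .
        then show ?thesis using a b gh pw by blast
      qed
    qed
    moreover have "card (g ` par w) = card (par w)"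
      using Aut_inj[OF Gam_Aut[OF g]] by (intro card_image) (auto simp: inj_on_def)
    ultimately have "g ` par w = par w" by (intro card_subset_eq[OF finite_par])
    then have "par (g w) = par w" using par_image[OF g, of w] by simp
    moreover have gw: "g w = \<gamma> (?h x)" using gh x(2) by simp
    moreover have "par (\<gamma> (?h x)) = \<gamma> ` par (?h x)"
      using par_\<gamma>[of "?h x"] Gam_level[OF h, of x] lx n by (simp del: comp_apply)
    ultimately have "\<gamma> ` par (?h x) = \<gamma> ` par x" using pw by simp
    then have "par (?h x) = par x" using Aut_inj[OF \<gamma>] by (simp add: inj_image_eq_iff inj_def del: comp_apply)
    then have "?h x = x" using P x(1) orb_closed[OF h x(1)] unfolding pinned_def by blast
    then show ?thesis using gw x(2) by simp
  qed
  have U_fix: "g x = x"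
    if "g \<in> Gam c n" "\<forall>v\<in>?U. c (g v) = c v" "x \<in> ?U" for g x
    using P that unfolding pinned_def by blast
  define c' where "c' v = (if v \<in> ?W then False else c v)" for v
  have WG: "g v \<in> ?W \<longleftrightarrow> v \<in> ?W" if "g \<in> Gam c n" for g v
    using orb_closed[OF that] orb_closed[OF Gam_inv[OF that], of "g v"] Aut_inv_left[OF Gam_Aut[OF that]] by metis
  have lU: "d r v = Suc n" if "v \<in> ?U" for v using orb_level[OF that] u by simp
  have Gam': "Gam c' m = Gam c m" for m
  proof (rule Gam_modify)
    show "d r v = Suc n" if "c' v \<noteq> c v" for v using that lW by (auto simp: c'_def split: if_splits)
    fix g assume g: "g \<in> Gam c n"
    have off: "c' (g v) = c (g v)" "c' v = c v" if "v \<notin> ?W" for v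
      using that WG[OF g, of v] by (auto simp: c'_def)
    show "(\<forall>v. d r v = Suc n \<longrightarrow> c' (g v) = c' v) \<longleftrightarrow> (\<forall>v. d r v = Suc n \<longrightarrow> c (g v) = c v)"
    proof
      assume L: "\<forall>v. d r v = Suc n \<longrightarrow> c' (g v) = c' v"
      have "c (g v) = c v" if "v \<in> ?U" for v using L lU[OF that] off[OF disj[OF that]] by simp
      then have "g w = w" if "w \<in> ?W" for w using fixW[OF g _ that] U_fix[OF g] by blast
      then show "\<forall>v. d r v = Suc n \<longrightarrow> c (g v) = c v" using L off by metis
    next
      assume R: "\<forall>v. d r v = Suc n \<longrightarrow> c (g v) = c v"
      then show "\<forall>v. d r v = Suc n \<longrightarrow> c' (g v) = c' v" using off WG[OF g] by (simp add: c'_def)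
    qed
  qed
  have ag: "c' v = c v" if "d r v \<le> n" for v using lW[of v] that by (auto simp: c'_def)
  obtain h where h: "h \<in> Gam c n" "\<And>v. c' (\<gamma> (h v)) = c' v"
    using witness_coset[OF nN good_of_Gam[OF Gam' good] ag] by blast
  have "card {v \<in> ?W. c' v} = 0" by (simp add: c'_def)
  then have "card {v \<in> ?U. c' v} = 0"
    using count_image[where c' = c' and h = h and u = u, OF nN h(1) h(2)] by simp
  moreover have "{v \<in> ?U. c' v} = black c n u" using disj unfolding black_def c'_def by auto
  ultimately have "card (black c n u) = 0" by simp
  then have "unbalanced c n u" unfolding unbalanced_def using card_orb_pos[of c n u] by linarith
  then show False using unbalanced_preserved[OF nN u] out by simp
qed

lemma all_preserved:
  assumes n: "n \<ge> N + 4" and u: "d r u = Suc n"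
  shows "\<gamma> u \<in> orb c n u"
proof -
  have nN: "n \<ge> N" using n by simp
  consider "unbalanced c n u" | "pinned c n u" | "triple_orb c n u" using strong_orbits(2)[OF G1 strong[OF nN] u] by blast
  then show ?thesis
  proof cases
    case 1 then show ?thesis using unbalanced_preserved[OF nN u] by simp
  next
    case 2 then show ?thesis using pinned_preserved[OF n u] by simp
  next
    case 3
    then obtain b where b: "cover c n u b" using triple_orb_cover by blast
    then have "\<gamma> b \<in> orb c n b" using nontrivial_preserved[of b] n unfolding cover_def by simp
    then show ?thesis using cover_preserved[OF b] n by simp
  qed
qed

text \<open>Truncate \<gamma> to the set \<open>D\<close> of fixed points of \<open>Gam c n\<close>.
  Vertices outside \<open>D\<close> up to level n + 1 are sent into their own orbits, and the group
  fixes \<open>D\<close> pointwise; so replacing v in \<open>D\<close> by \<open>\<gamma> v\<close>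
  changes no adjacency to them. Infinite motion then gives \<open>\<gamma> r = r\<close>.\<close>

lemma absurd: False
proof -
  \<comment> \<open>Within the ball only levels n - 1 and n contain vertices outside
    \<open>D\<close>, and these levels must be at least N + 4.\<close>
  define n where "n = N + 6"
  have nN: "n \<ge> N" unfolding n_def by simp
  define D where "D = {v. d r v \<le> n \<and> (\<forall>g\<in>Gam c n. g v = v)}"
  have orbD: "orb c n v = {v}" if "v \<in> D" for v
    using that orb_self[of v c n] unfolding D_def orb_def by auto
  have \<gamma>D: "\<gamma> v \<in> D" if v: "v \<in> D" for v
  proof -
    have "card (orb c n (\<gamma> v)) = 1" using card_orb_\<gamma>[OF nN, of v] orbD[OF v] by simp
    then show ?thesis using v ball_\<gamma>[OF nN, of v] orb_1_iff unfolding D_def by blast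
  qed
  have finD: "finite D" by (rule finite_subset[OF _ finite_ball[of r n]]) (auto simp: D_def)
  have imD: "\<gamma> ` D = D"
    by (rule endo_inj_surj[OF finD]) (use \<gamma>D Aut_inj[OF \<gamma>] in \<open>auto simp: inj_on_def\<close>)
  have pres: "\<gamma> w \<in> orb c n w" if w: "w \<notin> D" "d r w \<le> Suc n" for w
  proof (cases "d r w = Suc n")
    case True
    then show ?thesis using all_preserved[of n w] n_def by simp
  next
    case False
    then have le: "d r w \<le> n" using w by simp
    have mvd: "\<not> (\<forall>g\<in>Gam c n. g w = w)" using w le unfolding D_def by simp
    then have "card (orb c n w) \<noteq> 1" using orb_1_iff by blast
    then have c2: "card (orb c n w) \<ge> 2" using card_orb_pos[of c n w] by linarith
    have "\<not> d r w + 2 \<le> n" using mvd good_fixes[OF good] by blast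
    then consider "d r w = n" | "n = Suc (d r w)" using le by linarith
    then show ?thesis
    proof cases
      case 1
      then show ?thesis using nontrivial_preserved[of w] c2 n_def by simp
    next
      case 2
      let ?m = "d r w"
      \<comment> \<open>On level n - 1 only the orbit under the larger group \<open>Gam c ?m\<close>
        is known to be kept. It has at most three points, so the two orbits under
        \<open>Gam c n\<close> inside it meet.\<close>
      have sub: "orb c n w \<subseteq> orb c ?m w" using orb_mono[of ?m n] 2 by simp
      then have "card (orb c ?m w) \<ge> 2" using c2 card_mono[OF finite_orb sub] by linarith
      then have gm: "\<gamma> w \<in> orb c ?m w" using nontrivial_preserved[of w] 2 n_def by simp
      have "orb c n (\<gamma> w) \<subseteq> orb c ?m w" using orb_mono[of ?m n c "\<gamma> w"] 2 orb_eq[OF gm] by simp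
      moreover have "card (orb c ?m w) \<le> 3" using G1[of ?m] unfolding G1_def by blast
      ultimately have "orb c n w \<inter> orb c n (\<gamma> w) \<noteq> {}"
        using three_set_meet[OF sub] c2 card_orb_\<gamma>[OF nN, of w] by simp
      then obtain x where "x \<in> orb c n w" "x \<in> orb c n (\<gamma> w)" by blast
      then have "orb c n (\<gamma> w) = orb c n w" using orb_eq by metis
      then show ?thesis using orb_self by blast
    qed
  qed
  have "\<gamma> r = r"
  proof (rule patch[OF \<gamma> finD imD])
    show "r \<in> D" unfolding D_def using Gam_r by simp
    fix v w assume v: "v \<in> D" and w: "w \<notin> D"
    show "E v w \<longleftrightarrow> E (\<gamma> v) w"
    proof (cases "d r w \<le> Suc n")
      case True
      have "orb c n w = \<gamma> ` orb c n w" using orb_\<gamma>[OF nN, of w] orb_eq[OF pres[OF w True]] by simp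
      then obtain w' where w': "w' \<in> orb c n w" "w = \<gamma> w'" using orb_self by blast
      obtain g where g: "g \<in> Gam c n" "w' = g w" using w'(1) unfolding orb_def by auto
      have "g v = v" using v g unfolding D_def by blast
      then have "E v w \<longleftrightarrow> E v w'" using Aut_E[OF Gam_Aut[OF g(1)], of v w] g(2) by simp
      then show ?thesis using Aut_E[OF \<gamma>, of v w'] w'(2) by simp
    next
      case False
      have "d r v \<le> n" "d r (\<gamma> v) \<le> n" using v \<gamma>D[OF v] unfolding D_def by auto
      then show ?thesis using d_edge[of v w r] d_edge[of "\<gamma> v" w r] False by linarith
    qed
  qed
  then show False using \<gamma>r ne by simp
qed

end

context rooted_graph begin

section \<open>Removing the images of the root one by one\<close>

definition killed :: "('a \<Rightarrow> bool) \<Rightarrow> 'a \<Rightarrow> bool" where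
  "killed c r' \<longleftrightarrow> \<not> (\<exists>g\<in>Aut. g r = r' \<and> (\<forall>v. c (g v) = c v))"

text \<open>Making the colouring strong from M on leaves it unchanged up to level N. If no good
  extension destroyed the automorphisms to \<open>r'\<close>, this would be the situation of
  \<open>stuck\<close> for every radius K \<ge> M.\<close>

lemma kill:
  assumes c: "good c" and ne: "r' \<noteq> r"
  shows "\<exists>c'. good c' \<and> (\<forall>v. d r v \<le> N \<longrightarrow> c' v = c v) \<and> killed c' r'"
proof (rule ccontr)
  assume no: "\<not> ?thesis"
  define M where "M = max N (d r r' + 2)"
  obtain c1 where c1: "\<And>v. d r v \<le> M \<Longrightarrow> c1 v = c v" "\<And>n. n \<ge> M \<Longrightarrow> strong c1 n" "good c1"
    using extend[of M c] c unfolding good_def by blast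
  have stuck: "stuck E r c1 K r'" if K: "K \<ge> M" for K
  proof unfold_locales
    show "r' \<noteq> r" "good c1" by fact+
    show "strong c1 n" if "n \<ge> K" for n using c1(2) that K by simp
    show "d r r' + 2 \<le> K" using K by (simp add: M_def)
    show "\<exists>g\<in>Aut. g r = r' \<and> (\<forall>v. c' (g v) = c' v)"
      if c': "good c'" and a: "\<And>v. d r v \<le> K \<Longrightarrow> c' v = c1 v" for c'
    proof -
      have "c' v = c v" if "d r v \<le> N" for v using that a[of v] c1(1)[of v] K by (simp add: M_def)
      then show ?thesis using no c' unfolding killed_def by blast
    qed
  qed
  then interpret s: stuck E r c1 M r' by simp
  obtain K where K: "\<And>n v. n \<ge> K \<Longrightarrow> d r v \<le> n \<longleftrightarrow> d r' v \<le> n" using s.equal_balls by blast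
  obtain g where g: "g \<in> Aut" "g r = r'" "\<And>v. c1 (g v) = c1 v" using s.witness[of c1] c1(3) by blast
  \<comment> \<open>The same colouring, with the radius raised so that the balls agree from it
    on.\<close>
  interpret t: stuck E r c1 "max M K" r' using stuck by simp
  have "tame E r c1 (max M K) r' g" using K g by unfold_locales auto
  then show False by (rule tame.absurd)
qed

text \<open>Compactness: the maps \<open>G M\<close> send a ball around \<open>r\<close> to a finite
  ball around \<open>r'\<close>, so infinitely many of them agree on it. Agreement on growing balls
  defines f, which is an automorphism because any two vertices are seen by a single
  \<open>G M\<close>.\<close>

lemma limit_aut:
  assumes G: "\<And>M::nat. G M \<in> Aut" "\<And>M. G M r = r'"
  shows "\<exists>f\<in>Aut. \<forall>n K. \<exists>M\<ge>K. \<forall>v. d r v \<le> n \<longrightarrow> G M v = f v"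
proof -
  let ?I = "\<lambda>n h. {M. \<forall>v. d r v \<le> n \<longrightarrow> G M v = h v}"
  have "\<exists>F. \<forall>n. infinite (?I n (F n)) \<and> (\<forall>v. d r v \<le> n \<longrightarrow> F (Suc n) v = F n v)"
  proof (rule dependent_nat_choice)
    have "?I 0 (\<lambda>v. r') = UNIV" using G(2) by auto
    then have "infinite (?I 0 (\<lambda>v. r'))" by simp
    then show "\<exists>h. infinite (?I 0 h)" by (rule exI[of "\<lambda>h. infinite (?I 0 h)"])
  next
    fix h n assume h: "infinite (?I n h)"
    \<comment> \<open>Outside the ball the maps take the dummy value \<open>r\<close>, so only
      finitely many restrictions exist.\<close>
    let ?b = "\<lambda>M v. if v \<in> {v. d r v \<le> Suc n} then G M v else r"
    have lev: "d r' (G M v) = d r v" for M v using Aut_d[OF G(1), of M r v] G(2) by simp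
    have "?b ` ?I n h \<subseteq> {f. \<forall>v. (v \<in> {v. d r v \<le> Suc n} \<longrightarrow> f v \<in> {v. d r' v \<le> Suc n})
        \<and> (v \<notin> {v. d r v \<le> Suc n} \<longrightarrow> f v = r)}"
      by (auto simp: lev)
    then have "finite (?b ` ?I n h)"
      by (rule finite_subset[OF _ finite_set_of_finite_funs[OF finite_ball finite_ball]])
    from pigeonhole_infinite[OF h this] obtain M0
      where M0: "M0 \<in> ?I n h" "infinite {M \<in> ?I n h. ?b M = ?b M0}" by blast
    have "G M v = G M0 v" if "?b M = ?b M0" "d r v \<le> Suc n" for M v
      using fun_cong[OF that(1), of v] that(2) by simp
    then have "{M \<in> ?I n h. ?b M = ?b M0} \<subseteq> ?I (Suc n) (G M0)" by blast
    then have "infinite (?I (Suc n) (G M0))" using M0(2) infinite_super by blast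
    then show "\<exists>h'. infinite (?I (Suc n) h') \<and> (\<forall>v. d r v \<le> n \<longrightarrow> h' v = h v)"
      using M0(1) by blast
  qed
  then obtain F where F: "\<And>n. infinite (?I n (F n))"
    "\<And>n v. d r v \<le> n \<Longrightarrow> F (Suc n) v = F n v" by blast
  define f where "f v = F (d r v) v" for v
  have F': "F n v = f v" if "d r v \<le> n" for n v
    using that
  proof (induction n rule: dec_induct)
    case (step n) then show ?case using F(2)[of v n] by simp
  qed (simp add: f_def)
  have near: "\<exists>M\<ge>K. \<forall>v. d r v \<le> n \<longrightarrow> G M v = f v" for n K
  proof -
    obtain M where "M \<ge> K" "M \<in> ?I n (F n)" using F(1)[of n] by (meson infinite_nat_iff_unbounded_le)
    then show ?thesis using F' by auto
  qed
  have two: "\<exists>M. G M u = f u \<and> G M v = f v" for u v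
    using near[of 0 "max (d r u) (d r v)"] by (meson max.cobounded1 max.cobounded2)
  have "f u = f v \<longleftrightarrow> u = v" for u v using two[of u v] Aut_inj[OF G(1)] by metis
  then have "inj f" by (simp add: inj_def)
  moreover have "\<exists>x. y = f x" for y
  proof -
    obtain M where M: "\<And>v. d r v \<le> d r' y \<Longrightarrow> G M v = f v" using near by blast
    obtain x where x: "y = G M x" using Aut_inv_right[OF G(1)] by metis
    have "d r x = d r' y" using Aut_d[OF G(1), of M r x] G(2) x by simp
    then show ?thesis using M[of x] x by auto
  qed
  then have "surj f" by (auto simp: surj_def)
  moreover have "E u v \<longleftrightarrow> E (f u) (f v)" for u v using two[of u v] Aut_E[OF G(1)] by metis
  ultimately have "f \<in> Aut" unfolding Aut_def graph_aut_def bij_def by blast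
  then show ?thesis using near by blast
qed

text \<open>Otherwise each radius admits an automorphism to \<open>r'\<close> that preserves
  \<open>c\<close> wherever a vertex and its image are within this radius; a limit of these
  preserves \<open>c\<close> everywhere.\<close>

lemma killed_robust:
  assumes "killed c r'"
  shows "\<exists>M. \<forall>c'. (\<forall>v. d r v \<le> M \<longrightarrow> c' v = c v) \<longrightarrow> killed c' r'"
proof (rule ccontr)
  assume "\<not> ?thesis"
  then have "\<exists>c' g. (\<forall>v. d r v \<le> M \<longrightarrow> c' v = c v) \<and> g \<in> Aut \<and> g r = r' \<and> (\<forall>v. c' (g v) = c' v)" for M
    unfolding killed_def by blast
  then have "\<exists>g. g \<in> Aut \<and> g r = r' \<and> (\<forall>v. d r v \<le> M \<and> d r (g v) \<le> M \<longrightarrow> c (g v) = c v)" for M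
    by metis
  then obtain G where G: "\<And>M. G M \<in> Aut" "\<And>M. G M r = r'"
    "\<And>M v. d r v \<le> M \<Longrightarrow> d r (G M v) \<le> M \<Longrightarrow> c (G M v) = c v" by metis
  obtain f where f: "f \<in> Aut" "\<And>n K. \<exists>M\<ge>K. \<forall>v. d r v \<le> n \<longrightarrow> G M v = f v"
    using limit_aut[of G r'] G by blast
  have "c (f v) = c v" for v
  proof -
    obtain M where "M \<ge> max (d r v) (d r (f v))" "G M v = f v" using f(2)[of "max (d r v) (d r (f v))" "d r v"] by blast
    then show ?thesis using G(3)[of v M] by simp
  qed
  moreover have "f r = r'" using f(2)[of 0 0] G(2) by auto
  ultimately show False using assms f(1) unfolding killed_def by blast
qed

lemma countable_vertices: "countable (UNIV :: 'a set)"
proof -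
  have "countable (\<Union>n. {v. d r v \<le> n})" by (intro countable_UN countable_finite finite_ball countableI_type)
  moreover have "(\<Union>n. {v. d r v \<le> n}) = UNIV" by auto
  ultimately show ?thesis by simp
qed

text \<open>A pair of a colouring and a radius is refined: each step destroys the automorphisms to
  one more vertex, and the radius freezes the part of the colouring responsible for this. The limit
  is good because \<open>G1\<close> and \<open>G2\<close> depend on finitely many levels, and
  goodness disposes of the automorphisms fixing \<open>r\<close>.\<close>

theorem rigid_colouring: "\<exists>c :: 'a \<Rightarrow> bool. \<forall>g\<in>Aut. (\<forall>v. c (g v) = c v) \<longrightarrow> g = id"
proof -
  define e :: "nat \<Rightarrow> 'a" where "e = from_nat_into UNIV"
  have "range e = UNIV" unfolding e_def by (rule range_from_nat_into[OF UNIV_not_empty countable_vertices])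
  then have e: "\<exists>i. e i = v" for v by (metis UNIV_I imageE)
  let ?Q = "\<lambda>i x y. snd x < snd y \<and> (\<forall>v. d r v \<le> snd x \<longrightarrow> fst y v = fst x v) \<and>
    (e i \<noteq> r \<longrightarrow> (\<forall>c. (\<forall>v. d r v \<le> snd y \<longrightarrow> c v = fst y v) \<longrightarrow> killed c (e i)))"
  have "\<exists>f :: nat \<Rightarrow> ('a \<Rightarrow> bool) \<times> nat. \<forall>i. good (fst (f i)) \<and> ?Q i (f i) (f (Suc i))"
  proof (rule dependent_nat_choice)
    show "\<exists>x :: ('a \<Rightarrow> bool) \<times> nat. good (fst x)" using extend[of 0 undefined] G1_0 by auto
  next
    fix x :: "('a \<Rightarrow> bool) \<times> nat" and i assume x: "good (fst x)"
    show "\<exists>y :: ('a \<Rightarrow> bool) \<times> nat. good (fst y) \<and> ?Q i x y"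
    proof (cases "e i = r")
      case True
      then show ?thesis using x by (intro exI[of _ "(fst x, Suc (snd x))"]) auto
    next
      case False
      obtain c' where c': "good c'" "\<forall>v. d r v \<le> snd x \<longrightarrow> c' v = fst x v" "killed c' (e i)"
        using kill[OF x False] by blast
      obtain M where M: "\<forall>c. (\<forall>v. d r v \<le> M \<longrightarrow> c v = c' v) \<longrightarrow> killed c (e i)"
        using killed_robust[OF c'(3)] by blast
      show ?thesis using c' M by (intro exI[of _ "(c', max M (Suc (snd x)))"]) auto
    qed
  qed
  then obtain f :: "nat \<Rightarrow> ('a \<Rightarrow> bool) \<times> nat" where f: "\<And>i. good (fst (f i))" "\<And>i. ?Q i (f i) (f (Suc i))" by blast
  define C where "C i = fst (f i)" for i
  define B where "B i = snd (f i)" for i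
  have B_less: "B i < B (Suc i)" for i using f(2)[of i] unfolding B_def by blast
  have C_step: "C (Suc i) v = C i v" if "d r v \<le> B i" for i v
    using f(2)[of i] that unfolding B_def C_def by blast
  have C_killed: "killed c (e i)" if "e i \<noteq> r" "\<And>v. d r v \<le> B (Suc i) \<Longrightarrow> c v = C (Suc i) v" for i c
    using f(2)[of i] that unfolding B_def C_def by blast
  have mono: "strict_mono B" using B_less by (simp add: strict_mono_Suc_iff)
  have B: "i \<le> B i" for i by (rule strict_mono_imp_increasing[OF mono])
  have agree: "C j v = C i v" if "i \<le> j" "d r v \<le> B i" for i j v
    using that(1)
  proof (induction j rule: dec_induct)
    case (step j)
    have "B i \<le> B j" using step.hyps(1) mono by (simp add: strict_mono_less_eq)
    then have "d r v \<le> B j" using that(2) by simp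
    then show ?case using C_step[of v j] step.IH by simp
  qed simp
  \<comment> \<open>Since i \<le> \<open>B i\<close>, the colours on level i are final from stage i
    on.\<close>
  define c where "c v = C (d r v) v" for v
  have c: "c v = C i v" if "d r v \<le> B i" for i v
  proof (cases "d r v \<le> i")
    case True then show ?thesis using agree[of "d r v" i v] B[of "d r v"] by (simp add: c_def)
  next
    case False then show ?thesis using agree[of i "d r v" v] that by (simp add: c_def)
  qed
  have "G1 c n" for n
    using G1_cong[of n c "C n"] f(1)[of n] c[of _ n] B[of n] unfolding good_def C_def by simp
  moreover have "G2 c n" for n
    using G2_cong[of n c "C (Suc n)"] f(1)[of "Suc n"] c[of _ "Suc n"] B[of "Suc n"] unfolding good_def C_def by simp
  ultimately have good: "good c" unfolding good_def by blast
  have "g v = v" if g: "g \<in> Aut" "\<And>v. c (g v) = c v" for g v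
  proof -
    obtain i where i: "e i = g r" using e by blast
    have "g r = r"
    proof (rule ccontr)
      assume "g r \<noteq> r"
      then have "killed c (g r)" using C_killed[of i c] c[of _ "Suc i"] i by simp
      then show False using g unfolding killed_def by blast
    qed
    then have "g \<in> Gam c (d r v + 2)" using g unfolding Gam_def by simp
    then show ?thesis using good_fixes[OF good] by blast
  qed
  then show ?thesis by (intro exI[of _ c]) (auto simp: fun_eq_iff)
qed

end

theorem theorem1p2:
  fixes E :: "'a \<Rightarrow> 'a \<Rightarrow> bool"
  assumes "simple_graph E"
      and "connected_graph E"
      and "max_degree_le E 5"
      and "infinite_motion E"
  shows "(\<exists>c. distinguishing_colouring E 2 c) \<and> distinguishing_number E \<le> 2"
proof -
  \<comment> \<open>Any vertex can serve as the root.\<close>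
  interpret rooted_graph E undefined by unfold_locales (fact assms)+
  obtain c :: "'a \<Rightarrow> bool" where c: "\<And>g. g \<in> Aut \<Longrightarrow> (\<And>v. c (g v) = c v) \<Longrightarrow> g = id"
    using rigid_colouring by blast
  have "distinguishing_colouring E 2 (of_bool \<circ> c)"
    unfolding distinguishing_colouring_def
  proof (intro conjI allI impI)
    fix g assume g: "graph_aut E g \<and> of_bool \<circ> c \<circ> g = (of_bool \<circ> c :: 'a \<Rightarrow> nat)"
    have "c (g v) = c v" for v
      using fun_cong[OF conjunct2[OF g], of v] by (simp add: of_bool_eq_iff)
    then show "g = id" using c g by (simp add: Aut_def)
  qed simp
  then show ?thesis unfolding distinguishing_number_def by (auto intro: Least_le)
qed

end
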